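(* Let $C$ be an extended Choquet cone with an abundance of compact idempotents. Then $C$ is strongly connected if and only if $\mathrm{Lsc}_\sigma(C)$ has weak cancellation.
   Context: A cone is an abelian monoid $(C,+)$ with a scalar multiplication $(0,\infty)\times C\to C$ that is additive in each variable and satisfies $s(tx)=(st)x$ and $1\cdot x=x$ (cancellation is not assumed). The algebraic preorder: $x\le y$ iff $x+z=y$ for some $z\in C$; $C$ is algebraically ordered if this is a partial order. A topological cone has a topology making addition and scalar multiplication $(0,\infty)\times C\to C$ jointly continuous. An extended Choquet cone is an algebraically ordered topological cone $C$ that is a lattice under the algebraic order with addition distributing over $\wedge$ and $\vee$, and whose topology is compact, Hausdorff and locally convex (has a basis of open convex sets). Such cones are complete lattices. $\mathrm{Idem}(C)=\{w\in C:2w=w\}$; $w\in\mathrm{Idem}(C)$ is compact if whenever $(v_i)_i$ is a decreasing net in $\mathrm{Idem}(C)$ with $\inf_i v_i\le w$, there is $i_0$ with $v_{i_0}\le w$. $C$ has an abundance of compact idempotents if every idempotent is an infimum of compact idempotents. $C$ is strongly connected if $\{x\in C:x\le w\}$ is connected for every $w\in\mathrm{Idem}(C)$. $\mathrm{Lsc}_\sigma(C)$ is the set of linear (additive, homogeneous for positive scalars, $0\mapsto 0$) lower semicontinuous functions $f\colon C\to[0,\infty]$ such that $f^{-1}((a,\infty])$ is $\sigma$-compact for all $a\in[0,\infty)$, with pointwise operations and order; it is closed under pointwise suprema of increasing sequences. For $f,g$ in $S=\mathrm{Lsc}_\sigma(C)$, $f\ll g$ means: whenever $(g_n)_{n\ge1}$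 is an increasing sequence in $S$ with $g\le\sup_n g_n$, there is $n_0$ with $f\le g_{n_0}$. $S$ has weak cancellation if $x+z\ll y+z$ implies $x\ll y$ for all $x,y,z\in S$. *)

theory Defs
  imports "HOL-Analysis.Analysis" "HOL-Library.Lub_Glb"
begin

section \<open>Cones\<close>

text \<open>Scalars range over the open half-line: the values of \<open>t *\<^sub>R x\<close> for \<open>t \<le> 0\<close> are junk, and
  nothing below depends on them.\<close>

class abstract_cone = scaleR + comm_monoid_add +
  assumes cone_scale_add_right: "0 < s \<Longrightarrow> s *\<^sub>R (x + y) = s *\<^sub>R x + s *\<^sub>R y"
    and cone_scale_add_left: "0 < s \<Longrightarrow> 0 < t \<Longrightarrow> (s + t) *\<^sub>R x = s *\<^sub>R x + t *\<^sub>R x"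
    and cone_scale_scale: "0 < s \<Longrightarrow> 0 < t \<Longrightarrow> s *\<^sub>R (t *\<^sub>R x) = (s * t) *\<^sub>R x"
    and cone_scale_one: "1 *\<^sub>R x = x"

definition (in abstract_cone) cone_convex :: "'a set \<Rightarrow> bool" where
  "cone_convex S \<longleftrightarrow> (\<forall>x\<in>S. \<forall>y\<in>S. \<forall>t\<in>{0<..<1}. t *\<^sub>R x + (1 - t) *\<^sub>R y \<in> S)"

text \<open>Joint continuity is expressed through neighbourhood filters, as in
  \<open>topological_monoid_add\<close>, because the product topology is not available inside a class
  specification; see \<open>continuous_on_cone_scale\<close>.\<close>

class topological_cone = abstract_cone + topological_comm_monoid_add +
  assumes tendsto_cone_scale_Pair:
    "0 < t \<Longrightarrow> LIM p (nhds t \<times>\<^sub>F nhds x). fst p *\<^sub>R snd p :> nhds (t *\<^sub>R x)"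

lemma continuous_on_cone_scale:
  "continuous_on ({0<..} \<times> UNIV) (\<lambda>(t, x::'a::topological_cone). t *\<^sub>R x)"
proof -
  have "((\<lambda>(t, x). t *\<^sub>R x) \<longlongrightarrow> t *\<^sub>R x) (at (t, x) within {0<..} \<times> UNIV)"
    if "0 < t" for t and x :: 'a
    using tendsto_mono[OF at_within_le_nhds tendsto_cone_scale_Pair[OF that, of x, folded nhds_prod]]
    by (simp add: case_prod_unfold)
  then show ?thesis
    by (auto simp: continuous_on_def)
qed

text \<open>The class \<open>canonically_ordered_monoid_add\<close> says that \<open>\<le>\<close> is a partial order and
  coincides with the algebraic preorder.\<close>

class extended_choquet_cone =
  topological_cone + canonically_ordered_monoid_add + lattice + t2_space +
  assumes add_inf_distrib: "x + inf y z = inf (x + y) (x + z)"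
    and add_sup_distrib: "x + sup y z = sup (x + y) (x + z)"
    and compact_cone: "compact UNIV"
    and locally_convex_cone: "\<exists>B. topological_basis B \<and> (\<forall>V\<in>B. cone_convex V)"


section \<open>Idempotents\<close>

definition Idem :: "'a::abstract_cone set" where
  "Idem = {w. 2 *\<^sub>R w = w}"

text \<open>A decreasing net enters only through its range, which is a nonempty downward directed
  set; conversely such a set is a decreasing net indexed by itself. The lemma
  \<open>compact_idempotent_net\<close> below recovers the formulation with nets over an arbitrary index type.
  The infimum is that of the whole cone.\<close>

definition compact_idempotent :: "'a::extended_choquet_cone \<Rightarrow> bool" where
  "compact_idempotent w \<longleftrightarrow> w \<in> Idem \<and>
    (\<forall>D m. D \<subseteq> Idem \<and> D \<noteq> {} \<and> (\<forall>u\<in>D. \<forall>v\<in>D. \<exists>x\<in>D. x \<le> u \<and> x \<le> v) \<and>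
       isGlb UNIV D m \<and> m \<le> w \<longrightarrow> (\<exists>v\<in>D. v \<le> w))"

lemma compact_idempotent_net:
  fixes v :: "'i \<Rightarrow> 'a::extended_choquet_cone" and le :: "'i \<Rightarrow> 'i \<Rightarrow> bool"
  assumes "compact_idempotent w"
    and "\<And>i j. \<exists>k. le i k \<and> le j k"
    and "\<And>i j. le i j \<Longrightarrow> v j \<le> v i"
    and "\<And>i. v i \<in> Idem"
    and "isGlb UNIV (range v) m" and "m \<le> w"
  shows "\<exists>i. v i \<le> w"
proof -
  have "\<forall>a\<in>range v. \<forall>b\<in>range v. \<exists>x\<in>range v. x \<le> a \<and> x \<le> b"
    using assms(2,3) by auto meson
  moreover have "range v \<subseteq> Idem" "range v \<noteq> {}"
    using assms(4) by auto
  ultimately have "\<exists>x\<in>range v. x \<le> w"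
    using assms(1,5,6) unfolding compact_idempotent_def by metis
  then show ?thesis by auto
qed

definition abundance_of_compact_idempotents :: "'a::extended_choquet_cone itself \<Rightarrow> bool" where
  "abundance_of_compact_idempotents _ \<longleftrightarrow>
    (\<forall>w\<in>Idem. \<exists>K::'a set. (\<forall>v\<in>K. compact_idempotent v) \<and> isGlb UNIV K w)"

definition strongly_connected :: "'a::extended_choquet_cone itself \<Rightarrow> bool" where
  "strongly_connected _ \<longleftrightarrow> (\<forall>w::'a\<in>Idem. connected {x. x \<le> w})"


section \<open>Linear lower semicontinuous functions\<close>

definition sigma_compact :: "'a::topological_space set \<Rightarrow> bool" where
  "sigma_compact A \<longleftrightarrow> (\<exists>K::nat \<Rightarrow> 'a set. (\<forall>n. compact (K n)) \<and> A = (\<Union>n. K n))"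

definition cone_linear :: "('a::abstract_cone \<Rightarrow> ennreal) \<Rightarrow> bool" where
  "cone_linear f \<longleftrightarrow> f 0 = 0 \<and> (\<forall>x y. f (x + y) = f x + f y) \<and>
    (\<forall>t>0. \<forall>x. f (t *\<^sub>R x) = ennreal t * f x)"

definition lower_semicontinuous :: "('a::topological_space \<Rightarrow> ennreal) \<Rightarrow> bool" where
  "lower_semicontinuous f \<longleftrightarrow> (\<forall>a. open {x. a < f x})"

definition Lsc_sigma :: "('a::topological_cone \<Rightarrow> ennreal) set" where
  "Lsc_sigma = {f. cone_linear f \<and> lower_semicontinuous f \<and>
    (\<forall>a<\<infinity>. sigma_compact {x. a < f x})}"

text \<open>Way-below relation and weak cancellation for a set \<open>S\<close> of functions with pointwise addition
  and order. The supremum is pointwise; when \<open>S\<close> is closed under pointwise suprema of increasing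
  sequences, as \<open>Lsc_sigma\<close> is, it is the supremum in \<open>S\<close>.\<close>

definition way_below :: "('a \<Rightarrow> ennreal) set \<Rightarrow> ('a \<Rightarrow> ennreal) \<Rightarrow> ('a \<Rightarrow> ennreal) \<Rightarrow> bool" where
  "way_below S f g \<longleftrightarrow>
    (\<forall>h::nat \<Rightarrow> 'a \<Rightarrow> ennreal. range h \<subseteq> S \<and> incseq h \<and> g \<le> (SUP n. h n) \<longrightarrow> (\<exists>n. f \<le> h n))"

definition weak_cancellation :: "('a \<Rightarrow> ennreal) set \<Rightarrow> bool" where
  "weak_cancellation S \<longleftrightarrow>
    (\<forall>f\<in>S. \<forall>g\<in>S. \<forall>h\<in>S.
       way_below S (\<lambda>x. f x + h x) (\<lambda>x. g x + h x) \<longrightarrow> way_below S f g)"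

end

theory Submission
  imports Defs "HOL-Library.Function_Algebras"
begin

text \<open>Everything rests on a supply of functions in \<open>Lsc_sigma\<close>: if \<open>K\<close> is compact and \<open>w\<close> is an
  idempotent above no point of \<open>K\<close>, then some \<open>s\<close> is positive on \<open>K\<close> and bounded near \<open>w\<close>. By
  abundance it suffices to treat compact \<open>w\<close>. Then \<open>w\<close> has a neighbourhood without larger
  idempotents, which yields an upper semicontinuous linear \<open>k\<^sub>0\<close> vanishing exactly below \<open>w\<close>. Linear
  functionals come from a sandwich theorem: a minimal sublinear functional above a given lower bound
  is linear, and lower semicontinuous if the bound is. Interpolation below a multiple of a gauge gives
  \<open>k\<^sub>0 \<le> f\<^sub>0 \<le> h\<^sub>0 \<le> f\<^sub>1 \<le> h\<^sub>1 \<le> \<dots>\<close> with \<open>f\<^sub>n\<close> lower and \<open>h\<^sub>n\<close> upper semicontinuous, and their common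
  supremum \<open>s\<close> is lower semicontinuous with \<open>\<sigma>\<close>-compact sets \<open>{a < s}\<close>.

  If \<open>f + h\<close> is way below \<open>g + h\<close> and \<open>g\<close> is the supremum of an increasing sequence, then some member
  \<open>g'\<close> of the sequence satisfies \<open>f + h \<le> (1 - \<delta>) (g' + h)\<close> and \<open>f + h \<le> g' + H\<close>, where \<open>H\<close> is
  finite near every point at which \<open>h\<close> is finite. When \<open>g' x < \<infinity>\<close>, these make \<open>{y \<le> x. h y < \<infinity>}\<close>
  relatively clopen in \<open>{y. y \<le> x}\<close>. By strong connectedness it contains the largest idempotent below
  \<open>x\<close>, hence \<open>x\<close> itself, and \<open>h x\<close> can be cancelled.

  Conversely, if strong connectedness fails, there are idempotents \<open>e\<close> and \<open>v\<close> such that \<open>e\<close> is not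
  below \<open>v\<close> but every \<open>z < e\<close> is. Take \<open>s\<close> with \<open>s e = \<infinity>\<close> and \<open>s < 1\<close> near \<open>v\<close>, and \<open>g\<close> with
  \<open>g e = 0\<close> and \<open>g \<ge> 4\<close> on the rest of \<open>{s \<le> 2}\<close>. Then \<open>s + s\<close> is way below \<open>g + s\<close>, although
  \<open>s \<le> g\<close> fails at \<open>e\<close>.\<close>

section \<open>Sandwich theorems for linear functionals on cones\<close>

text \<open>This and the pointwise structure below make \<open>'i \<Rightarrow> real\<close> a cone,
  so that the sandwich theorem can also be applied to vectors of coefficients, in
  \<open>interpolation_real\<close>.\<close>

instance real :: abstract_cone
  by standard (simp_all add: algebra_simps)

instantiation "fun" :: (type, abstract_cone) abstract_cone
begin

definition scaleR_fun :: "real \<Rightarrow> ('a \<Rightarrow> 'b) \<Rightarrow> 'a \<Rightarrow> 'b" where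
  "scaleR_fun t f = (\<lambda>x. t *\<^sub>R f x)"

instance
  by standard (simp_all add: scaleR_fun_def fun_eq_iff cone_scale_add_right cone_scale_add_left
      cone_scale_scale cone_scale_one)

end

lemma cone_scale_inverse:
  fixes x :: "'a::abstract_cone"
  assumes "0 < t"
  shows "t *\<^sub>R ((1 / t) *\<^sub>R x) = x" and "(1 / t) *\<^sub>R (t *\<^sub>R x) = x"
  using assms by (simp_all add: cone_scale_scale cone_scale_one)

text \<open>The cone axioms do not say how \<open>0\<close> scales. For
  \<open>x = (1 / t) *\<^sub>R 0\<close>, scaling \<open>x = x + 0\<close> by \<open>t\<close> gives
  \<open>0\<close> on one side and \<open>0 + t *\<^sub>R 0\<close> on the other.\<close>

lemma cone_scale_zero:
  assumes "0 < t"
  shows "t *\<^sub>R (0::'a::abstract_cone) = 0"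
proof -
  have "t *\<^sub>R (0::'a) = t *\<^sub>R ((1 / t) *\<^sub>R 0 + 0)"
    using assms cone_scale_add_right[OF assms, of "(1 / t) *\<^sub>R (0::'a)" 0]
    by (simp add: cone_scale_inverse)
  then show ?thesis
    using assms by (simp add: cone_scale_inverse)
qed

definition subcone :: "'a::abstract_cone set \<Rightarrow> bool" where
  "subcone D \<longleftrightarrow> 0 \<in> D \<and> (\<forall>x\<in>D. \<forall>y\<in>D. x + y \<in> D) \<and> (\<forall>t>0. \<forall>x\<in>D. t *\<^sub>R x \<in> D)"

definition sublinear_on :: "'a::abstract_cone set \<Rightarrow> ('a \<Rightarrow> real) \<Rightarrow> bool" where
  "sublinear_on D f \<longleftrightarrow> (\<forall>x\<in>D. \<forall>y\<in>D. f (x + y) \<le> f x + f y) \<and>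
    (\<forall>t>0. \<forall>x\<in>D. f (t *\<^sub>R x) = t * f x)"

definition linear_on_cone :: "'a::abstract_cone set \<Rightarrow> ('a \<Rightarrow> real) \<Rightarrow> bool" where
  "linear_on_cone D f \<longleftrightarrow> (\<forall>x\<in>D. \<forall>y\<in>D. f (x + y) = f x + f y) \<and>
    (\<forall>t>0. \<forall>x\<in>D. f (t *\<^sub>R x) = t * f x)"

lemma linear_on_cone_imp_sublinear_on: "linear_on_cone D f \<Longrightarrow> sublinear_on D f"
  by (auto simp: linear_on_cone_def sublinear_on_def)

lemma linear_on_cone_uminus: "linear_on_cone D f \<Longrightarrow> linear_on_cone D (\<lambda>x. - f x)"
  by (auto simp: linear_on_cone_def)

text \<open>A lower bound \<open>P\<close> for sublinear functionals is given as a relation: \<open>P x c\<close> demands the value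
  \<open>c\<close> at least at \<open>x\<close>, and there is no demand at \<open>x\<close> if \<open>P x c\<close> for no \<open>c\<close>. So a partially defined
  superlinear functional can be encoded without the value \<open>-\<infinity>\<close>.\<close>

locale lower_bound =
  fixes D :: "'a::abstract_cone set" and P :: "'a \<Rightarrow> real \<Rightarrow> bool"
  assumes subcone: "subcone D"
    and P_add: "\<And>x y c d. x \<in> D \<Longrightarrow> y \<in> D \<Longrightarrow> P x c \<Longrightarrow> P y d \<Longrightarrow> P (x + y) (c + d)"
    and P_scale: "\<And>t x c. 0 < t \<Longrightarrow> x \<in> D \<Longrightarrow> P x c \<Longrightarrow> P (t *\<^sub>R x) (t * c)"
    and P_absorbing: "\<And>x. x \<in> D \<Longrightarrow> \<exists>y\<in>D. \<exists>c. P (x + y) c"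
begin

definition above :: "('a \<Rightarrow> real) \<Rightarrow> bool" where
  "above f \<longleftrightarrow> (\<forall>x\<in>D. \<forall>c. P x c \<longrightarrow> c \<le> f x)"

lemma D_add: "x \<in> D \<Longrightarrow> y \<in> D \<Longrightarrow> x + y \<in> D"
  and D_scale: "0 < t \<Longrightarrow> x \<in> D \<Longrightarrow> t *\<^sub>R x \<in> D"
  and D_zero: "0 \<in> D"
  using subcone by (auto simp: subcone_def)

text \<open>\<open>R\<close> collects upper estimates that can be added and scaled, so its infimum
  is sublinear. \<open>P_absorbing\<close> keeps the infimum finite: a demand at
  \<open>x + y\<close> and one fixed estimate at \<open>y\<close> bound all estimates at
  \<open>x\<close> from below.\<close>

lemma sublinear_on_Inf:
  fixes R :: "'a \<Rightarrow> real \<Rightarrow> bool"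
  assumes R_ex: "\<And>x. x \<in> D \<Longrightarrow> \<exists>c. R x c"
    and R_add: "\<And>x y c d. x \<in> D \<Longrightarrow> y \<in> D \<Longrightarrow> R x c \<Longrightarrow> R y d \<Longrightarrow> R (x + y) (c + d)"
    and R_scale: "\<And>t x c. 0 < t \<Longrightarrow> x \<in> D \<Longrightarrow> R x c \<Longrightarrow> R (t *\<^sub>R x) (t * c)"
    and R_P: "\<And>x c d. x \<in> D \<Longrightarrow> R x c \<Longrightarrow> P x d \<Longrightarrow> d \<le> c"
  defines "g \<equiv> (\<lambda>x. Inf {c. R x c})"
  shows "sublinear_on D g \<and> above g \<and> (\<forall>x\<in>D. \<forall>c. R x c \<longrightarrow> g x \<le> c)"
proof -
  have bdd: "bdd_below {c. R x c}" if "x \<in> D" for x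
  proof -
    obtain y c where y: "y \<in> D" "P (x + y) c"
      using P_absorbing[OF \<open>x \<in> D\<close>] by blast
    obtain d where d: "R y d"
      using R_ex[OF y(1)] by blast
    have "c - d \<le> b" if "R x b" for b
      using R_P[OF D_add[OF \<open>x \<in> D\<close> y(1)] R_add[OF \<open>x \<in> D\<close> y(1) that d] y(2)] by simp
    then show ?thesis by (intro bdd_belowI[of _ "c - d"]) simp
  qed
  have le: "g x \<le> c" if "x \<in> D" "R x c" for x c
    unfolding g_def using bdd that by (intro cInf_lower) auto
  have ge: "b \<le> g x" if "x \<in> D" "\<And>c. R x c \<Longrightarrow> b \<le> c" for x b
    unfolding g_def using R_ex[OF that(1)] that(2) by (intro cInf_greatest) auto
  have "above g"
    unfolding above_def using R_P by (blast intro: ge)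
  have "g (x + y) \<le> g x + g y" if "x \<in> D" "y \<in> D" for x y
  proof -
    have "g (x + y) - c \<le> g y" if c: "R x c" for c
    proof (rule ge[OF \<open>y \<in> D\<close>])
      fix d assume "R y d"
      with that le[OF D_add R_add] \<open>x \<in> D\<close> \<open>y \<in> D\<close> show "g (x + y) - c \<le> d"
        by (fastforce simp: algebra_simps)
    qed
    then have "g (x + y) - g y \<le> g x"
      by (intro ge[OF \<open>x \<in> D\<close>]) (simp add: algebra_simps)
    then show ?thesis by simp
  qed
  moreover have half: "g (t *\<^sub>R x) \<le> t * g x" if "0 < t" "x \<in> D" for t x
  proof -
    have "g (t *\<^sub>R x) / t \<le> g x"
    proof (rule ge[OF \<open>x \<in> D\<close>])
      fix c assume "R x c"
      then have "g (t *\<^sub>R x) \<le> t * c"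
        using that by (intro le D_scale R_scale)
      then show "g (t *\<^sub>R x) / t \<le> c"
        using \<open>0 < t\<close> by (simp add: field_simps)
    qed
    then show ?thesis
      using \<open>0 < t\<close> by (simp add: field_simps)
  qed
  moreover have "g (t *\<^sub>R x) = t * g x" if "0 < t" "x \<in> D" for t x
  proof (rule antisym[OF half[OF that]])
    have "g x \<le> 1 / t * g (t *\<^sub>R x)"
      using half[of "1 / t" "t *\<^sub>R x"] that D_scale by (simp add: cone_scale_inverse)
    then show "t * g x \<le> g (t *\<^sub>R x)"
      using that by (simp add: field_simps)
  qed
  ultimately have "sublinear_on D g"
    by (simp add: sublinear_on_def)
  with \<open>above g\<close> le show ?thesis by blast
qed

definition minimal :: "('a \<Rightarrow> real) \<Rightarrow> bool" where
  "minimal f \<longleftrightarrow> sublinear_on D f \<and> above f \<and>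
    (\<forall>g. sublinear_on D g \<and> above g \<and> (\<forall>x\<in>D. g x \<le> f x) \<longrightarrow> (\<forall>x\<in>D. g x = f x))"

text \<open>Zorn's lemma, with pointwise infima as lower bounds of chains. Values outside
  \<open>D\<close> are normalised to \<open>0\<close>, which makes the pointwise order of functions
  the order on \<open>D\<close>.\<close>

lemma minimal_sublinear_exists:
  assumes q: "sublinear_on D q" "above q"
  obtains f where "minimal f" "\<And>x. x \<in> D \<Longrightarrow> f x \<le> q x"
proof -
  let ?A = "{f. sublinear_on D f \<and> above f \<and> (\<forall>x\<in>D. f x \<le> q x) \<and> (\<forall>x. x \<notin> D \<longrightarrow> f x = 0)}"
  let ?r = "\<lambda>f x. if x \<in> D then f x else (0::real)"
  have r: "sublinear_on D (?r f) \<longleftrightarrow> sublinear_on D f" "above (?r f) \<longleftrightarrow> above f" for f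
    by (simp_all add: sublinear_on_def above_def D_add D_scale)
  have "\<exists>m\<in>?A. \<forall>a\<in>?A. a \<le> m \<longrightarrow> a = m"
  proof (rule predicate_Zorn)
    show "partial_order_on ?A (relation_of (\<ge>) ?A)"
      by (rule partial_order_on_relation_ofI) auto
    fix C assume "C \<in> Chains (relation_of (\<ge>) ?A)"
    then have C: "C \<subseteq> ?A" and chain: "\<And>f g. f \<in> C \<Longrightarrow> g \<in> C \<Longrightarrow> f \<le> g \<or> g \<le> f"
      by (auto simp: Chains_def relation_of_def)
    show "\<exists>u\<in>?A. \<forall>a\<in>C. u \<le> a"
    proof (cases "C = {}")
      case True
      then show ?thesis
        using q by (intro bexI[of _ "?r q"]) (auto simp: r)
    next
      case False
      define g where "g x = Inf {c. \<exists>f\<in>C. f x \<le> c}" for x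
      have g: "sublinear_on D g \<and> above g \<and> (\<forall>x\<in>D. \<forall>c. (\<exists>f\<in>C. f x \<le> c) \<longrightarrow> g x \<le> c)"
        unfolding g_def
      proof (rule sublinear_on_Inf)
        show "\<exists>c. \<exists>f\<in>C. f x \<le> c" for x
          using False by blast
      next
        \<comment> \<open>In a chain a single member serves both \<open>x\<close> and
          \<open>y\<close>, so its own subadditivity can be used.\<close>
        fix x y c d assume *: "x \<in> D" "y \<in> D" "\<exists>f\<in>C. f x \<le> c" "\<exists>f\<in>C. f y \<le> d"
        then obtain f g where "f \<in> C" "f x \<le> c" "g \<in> C" "g y \<le> d" by blast
        moreover from this have "f \<le> g \<or> g \<le> f"
          by (intro chain)
        ultimately obtain h where h: "h \<in> C" "h x \<le> c" "h y \<le> d"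
          by (meson le_funD order_trans)
        then have "h (x + y) \<le> h x + h y"
          using * C by (auto simp: sublinear_on_def)
        with h show "\<exists>f\<in>C. f (x + y) \<le> c + d"
          by (intro bexI[of _ h]) auto
      next
        fix t :: real and x c assume *: "0 < t" "x \<in> D" "\<exists>f\<in>C. f x \<le> c"
        then obtain f where f: "f \<in> C" "f x \<le> c" by blast
        then have "f (t *\<^sub>R x) = t * f x"
          using * C by (auto simp: sublinear_on_def)
        with * f show "\<exists>f\<in>C. f (t *\<^sub>R x) \<le> t * c"
          by (intro bexI[of _ f]) auto
      next
        fix x c d assume "x \<in> D" "\<exists>f\<in>C. f x \<le> c" "P x d"
        then show "d \<le> c"
          using C unfolding above_def by fastforce
      qed
      have le: "g x \<le> f x" if "x \<in> D" "f \<in> C" for f x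
        using that g by blast
      moreover obtain f0 where "f0 \<in> C" using False by blast
      ultimately have "g x \<le> q x" if "x \<in> D" for x
        using that C by (force intro: order_trans)
      moreover have "?r g \<le> f" if "f \<in> C" for f
        using le that C by (auto simp: le_fun_def)
      ultimately show ?thesis
        using g by (intro bexI[of _ "?r g"]) (auto simp: r)
    qed
  qed
  then obtain m where m: "m \<in> ?A" "\<And>a. a \<in> ?A \<Longrightarrow> a \<le> m \<Longrightarrow> a = m" by blast
  have "minimal m"
    unfolding minimal_def
  proof (intro conjI allI impI ballI)
    fix g x assume g: "sublinear_on D g \<and> above g \<and> (\<forall>x\<in>D. g x \<le> m x)" and "x \<in> D"
    have "?r g = m"
      using g m(1) by (intro m(2)) (auto simp: r le_fun_def intro: order_trans)
    from fun_cong[OF this, of x] show "g x = m x"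
      using \<open>x \<in> D\<close> by simp
  qed (use m in auto)
  with m show thesis by (intro that[of m]) auto
qed

text \<open>Lower \<open>f\<close> along the ray of \<open>a\<close>: \<open>g x\<close> is the
  infimum of \<open>f (x + r *\<^sub>R a) - r * h\<close> over \<open>r \<ge> 0\<close>. The
  assumption on the constant \<open>h\<close> keeps \<open>g\<close> above \<open>P\<close>, so
  minimality gives \<open>g = f\<close> on \<open>D\<close>, and \<open>r = 1\<close> yields the
  claim.\<close>

lemma minimal_perturbation:
  assumes f: "minimal f" and "a \<in> D" "x \<in> D"
    and h: "\<And>x c r. 0 < r \<Longrightarrow> x \<in> D \<Longrightarrow> P x c \<Longrightarrow> c + r * h \<le> f (x + r *\<^sub>R a)"
  shows "f x + h \<le> f (x + a)"
proof -
  \<comment> \<open>The value \<open>r = 0\<close> gets its own clause, because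
    \<open>0 *\<^sub>R a\<close> is junk.\<close>
  define M where "M r y \<longleftrightarrow> r = 0 \<and> y = 0 \<or> 0 < r \<and> y = r *\<^sub>R a" for r :: real and y
  define R where "R x c \<longleftrightarrow> (\<exists>r y. M r y \<and> f (x + y) \<le> c + r * h)" for x c
  define g where "g x = Inf {c. R x c}" for x
  have f_sub: "sublinear_on D f" "above f"
    using f by (auto simp: minimal_def)
  have M_add: "M (r + s) (y + z)" if "M r y" "M s z" for r s y z
    using that by (auto simp: M_def cone_scale_add_left)
  have M_scale: "M (t * r) (t *\<^sub>R y)" if "0 < t" "M r y" for t r y
    using that by (auto simp: M_def cone_scale_scale cone_scale_zero)
  have M_D: "y \<in> D" if "M r y" for r y
    using that \<open>a \<in> D\<close> by (auto simp: M_def D_scale D_zero)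
  have R_f: "R x (f x)" for x
    unfolding R_def M_def by (intro exI[of _ 0]) simp
  have g: "sublinear_on D g \<and> above g \<and> (\<forall>x\<in>D. \<forall>c. R x c \<longrightarrow> g x \<le> c)"
    unfolding g_def
  proof (rule sublinear_on_Inf)
    show "\<exists>c. R x c" for x
      using R_f by blast
  next
    fix x y c d assume "x \<in> D" "y \<in> D" "R x c" "R y d"
    then obtain r u s v where 1: "M r u" "f (x + u) \<le> c + r * h"
      and 2: "M s v" "f (y + v) \<le> d + s * h"
      unfolding R_def by blast
    have "f ((x + y) + (u + v)) = f ((x + u) + (y + v))"
      by (simp add: ac_simps)
    also have "\<dots> \<le> f (x + u) + f (y + v)"
      using f_sub 1 2 M_D \<open>x \<in> D\<close> \<open>y \<in> D\<close> by (simp add: sublinear_on_def D_add)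
    also have "\<dots> \<le> (c + d) + (r + s) * h"
      using 1 2 by (simp add: algebra_simps)
    finally show "R (x + y) (c + d)"
      unfolding R_def using M_add 1 2 by blast
  next
    fix t :: real and x c assume "0 < t" "x \<in> D" "R x c"
    then obtain r u where 1: "M r u" "f (x + u) \<le> c + r * h"
      unfolding R_def by blast
    have "f (t *\<^sub>R x + t *\<^sub>R u) = t * f (x + u)"
      using f_sub \<open>0 < t\<close> \<open>x \<in> D\<close> M_D 1
      by (simp add: sublinear_on_def D_add flip: cone_scale_add_right)
    also have "\<dots> \<le> t * (c + r * h)"
      using 1 \<open>0 < t\<close> by simp
    also have "\<dots> = t * c + (t * r) * h"
      by (simp add: algebra_simps)
    finally show "R (t *\<^sub>R x) (t * c)"
      unfolding R_def using M_scale 1 \<open>0 < t\<close> by blast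
  next
    fix x c d assume "x \<in> D" "R x c" "P x d"
    then obtain r u where 1: "M r u" "f (x + u) \<le> c + r * h"
      unfolding R_def by blast
    then have "d + r * h \<le> f (x + u)"
      using h[of r x d] \<open>x \<in> D\<close> \<open>P x d\<close> f_sub(2) by (auto simp: M_def above_def)
    with 1 show "d \<le> c" by simp
  qed
  have "g x = f x"
    using f g R_f \<open>x \<in> D\<close> by (simp add: minimal_def)
  have "M 1 a"
    by (simp add: M_def cone_scale_one)
  then have "R x (f (x + a) - h)"
    unfolding R_def by (intro exI[of _ 1] exI[of _ a]) simp
  then have "g x \<le> f (x + a) - h"
    using g \<open>x \<in> D\<close> by blast
  then show ?thesis
    by (simp add: \<open>g x = f x\<close>)
qed

text \<open>Perturbing \<open>f\<close> in the direction of \<open>a\<close> first gives \<open>f x + c \<le> f (x + a)\<close> whenever \<open>P a c\<close>;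
  this is what keeps the second perturbation above \<open>P\<close>.\<close>

lemma minimal_imp_linear:
  assumes f: "minimal f"
  shows "linear_on_cone D f"
proof -
  have sub: "sublinear_on D f" "above f"
    using f by (auto simp: minimal_def)
  have step: "f x + c \<le> f (x + a)" if "a \<in> D" "x \<in> D" "P a c" for a x c
  proof (rule minimal_perturbation[OF f that(1,2)])
    fix y d and r :: real assume "0 < r" "y \<in> D" "P y d"
    with that have "P (y + r *\<^sub>R a) (d + r * c)"
      by (intro P_add P_scale D_scale)
    then show "d + r * c \<le> f (y + r *\<^sub>R a)"
      using sub(2) \<open>y \<in> D\<close> \<open>0 < r\<close> \<open>a \<in> D\<close> by (simp add: above_def D_add D_scale)
  qed
  have "f x + f a \<le> f (x + a)" if "a \<in> D" "x \<in> D" for a x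
  proof (rule minimal_perturbation[OF f that(1,2)])
    fix y d and r :: real assume "0 < r" "y \<in> D" "P y d"
    then show "d + r * f a \<le> f (y + r *\<^sub>R a)"
      using step[of y "r *\<^sub>R a" d] sub(1) that
      by (simp add: sublinear_on_def D_scale add.commute)
  qed
  then show ?thesis
    using sub(1) by (simp add: linear_on_cone_def sublinear_on_def antisym)
qed

lemma linear_sandwich:
  assumes "sublinear_on D q" "above q"
  obtains f where "linear_on_cone D f" "above f" "\<And>x. x \<in> D \<Longrightarrow> f x \<le> q x"
proof (rule minimal_sublinear_exists[OF assms])
  fix f assume "minimal f" "\<And>x. x \<in> D \<Longrightarrow> f x \<le> q x"
  then show thesis
    by (intro that[of f] minimal_imp_linear) (auto simp: minimal_def)
qed

end

section \<open>Semicontinuous versions of the sandwich theorem\<close>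

definition lsc_on :: "'a::topological_space set \<Rightarrow> ('a \<Rightarrow> real) \<Rightarrow> bool" where
  "lsc_on D f \<longleftrightarrow> (\<forall>x\<in>D. \<forall>c<f x. \<exists>N. open N \<and> x \<in> N \<and> (\<forall>y\<in>N \<inter> D. c < f y))"

definition usc_on :: "'a::topological_space set \<Rightarrow> ('a \<Rightarrow> real) \<Rightarrow> bool" where
  "usc_on D f \<longleftrightarrow> (\<forall>x\<in>D. \<forall>c>f x. \<exists>N. open N \<and> x \<in> N \<and> (\<forall>y\<in>N \<inter> D. f y < c))"

lemma usc_on_uminus: "lsc_on D f \<Longrightarrow> usc_on D (\<lambda>x. - f x)"
  unfolding lsc_on_def usc_on_def by (simp add: minus_less_iff)

lemma continuous_on_cone_scale_left:
  assumes "0 < t"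
  shows "continuous_on UNIV (\<lambda>x::'a::topological_cone. t *\<^sub>R x)"
proof -
  have "continuous_on UNIV (\<lambda>x::'a. (\<lambda>(t, x). t *\<^sub>R x) (t, x))"
    using assms by (intro continuous_on_compose2[OF continuous_on_cone_scale])
      (auto intro!: continuous_intros)
  then show ?thesis by simp
qed

lemma open_scale_vimage:
  assumes "open U" "0 < t"
  shows "open {x::'a::topological_cone. t *\<^sub>R x \<in> U}"
  using open_vimage[OF assms(1) continuous_on_cone_scale_left[OF assms(2)]] by (simp add: vimage_def)

lemma open_add_vimage:
  assumes "open U"
  shows "open {x::'a::topological_cone. x + a \<in> U}"
  using open_vimage[OF assms, of "\<lambda>x. x + a"] by (simp add: vimage_def continuous_intros)

locale lsc_lower_bound = lower_bound D P
  for D :: "'a::topological_cone set" and P :: "'a \<Rightarrow> real \<Rightarrow> bool" +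
  assumes P_lsc: "\<And>x c d. x \<in> D \<Longrightarrow> P x c \<Longrightarrow> d < c \<Longrightarrow> \<exists>N. open N \<and> x \<in> N \<and> (\<forall>y\<in>N \<inter> D. P y d)"
begin

text \<open>A minimal functional coincides with its lower semicontinuous regularisation, since the latter
  is sublinear by continuity of the addition and stays above \<open>P\<close>.\<close>

lemma minimal_imp_lsc:
  assumes f: "minimal f"
  shows "lsc_on D f"
proof -
  have sub: "sublinear_on D f" "above f"
    using f by (auto simp: minimal_def)
  define S where "S x = {c. \<exists>N. open N \<and> x \<in> N \<and> (\<forall>y\<in>N \<inter> D. c \<le> f y)}" for x
  define g where "g x = Sup (S x)" for x
  have S_le: "c \<le> f x" if "c \<in> S x" "x \<in> D" for x c
    using that by (auto simp: S_def)
  \<comment> \<open>For \<open>z\<close> near \<open>x\<close>, the sum \<open>z + y\<close> is near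
    \<open>x + y\<close>, where \<open>P\<close> still demands \<open>c - 1\<close>; subadditivity
    turns this into a local lower bound for \<open>f z\<close>.\<close>
  have ne: "S x \<noteq> {}" if x: "x \<in> D" for x
  proof -
    obtain y c where y: "y \<in> D" "P (x + y) c"
      using P_absorbing[OF x] by blast
    then obtain N where N: "open N" "x + y \<in> N" "\<And>z. z \<in> N \<inter> D \<Longrightarrow> P z (c - 1)"
      using P_lsc[of "x + y" c "c - 1"] x by (auto simp: D_add)
    have "c - 1 - f y \<le> f z" if "z + y \<in> N" "z \<in> D" for z
    proof -
      have "c - 1 \<le> f (z + y)"
        using N(3)[of "z + y"] that y(1) sub(2) by (simp add: above_def D_add)
      also have "\<dots> \<le> f z + f y"
        using sub(1) that y(1) by (simp add: sublinear_on_def)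
      finally show ?thesis by simp
    qed
    then have "c - 1 - f y \<in> S x"
      unfolding S_def using N(2) open_add_vimage[OF N(1), of y]
      by (auto intro!: exI[of _ "{z. z + y \<in> N}"])
    then show ?thesis by blast
  qed
  have le_g: "c \<le> g x" if "c \<in> S x" "x \<in> D" for x c
    unfolding g_def using that S_le by (intro cSup_upper bdd_aboveI[of _ "f x"])
  have g_le: "g x \<le> b" if "x \<in> D" "\<And>c. c \<in> S x \<Longrightarrow> c \<le> b" for x b
    unfolding g_def using ne[OF that(1)] that(2) by (intro cSup_least)
  have "g (x + y) \<le> g x + g y" if x: "x \<in> D" and y: "y \<in> D" for x y
  proof (rule g_le[OF D_add[OF x y]])
    fix c assume "c \<in> S (x + y)"
    then obtain N where N: "open N" "x + y \<in> N" "\<And>z. z \<in> N \<inter> D \<Longrightarrow> c \<le> f z"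
      by (auto simp: S_def)
    have "open {p::'a \<times> 'a. fst p + snd p \<in> N}"
      using open_vimage[OF N(1), of "\<lambda>p. fst p + snd p"] by (simp add: vimage_def continuous_intros)
    moreover have "(x, y) \<in> {p. fst p + snd p \<in> N}"
      using N(2) by simp
    ultimately obtain A B where AB: "open A" "x \<in> A" "open B" "y \<in> B"
      "A \<times> B \<subseteq> {p. fst p + snd p \<in> N}"
      by (rule open_prod_elim) auto
    have "c \<le> f v + f w" if "v \<in> A \<inter> D" "w \<in> B \<inter> D" for v w
    proof -
      have "c \<le> f (v + w)"
        using N(3) AB(5) that by (force simp: D_add)
      also have "\<dots> \<le> f v + f w"
        using sub(1) that by (simp add: sublinear_on_def)
      finally show ?thesis .
    qed
    \<comment> \<open>The two suprema are taken one after the other: first near \<open>x\<close>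
      with \<open>w\<close> fixed, then near \<open>y\<close>.\<close>
    then have "c - f w \<in> S x" if "w \<in> B \<inter> D" for w
      unfolding S_def using AB that by (force simp: algebra_simps)
    then have "c - f w \<le> g x" if "w \<in> B \<inter> D" for w
      using le_g x that by blast
    then have "c - g x \<in> S y"
      unfolding S_def using AB by (force simp: algebra_simps)
    then show "c \<le> g x + g y"
      using le_g[OF _ y] by fastforce
  qed
  moreover have half: "g (t *\<^sub>R x) \<ge> t * g x" if t: "0 < t" and x: "x \<in> D" for t x
  proof -
    have "g x \<le> g (t *\<^sub>R x) / t"
    proof (rule g_le[OF x])
      fix c assume "c \<in> S x"
      then obtain N where N: "open N" "x \<in> N" "\<And>z. z \<in> N \<inter> D \<Longrightarrow> c \<le> f z"
        by (auto simp: S_def)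
      have "t * c \<le> f z" if "(1 / t) *\<^sub>R z \<in> N" "z \<in> D" for z
      proof -
        have "c \<le> f ((1 / t) *\<^sub>R z)"
          using that t by (intro N(3)) (simp add: D_scale)
        also have "\<dots> = 1 / t * f z"
          using sub(1) that t by (simp add: sublinear_on_def)
        finally show ?thesis
          using t by (simp add: field_simps)
      qed
      moreover have "open {z. (1 / t) *\<^sub>R z \<in> N}"
        using t N(1) by (intro open_scale_vimage) auto
      ultimately have "t * c \<in> S (t *\<^sub>R x)"
        unfolding S_def using N(2) t
        by (auto intro!: exI[of _ "{z. (1 / t) *\<^sub>R z \<in> N}"] simp: cone_scale_inverse)
      then have "t * c \<le> g (t *\<^sub>R x)"
        using x t by (intro le_g D_scale)
      then show "c \<le> g (t *\<^sub>R x) / t"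
        using t by (simp add: field_simps)
    qed
    then show ?thesis
      using t by (simp add: field_simps)
  qed
  moreover have "g (t *\<^sub>R x) = t * g x" if t: "0 < t" and x: "x \<in> D" for t x
  proof (rule antisym[OF _ half[OF that]])
    have "1 / t * g (t *\<^sub>R x) \<le> g x"
      using half[of "1 / t" "t *\<^sub>R x"] that D_scale by (simp add: cone_scale_inverse)
    then show "g (t *\<^sub>R x) \<le> t * g x"
      using t by (simp add: field_simps)
  qed
  ultimately have "sublinear_on D g"
    by (simp add: sublinear_on_def)
  moreover have "above g"
    unfolding above_def
  proof (intro ballI allI impI)
    fix x c assume x: "x \<in> D" and "P x c"
    show "c \<le> g x"
    proof (rule dense_le)
      fix d assume "d < c"
      from P_lsc[OF x \<open>P x c\<close> this]
      obtain N where "open N" "x \<in> N" "\<forall>y\<in>N \<inter> D. P y d"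
        by (elim exE conjE)
      moreover from this have "\<forall>y\<in>N \<inter> D. d \<le> f y"
        using sub(2) by (simp add: above_def)
      ultimately have "d \<in> S x"
        unfolding S_def by (intro CollectI exI[of _ N]) simp
      then show "d \<le> g x"
        using le_g x by blast
    qed
  qed
  moreover have "g x \<le> f x" if "x \<in> D" for x
    using that S_le by (intro g_le)
  ultimately have g_eq: "g x = f x" if "x \<in> D" for x
    using f that by (simp add: minimal_def)
  show ?thesis
    unfolding lsc_on_def
  proof (intro ballI allI impI)
    fix x c assume x: "x \<in> D" and "c < f x"
    then have "c < Sup (S x)"
      using g_eq[OF x] by (simp add: g_def)
    then obtain d where "d \<in> S x" "c < d"
      using ne[OF x] by (rule less_cSupE)
    then obtain N where "open N" "x \<in> N" "\<And>y. y \<in> N \<inter> D \<Longrightarrow> d \<le> f y"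
      by (auto simp: S_def)
    with \<open>c < d\<close> show "\<exists>N. open N \<and> x \<in> N \<and> (\<forall>y\<in>N \<inter> D. c < f y)"
      by (intro exI[of _ N]) force
  qed
qed

lemma lsc_linear_sandwich:
  assumes "sublinear_on D q" "above q"
  obtains f where "linear_on_cone D f" "lsc_on D f" "above f" "\<And>x. x \<in> D \<Longrightarrow> f x \<le> q x"
proof (rule minimal_sublinear_exists[OF assms])
  fix f assume "minimal f" "\<And>x. x \<in> D \<Longrightarrow> f x \<le> q x"
  then show thesis
    by (intro that[of f] minimal_imp_linear minimal_imp_lsc) (auto simp: minimal_def)
qed

end

text \<open>The lower semicontinuous sandwich applied to negatives: \<open>- q\<close> becomes the
  lower bound and \<open>- f\<close> the sublinear functional above it.\<close>

lemma usc_linear_sandwich: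
  fixes D :: "'a::topological_cone set"
  assumes D: "subcone D" and f: "linear_on_cone D f" and q: "sublinear_on D q" "usc_on D q"
    and le: "\<And>x. x \<in> D \<Longrightarrow> f x \<le> q x"
  obtains h where "linear_on_cone D h" "usc_on D h"
    "\<And>x. x \<in> D \<Longrightarrow> f x \<le> h x" "\<And>x. x \<in> D \<Longrightarrow> h x \<le> q x"
proof -
  interpret lsc_lower_bound D "\<lambda>x c. c \<le> - q x"
  proof
    fix x c d assume "x \<in> D" "c \<le> - q x" "d < c"
    then have "q x < - d" by simp
    with q(2) \<open>x \<in> D\<close> have "\<exists>N. open N \<and> x \<in> N \<and> (\<forall>y\<in>N \<inter> D. q y < - d)"
      unfolding usc_on_def by simp
    then obtain N where "open N" "x \<in> N" "\<forall>y\<in>N \<inter> D. q y < - d"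
      by (elim exE conjE)
    then show "\<exists>N. open N \<and> x \<in> N \<and> (\<forall>y\<in>N \<inter> D. d \<le> - q y)"
      by (intro exI[of _ N]) force
  next
    fix x y c d assume "x \<in> D" "y \<in> D" "c \<le> - q x" "d \<le> - q y"
    moreover from this have "q (x + y) \<le> q x + q y"
      using q(1) by (simp add: sublinear_on_def)
    ultimately show "c + d \<le> - q (x + y)" by linarith
  next
    fix t :: real and x c assume "0 < t" "x \<in> D" "c \<le> - q x"
    moreover from this have "q (t *\<^sub>R x) = t * q x"
      using q(1) by (simp add: sublinear_on_def)
    ultimately show "t * c \<le> - q (t *\<^sub>R x)"
      using mult_left_mono[of c "- q x" t] by simp
  next
    show "\<exists>y\<in>D. \<exists>c. c \<le> - q (x + y)" if "x \<in> D" for x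
      using that by (intro bexI[of _ x] exI[of _ "- q (x + x)"]) auto
  qed (rule D)
  have "above (\<lambda>x. - f x)"
    using le by (force simp: above_def)
  then obtain h where h: "linear_on_cone D h" "lsc_on D h" "above h"
    "\<And>x. x \<in> D \<Longrightarrow> h x \<le> - f x"
    using lsc_linear_sandwich[OF linear_on_cone_imp_sublinear_on[OF linear_on_cone_uminus[OF f]]]
    by blast
  show thesis
  proof (rule that)
    show "f x \<le> - h x" if "x \<in> D" for x
      using h(4)[OF that] by simp
    show "- h x \<le> q x" if "x \<in> D" for x
      using h(3) that by (force simp: above_def)
  qed (use h linear_on_cone_uminus usc_on_uminus in auto)
qed

section \<open>Order and topology of extended Choquet cones\<close>

lemma cone_scale_mono:
  fixes x y :: "'a::extended_choquet_cone"
  assumes "0 < t" "x \<le> y"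
  shows "t *\<^sub>R x \<le> t *\<^sub>R y"
  using assms by (auto simp: le_iff_add cone_scale_add_right)

lemma cone_scale_mono_left:
  fixes x :: "'a::extended_choquet_cone"
  assumes "0 < s" "s \<le> t"
  shows "s *\<^sub>R x \<le> t *\<^sub>R x"
proof (cases "s = t")
  case False
  then have "t *\<^sub>R x = s *\<^sub>R x + (t - s) *\<^sub>R x"
    using assms cone_scale_add_left[of s "t - s" x] by simp
  then show ?thesis
    by (auto simp: le_iff_add)
qed simp

lemma le_add_left_cone: "x \<le> x + (y::'a::extended_choquet_cone)"
  by (auto simp: le_iff_add)

lemma closed_imp_compact: "closed S \<Longrightarrow> compact (S::'a::extended_choquet_cone set)"
  using compact_Int_closed[OF compact_cone, of S] by simp

lemma compact_finite_subcover:
  assumes S: "compact S" and B: "\<And>y. y \<in> S \<Longrightarrow> open (B y) \<and> y \<in> B y"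
  shows "\<exists>T. finite T \<and> T \<subseteq> S \<and> S \<subseteq> (\<Union>y\<in>T. B y)"
proof -
  have "S \<subseteq> (\<Union>y\<in>S. B y)"
    using B by auto
  show ?thesis
    by (rule compactE_image[OF S _ \<open>S \<subseteq> (\<Union>y\<in>S. B y)\<close>]) (use B in auto)
qed

text \<open>The order is the image of the compact square of the cone under the continuous map
  sending \<open>(x, z)\<close> to \<open>(x, x + z)\<close>.\<close>

lemma closed_le: "closed {p::'a::extended_choquet_cone \<times> 'a. fst p \<le> snd p}"
proof -
  have "compact ((\<lambda>p::'a \<times> 'a. (fst p, fst p + snd p)) ` (UNIV \<times> UNIV))"
    by (intro compact_continuous_image compact_Times compact_cone continuous_intros)
  also have "(\<lambda>p::'a \<times> 'a. (fst p, fst p + snd p)) ` (UNIV \<times> UNIV) = {p. fst p \<le> snd p}"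
    by (force simp: image_iff le_iff_add)
  finally show ?thesis
    by (rule compact_imp_closed)
qed

lemma not_le_nhds:
  fixes x z :: "'a::extended_choquet_cone"
  assumes "\<not> x \<le> z"
  obtains A B where "open A" "x \<in> A" "open B" "z \<in> B" "\<And>a b. a \<in> A \<Longrightarrow> b \<in> B \<Longrightarrow> \<not> a \<le> b"
proof -
  have "open (- {p::'a \<times> 'a. fst p \<le> snd p})"
    using closed_le by (rule open_Compl)
  moreover have "(x, z) \<in> - {p. fst p \<le> snd p}"
    using assms by simp
  ultimately obtain A B where "open A" "x \<in> A" "open B" "z \<in> B"
    "A \<times> B \<subseteq> - {p. fst p \<le> snd p}"
    by (rule open_prod_elim) auto
  then show thesis
    by (intro that[of A B]) auto
qed

lemma closed_le_right: "closed {y. y \<le> (x::'a::extended_choquet_cone)}"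
  unfolding closed_def open_subopen[of "- {y. y \<le> x}"]
proof
  fix y assume "y \<in> - {y. y \<le> x}"
  then obtain A B where "open A" "y \<in> A" "open B" "x \<in> B" "\<And>a b. a \<in> A \<Longrightarrow> b \<in> B \<Longrightarrow> \<not> a \<le> b"
    using not_le_nhds[of y x] by auto
  then show "\<exists>T. open T \<and> y \<in> T \<and> T \<subseteq> - {y. y \<le> x}"
    by (intro exI[of _ A]) auto
qed

lemma closed_le_left: "closed {y. (x::'a::extended_choquet_cone) \<le> y}"
  unfolding closed_def open_subopen[of "- {y. x \<le> y}"]
proof
  fix y assume "y \<in> - {y. x \<le> y}"
  then obtain A B where "open A" "x \<in> A" "open B" "y \<in> B" "\<And>a b. a \<in> A \<Longrightarrow> b \<in> B \<Longrightarrow> \<not> a \<le> b"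
    using not_le_nhds[of x y] by auto
  then show "\<exists>T. open T \<and> y \<in> T \<and> T \<subseteq> - {y. x \<le> y}"
    by (intro exI[of _ B]) auto
qed

section \<open>Down-sets and separation\<close>

definition down_closed :: "'a::order set \<Rightarrow> bool" where
  "down_closed S \<longleftrightarrow> (\<forall>y\<in>S. \<forall>x\<le>y. x \<in> S)"

definition down_hull :: "'a::order set \<Rightarrow> 'a set" where
  "down_hull S = {x. \<exists>y\<in>S. x \<le> y}"

lemma down_closed_down_hull: "down_closed (down_hull S)"
  by (auto simp: down_closed_def down_hull_def intro: order_trans)

lemma subset_down_hull: "S \<subseteq> down_hull S"
  by (auto simp: down_hull_def)

text \<open>Since the order is algebraic, the hull is a union of preimages of \<open>S\<close> under
  translations.\<close>

lemma open_down_hull: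
  fixes S :: "'a::extended_choquet_cone set"
  assumes "open S"
  shows "open (down_hull S)"
proof -
  have "down_hull S = (\<Union>c. {x. x + c \<in> S})"
    by (auto simp: down_hull_def le_iff_add)
  then show ?thesis
    using open_add_vimage[OF assms] by auto
qed

text \<open>For \<open>x\<close> outside the hull, finitely many of the neighbourhoods that
  \<open>not_le_nhds\<close> gives for the points of \<open>S\<close> cover \<open>S\<close>; the
  matching neighbourhoods of \<open>x\<close> intersect in one that misses the hull.\<close>

lemma closed_down_hull:
  fixes S :: "'a::extended_choquet_cone set"
  assumes "compact S"
  shows "closed (down_hull S)"
  unfolding closed_def open_subopen[of "- down_hull S"]
proof
  fix x assume x: "x \<in> - down_hull S"
  define Q where "Q y A B \<longleftrightarrow> open A \<and> x \<in> A \<and> open B \<and> y \<in> B \<and> (\<forall>a\<in>A. \<forall>b\<in>B. \<not> a \<le> b)" for y A B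
  have "\<exists>A B. Q y A B" if "y \<in> S" for y
  proof -
    have "\<not> x \<le> y"
      using x that by (auto simp: down_hull_def)
    then obtain A B where "open A" "x \<in> A" "open B" "y \<in> B" "\<And>a b. a \<in> A \<Longrightarrow> b \<in> B \<Longrightarrow> \<not> a \<le> b"
      by (rule not_le_nhds) (rule that)
    then have "Q y A B" by (auto simp: Q_def)
    then show ?thesis by blast
  qed
  then obtain A B where AB: "\<And>y. y \<in> S \<Longrightarrow> Q y (A y) (B y)"
    by metis
  note AB = AB[unfolded Q_def]
  obtain T where T: "finite T" "T \<subseteq> S" "S \<subseteq> (\<Union>y\<in>T. B y)"
    using compact_finite_subcover[OF assms, of B] AB by auto
  have "open (\<Inter>y\<in>T. A y)" "x \<in> (\<Inter>y\<in>T. A y)"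
    using T AB by auto
  moreover have "(\<Inter>y\<in>T. A y) \<subseteq> - down_hull S"
  proof
    fix z assume z: "z \<in> (\<Inter>y\<in>T. A y)"
    have "\<not> z \<le> y" if "y \<in> S" for y
    proof -
      obtain t where "t \<in> T" "y \<in> B t"
        using T(3) \<open>y \<in> S\<close> by auto
      then show ?thesis
        using z AB[of t] T(2) by auto
    qed
    then show "z \<in> - down_hull S"
      by (auto simp: down_hull_def)
  qed
  ultimately show "\<exists>U. open U \<and> x \<in> U \<and> U \<subseteq> - down_hull S" by blast
qed

lemma cone_convex_down_hull:
  fixes S :: "'a::extended_choquet_cone set"
  assumes "cone_convex S"
  shows "cone_convex (down_hull S)"
  unfolding cone_convex_def
proof (intro ballI)
  fix x y and t :: real assume "x \<in> down_hull S" "y \<in> down_hull S" and t: "t \<in> {0<..<1}"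
  then obtain a b where "a \<in> S" "x \<le> a" "b \<in> S" "y \<le> b"
    by (auto simp: down_hull_def)
  then have "t *\<^sub>R a + (1 - t) *\<^sub>R b \<in> S" "t *\<^sub>R x + (1 - t) *\<^sub>R y \<le> t *\<^sub>R a + (1 - t) *\<^sub>R b"
    using assms t by (auto simp: cone_convex_def intro!: add_mono cone_scale_mono)
  then show "t *\<^sub>R x + (1 - t) *\<^sub>R y \<in> down_hull S"
    by (auto simp: down_hull_def)
qed

lemma open_convex_nhd:
  fixes x :: "'a::extended_choquet_cone"
  assumes "open W" "x \<in> W"
  obtains O' where "open O'" "cone_convex O'" "x \<in> O'" "O' \<subseteq> W"
  using locally_convex_cone assms by (metis topological_basisE topological_basis_open)

text \<open>Regularity of a compact Hausdorff space, with the neighbourhood then shrunk to a convex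
  one.\<close>

lemma open_convex_nhd_closure:
  fixes x :: "'a::extended_choquet_cone"
  assumes W: "open W" "x \<in> W"
  obtains U where "open U" "cone_convex U" "x \<in> U" "closure U \<subseteq> W"
proof -
  define Q where "Q y A B \<longleftrightarrow> open A \<and> open B \<and> x \<in> A \<and> y \<in> B \<and> A \<inter> B = {}" for y A B
  have "\<exists>A B. Q y A B" if "y \<in> - W" for y
  proof -
    have "x \<noteq> y"
      using W that by auto
    then show ?thesis
      unfolding Q_def separation_t2 .
  qed
  then obtain A B where AB: "\<And>y. y \<in> - W \<Longrightarrow> Q y (A y) (B y)"
    by metis
  note AB = AB[unfolded Q_def]
  have "compact (- W)"
    using W by (intro closed_imp_compact) auto
  from compact_finite_subcover[OF this, of B]
  obtain T where T: "finite T" "T \<subseteq> - W" "- W \<subseteq> (\<Union>y\<in>T. B y)"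
    using AB by auto
  have "open (\<Inter>y\<in>T. A y)" "x \<in> (\<Inter>y\<in>T. A y)"
    using T AB by auto
  then obtain U where U: "open U" "cone_convex U" "x \<in> U" "U \<subseteq> (\<Inter>y\<in>T. A y)"
    by (rule open_convex_nhd) (rule that)
  have "U \<inter> (\<Union>y\<in>T. B y) = {}"
    using U T AB by blast
  moreover have "open (\<Union>y\<in>T. B y)"
    using T AB by auto
  ultimately have "closure U \<inter> (\<Union>y\<in>T. B y) = {}"
    using open_Int_closure_eq_empty[of "\<Union>y\<in>T. B y" U] by blast
  then have "closure U \<subseteq> W"
    using T by blast
  with U show thesis
    by (intro that)
qed

text \<open>No point near \<open>x\<close> lies below a point near \<open>z\<close>, so a convex
  neighbourhood \<open>V\<close> of \<open>z\<close> can be replaced by its down-hull without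
  meeting \<open>U\<close>.\<close>

lemma separate_not_le:
  fixes x z :: "'a::extended_choquet_cone"
  assumes "\<not> x \<le> z"
  obtains U G where "open U" "cone_convex U" "x \<in> U" "open G" "cone_convex G" "down_closed G" "z \<in> G"
    "U \<inter> G = {}"
proof -
  obtain A B where AB: "open A" "x \<in> A" "open B" "z \<in> B" "\<And>a b. a \<in> A \<Longrightarrow> b \<in> B \<Longrightarrow> \<not> a \<le> b"
    by (rule not_le_nhds[OF assms]) (rule that)
  obtain U where U: "open U" "cone_convex U" "x \<in> U" "U \<subseteq> A"
    by (rule open_convex_nhd[OF AB(1,2)]) (rule that)
  obtain V where V: "open V" "cone_convex V" "z \<in> V" "V \<subseteq> B"
    by (rule open_convex_nhd[OF AB(3,4)]) (rule that)
  have "U \<inter> down_hull V = {}"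
    using U V AB(5) by (fastforce simp: down_hull_def)
  then show thesis
    using U V subset_down_hull[of V]
    by (intro that[of U "down_hull V"] open_down_hull cone_convex_down_hull down_closed_down_hull) auto
qed

lemma cone_convex_closure:
  fixes S :: "'a::topological_cone set"
  assumes "cone_convex S"
  shows "cone_convex (closure S)"
  unfolding cone_convex_def
proof (intro ballI)
  fix x y and t :: real assume xy: "x \<in> closure S" "y \<in> closure S" and t: "t \<in> {0<..<1}"
  let ?f = "\<lambda>p::'a \<times> 'a. t *\<^sub>R fst p + (1 - t) *\<^sub>R snd p"
  have "continuous_on UNIV ?f"
    using t by (intro continuous_intros continuous_on_compose2[OF continuous_on_cone_scale_left]) auto
  then have "?f ` closure (S \<times> S) \<subseteq> closure S"
    using assms t by (intro image_closure_subset) (auto simp: cone_convex_def intro!: subsetD[OF closure_subset] elim: continuous_on_subset)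
  then show "t *\<^sub>R x + (1 - t) *\<^sub>R y \<in> closure S"
    using xy by (force simp: closure_Times)
qed

lemma closure_add_closed:
  fixes S :: "'a::topological_cone set"
  assumes "\<And>x y. x \<in> S \<Longrightarrow> y \<in> S \<Longrightarrow> x + y \<in> S" "x \<in> closure S" "y \<in> closure S"
  shows "x + y \<in> closure S"
proof -
  let ?f = "\<lambda>p::'a \<times> 'a. fst p + snd p"
  have "?f ` closure (S \<times> S) \<subseteq> closure S"
    using assms(1) by (intro image_closure_subset continuous_intros) (auto intro!: subsetD[OF closure_subset])
  then show ?thesis
    using assms(2,3) by (force simp: closure_Times)
qed

lemma closure_scale_closed:
  fixes S :: "'a::topological_cone set"
  assumes "0 < t" "\<And>x. x \<in> S \<Longrightarrow> t *\<^sub>R x \<in> S" "x \<in> closure S"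
  shows "t *\<^sub>R x \<in> closure S"
proof -
  have "(\<lambda>x. t *\<^sub>R x) ` closure S \<subseteq> closure S"
    using assms(2) by (intro image_closure_subset continuous_on_subset[OF continuous_on_cone_scale_left[OF assms(1)]])
      (auto intro!: subsetD[OF closure_subset])
  then show ?thesis
    using assms(3) by force
qed

text \<open>Sums of finitely many members of \<open>S\<close> are upper bounds that stay in
  \<open>S\<close>; compactness gives a common upper bound of all members within
  \<open>S\<close>.\<close>

lemma greatest_exists:
  fixes S :: "'a::extended_choquet_cone set"
  assumes S: "closed S" "S \<noteq> {}" and add: "\<And>x y. x \<in> S \<Longrightarrow> y \<in> S \<Longrightarrow> x + y \<in> S"
  obtains m where "m \<in> S" "\<And>x. x \<in> S \<Longrightarrow> x \<le> m"
proof -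
  have "S \<inter> (\<Inter>x\<in>S. {y. x \<le> y}) \<noteq> {}"
  proof (rule compact_imp_fip_image)
    fix I assume "finite I" "I \<subseteq> S"
    then have "\<exists>m\<in>S. \<forall>x\<in>I. x \<le> m"
    proof induction
      case empty
      then show ?case using S by auto
    next
      case (insert a I)
      then obtain m where "m \<in> S" "\<forall>x\<in>I. x \<le> m" by auto
      then show ?case
        using insert.prems add le_add_left_cone[of a m] le_add_left_cone[of m a]
        by (intro bexI[of _ "a + m"]) (auto simp: add.commute intro: order_trans)
    qed
    then show "S \<inter> (\<Inter>x\<in>I. {y. x \<le> y}) \<noteq> {}" by auto
  qed (use S closed_imp_compact closed_le_left in auto)
  then show thesis
    using that by auto
qed

section \<open>Idempotents\<close>

text \<open>Powers of two fix \<open>w\<close>, monotonicity in the scalar traps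
  \<open>t \<ge> 1\<close> between \<open>1\<close> and such a power, and inverting the scalar
  covers \<open>t < 1\<close>.\<close>

lemma Idem_scale:
  fixes w :: "'a::extended_choquet_cone"
  assumes w: "w \<in> Idem" and "0 < t"
  shows "t *\<^sub>R w = w"
proof -
  have pow: "(2 ^ n) *\<^sub>R w = w" for n
  proof (induction n)
    case (Suc n)
    have "(2 ^ Suc n) *\<^sub>R w = 2 *\<^sub>R ((2 ^ n) *\<^sub>R w)"
      by (simp add: cone_scale_scale)
    then show ?case
      using Suc w by (simp add: Idem_def)
  qed (simp add: cone_scale_one)
  have ge1: "t *\<^sub>R w = w" if "1 \<le> t" for t
  proof -
    obtain n where "t < 2 ^ n"
      using real_arch_pow[of 2 t] by auto
    then have "t *\<^sub>R w \<le> (2 ^ n) *\<^sub>R w"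
      using that by (intro cone_scale_mono_left) auto
    moreover have "1 *\<^sub>R w \<le> t *\<^sub>R w"
      using that by (intro cone_scale_mono_left) auto
    ultimately show ?thesis
      by (simp add: pow cone_scale_one)
  qed
  show ?thesis
  proof (cases "1 \<le> t")
    case False
    then have "(1 / t) *\<^sub>R w = w"
      using \<open>0 < t\<close> by (intro ge1) auto
    then show ?thesis
      using cone_scale_inverse(1)[OF \<open>0 < t\<close>, of w] by simp
  qed (rule ge1)
qed

lemma Idem_add_self:
  fixes w :: "'a::extended_choquet_cone"
  shows "w \<in> Idem \<longleftrightarrow> w + w = w"
  using cone_scale_add_left[of 1 1 w] by (simp add: Idem_def cone_scale_one)

lemma Idem_absorb:
  fixes w :: "'a::extended_choquet_cone"
  assumes "w \<in> Idem" "w \<le> x"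
  shows "x + w = x" "w + x = x"
proof -
  obtain z where "x = w + z"
    using assms(2) by (auto simp: le_iff_add)
  moreover have "w + w = w"
    using assms(1) by (simp add: Idem_add_self)
  ultimately show "w + x = x"
    by (simp flip: add.assoc)
  then show "x + w = x"
    by (simp add: add.commute)
qed

lemma Idem_add:
  fixes v w :: "'a::extended_choquet_cone"
  assumes "v \<in> Idem" "w \<in> Idem"
  shows "v + w \<in> Idem"
  using assms unfolding Idem_def by (simp add: cone_scale_add_right)

lemma closed_Idem: "closed (Idem :: 'a::extended_choquet_cone set)"
  unfolding Idem_def
  by (intro closed_Collect_eq continuous_on_cone_scale_left continuous_on_id) simp

text \<open>By compactness the sequence \<open>(1 / n) *\<^sub>R x\<close> has a cluster point
  \<open>e\<close>, and inequalities pass to it because order intervals are closed. The third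
  property is the main use of \<open>e\<close>: what holds on an open set around \<open>e\<close>
  holds at some small multiple of \<open>x\<close>.\<close>

lemma idempotent_part:
  fixes x :: "'a::extended_choquet_cone"
  obtains e where "e \<in> Idem" "\<And>t. 0 < t \<Longrightarrow> e \<le> t *\<^sub>R x"
    "\<And>U. open U \<Longrightarrow> e \<in> U \<Longrightarrow> \<exists>n>0. (1 / real n) *\<^sub>R x \<in> U"
proof -
  define X where "X n = (1 / real (Suc n)) *\<^sub>R x" for n
  \<comment> \<open>If no \<open>e\<close> were a cluster point of \<open>X\<close>, finitely many
    open sets that \<open>X\<close> eventually avoids would cover the cone.\<close>
  define Q where "Q e U N \<longleftrightarrow> open U \<and> e \<in> U \<and> (\<forall>n\<ge>N. X n \<notin> U)" for e U and N :: nat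
  have "\<exists>e. \<forall>U N. \<not> Q e U N"
  proof (rule ccontr)
    assume "\<not> ?thesis"
    then have "\<forall>e. \<exists>U N. Q e U N" by simp
    then obtain U N where "\<And>e. Q e (U e) (N e)"
      by metis
    then have UN: "\<And>e. open (U e)" "\<And>e. e \<in> U e" "\<And>e n. n \<ge> N e \<Longrightarrow> X n \<notin> U e"
      by (simp_all add: Q_def)
    obtain T where T: "finite T" "UNIV \<subseteq> (\<Union>e\<in>T. U e)"
      using compact_finite_subcover[OF compact_cone, of U] UN(1,2) by auto
    obtain M where M: "\<forall>n\<in>N ` T. n \<le> M"
      using finite_nat_set_iff_bounded_le[of "N ` T"] T(1) by auto
    obtain e where "e \<in> T" "X M \<in> U e"
      using T(2) by auto
    then show False
      using UN(3)[of e M] M by auto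
  qed
  then obtain e where "\<forall>U N. \<not> Q e U N" ..
  then have e: "\<exists>n\<ge>N. X n \<in> U" if "open U" "e \<in> U" for U N
    using that by (auto simp: Q_def)
  have in_closed: "e \<in> S" if "closed S" "\<And>n. n \<ge> N \<Longrightarrow> X n \<in> S" for S N
    using e[of "- S" N] that by auto
  have le: "e \<le> t *\<^sub>R x" if "0 < t" for t
  proof -
    obtain N where N: "1 / real (Suc N) < t"
      using nat_approx_posE[OF \<open>0 < t\<close>] by auto
    have "e \<in> {y. y \<le> t *\<^sub>R x}"
    proof (rule in_closed[OF closed_le_right])
      fix n assume "N \<le> n"
      then have "1 / real (Suc n) \<le> 1 / real (Suc N)"
        by (intro divide_left_mono) auto
      also note N
      finally show "X n \<in> {y. y \<le> t *\<^sub>R x}"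
        unfolding X_def by (auto intro!: cone_scale_mono_left)
    qed
    then show ?thesis by simp
  qed
  \<comment> \<open>Since \<open>e\<close> lies below half of \<open>X n\<close>, its double is
    below every \<open>X n\<close> and hence below the cluster point \<open>e\<close>.\<close>
  have "2 *\<^sub>R e \<le> e"
  proof -
    have "e \<in> {y. 2 *\<^sub>R e \<le> y}"
    proof (rule in_closed[OF closed_le_left])
      fix n :: nat
      have "2 *\<^sub>R e \<le> 2 *\<^sub>R ((1 / (2 * real (Suc n))) *\<^sub>R x)"
        by (intro cone_scale_mono le) auto
      also have "\<dots> = X n"
        unfolding X_def by (subst cone_scale_scale) (simp_all del: of_nat_Suc)
      finally show "X n \<in> {y. 2 *\<^sub>R e \<le> y}" by simp
    qed
    then show ?thesis by simp
  qed
  moreover have "1 *\<^sub>R e \<le> 2 *\<^sub>R e"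
    by (rule cone_scale_mono_left) auto
  ultimately have "e \<in> Idem"
    by (simp add: Idem_def cone_scale_one)
  moreover have "\<exists>n>0. (1 / real n) *\<^sub>R x \<in> U" if "open U" "e \<in> U" for U
    using e[OF that, of 0] unfolding X_def by blast
  ultimately show thesis
    using le by (intro that)
qed

section \<open>Semicontinuous linear functions\<close>

definition upper_semicontinuous :: "('a::topological_space \<Rightarrow> ennreal) \<Rightarrow> bool" where
  "upper_semicontinuous f \<longleftrightarrow> (\<forall>a. open {x. f x < a})"

lemma cone_linear_zero: "cone_linear f \<Longrightarrow> f 0 = 0"
  and cone_linear_add: "cone_linear f \<Longrightarrow> f (x + y) = f x + f y"
  and cone_linear_scale: "cone_linear f \<Longrightarrow> 0 < t \<Longrightarrow> f (t *\<^sub>R x) = ennreal t * f x"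
  by (auto simp: cone_linear_def)

lemma cone_linear_mono:
  fixes x y :: "'a::extended_choquet_cone"
  assumes "cone_linear f" "x \<le> y"
  shows "f x \<le> f y"
  using assms(2) by (auto simp: le_iff_add cone_linear_add[OF assms(1)])

text \<open>A value \<open>a\<close> with \<open>a + a = a\<close> is \<open>0\<close> or
  infinite.\<close>

lemma cone_linear_Idem:
  fixes w :: "'a::extended_choquet_cone"
  assumes "cone_linear f" "w \<in> Idem" "f w < top"
  shows "f w = 0"
proof -
  have "f w + f w = f w"
    using assms(2) by (simp add: Idem_add_self flip: cone_linear_add[OF assms(1)])
  then show ?thesis
    using assms(3) by (cases "f w") (auto simp flip: ennreal_plus)
qed

lemma cone_linear_const_zero: "cone_linear (\<lambda>x. 0)"
  by (simp add: cone_linear_def)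

lemma cone_linear_plus: "cone_linear f \<Longrightarrow> cone_linear g \<Longrightarrow> cone_linear (\<lambda>x. f x + g x)"
  by (simp add: cone_linear_def algebra_simps)

lemma cone_linear_sum:
  "(\<And>i. i \<in> I \<Longrightarrow> cone_linear (f i)) \<Longrightarrow> cone_linear (\<lambda>x. \<Sum>i\<in>I. f i x)"
  by (simp add: cone_linear_def sum.distrib sum_distrib_left)

lemma cone_linear_times: "cone_linear f \<Longrightarrow> cone_linear (\<lambda>x. c * f x)"
  by (simp add: cone_linear_def algebra_simps)

lemma lsc_const_zero: "lower_semicontinuous (\<lambda>x. 0)"
  by (simp add: lower_semicontinuous_def)

text \<open>The first two alternatives cover a summand \<open>0\<close>, below which there is no
  \<open>s\<close> or \<open>t\<close>.\<close>

lemma less_add_ennrealE: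
  fixes a b c :: ennreal
  assumes "c < a + b"
  obtains "c < a" | "c < b" | s t where "s < a" "t < b" "c < s + t"
proof -
  consider "c < a" | "c < b" | "a \<le> c" "b \<le> c" by force
  then show thesis
  proof cases
    case 3
    then have "a \<noteq> top" "b \<noteq> top"
      using assms by (auto simp: top_unique)
    moreover have "a \<noteq> 0" "b \<noteq> 0"
      using 3 assms by auto
    moreover have "c \<noteq> top"
      using assms by auto
    ultimately obtain r p q where rpq: "a = ennreal p" "0 < p" "b = ennreal q" "0 < q" "c = ennreal r" "0 \<le> r"
      by (cases a; cases b; cases c) (auto simp: less_le)
    then have "r < p + q"
      using assms by (simp add: ennreal_less_iff flip: ennreal_plus)
    \<comment> \<open>Staying below \<open>p\<close> and \<open>q\<close> keeps both reduced
      summands nonnegative; a quarter of the gap leaves their sum above \<open>r\<close>.\<close>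
    define d where "d = min (min p q) ((p + q - r) / 4)"
    have d: "0 < d" "d \<le> p" "d \<le> q"
      using \<open>r < p + q\<close> rpq by (auto simp: d_def)
    have "d \<le> (p + q - r) / 4"
      unfolding d_def by (rule min.cobounded2)
    then have "r < (p - d) + (q - d)"
      using \<open>r < p + q\<close> by (simp add: field_simps)
    then have "ennreal (p - d) < a" "ennreal (q - d) < b" "c < ennreal (p - d) + ennreal (q - d)"
      using rpq d by (simp_all add: ennreal_less_iff flip: ennreal_plus)
    then show thesis by (rule that(3))
  qed (use that in auto)
qed

lemma less_add_ennreal_iff:
  fixes a b c :: ennreal
  shows "c < a + b \<longleftrightarrow> c < a \<or> c < b \<or> (\<exists>s t. c < s + t \<and> s < a \<and> t < b)"
proof
  assume "c < a + b"
  then show "c < a \<or> c < b \<or> (\<exists>s t. c < s + t \<and> s < a \<and> t < b)"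
    by (rule less_add_ennrealE) auto
next
  assume *: "c < a \<or> c < b \<or> (\<exists>s t. c < s + t \<and> s < a \<and> t < b)"
  have "a \<le> a + b" "b \<le> a + b"
    by (simp_all add: add_increasing add_increasing2)
  moreover have "s + t \<le> a + b" if "s < a" "t < b" for s t
    using that by (intro add_mono) auto
  ultimately show "c < a + b"
    using * by (auto intro: less_le_trans)
qed

text \<open>The sum \<open>s + t\<close> may reach \<open>c\<close>, so that
  \<open>s = t = top\<close> works for \<open>c = top\<close>, and otherwise the gap is split
  evenly.\<close>

lemma add_less_ennrealE:
  fixes a b c :: ennreal
  assumes "a + b < c"
  obtains s t where "a < s" "b < t" "s + t \<le> c"
proof -
  have ne: "a \<noteq> top" "b \<noteq> top"
    using assms by auto
  show thesis
  proof (cases "c = top")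
    case True
    with ne show thesis
      by (intro that[of top top]) (auto simp: less_top)
  next
    case False
    with ne obtain r p q where rpq: "a = ennreal p" "0 \<le> p" "b = ennreal q" "0 \<le> q" "c = ennreal r" "0 \<le> r"
      by (cases a; cases b; cases c) auto
    then have "p + q < r"
      using assms by (simp add: ennreal_less_iff flip: ennreal_plus)
    define d where "d = (r - p - q) / 2"
    have "0 < d"
      using \<open>p + q < r\<close> by (simp add: d_def)
    then show thesis
      using rpq by (intro that[of "ennreal (p + d)" "ennreal (q + d)"])
        (auto simp: ennreal_less_iff d_def field_simps simp flip: ennreal_plus)
  qed
qed

lemma add_less_ennreal_iff:
  fixes a b c :: ennreal
  shows "a + b < c \<longleftrightarrow> (\<exists>s t. s + t \<le> c \<and> a < s \<and> b < t)"
proof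
  assume "a + b < c"
  then show "\<exists>s t. s + t \<le> c \<and> a < s \<and> b < t"
    by (rule add_less_ennrealE) auto
next
  assume "\<exists>s t. s + t \<le> c \<and> a < s \<and> b < t"
  then show "a + b < c"
    using add_strict_mono by (metis order_less_le_trans)
qed

lemma lsc_plus:
  assumes f: "lower_semicontinuous f" and g: "lower_semicontinuous g"
  shows "lower_semicontinuous (\<lambda>x. f x + g x)"
  unfolding lower_semicontinuous_def
proof
  fix c
  have "{x. c < f x + g x} = {x. c < f x} \<union> {x. c < g x} \<union>
    (\<Union>p\<in>{p. c < fst p + snd p}. {x. fst p < f x} \<inter> {x. snd p < g x})"
  proof (rule set_eqI)
    show "x \<in> {x. c < f x + g x} \<longleftrightarrow> x \<in> {x. c < f x} \<union> {x. c < g x} \<union>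
      (\<Union>p\<in>{p. c < fst p + snd p}. {x. fst p < f x} \<inter> {x. snd p < g x})" for x
      using less_add_ennreal_iff[of c "f x" "g x"] by simp
  qed
  also have "open \<dots>"
    using f g by (intro open_Un open_UN open_Int ballI) (simp_all add: lower_semicontinuous_def)
  finally show "open {x. c < f x + g x}" .
qed

lemma usc_const_zero: "upper_semicontinuous (\<lambda>x. 0)"
  by (auto simp: upper_semicontinuous_def)

lemma usc_plus:
  assumes f: "upper_semicontinuous f" and g: "upper_semicontinuous g"
  shows "upper_semicontinuous (\<lambda>x. f x + g x)"
  unfolding upper_semicontinuous_def
proof
  fix c
  have "{x. f x + g x < c} = (\<Union>p\<in>{p. fst p + snd p \<le> c}. {x. f x < fst p} \<inter> {x. g x < snd p})"
  proof (rule set_eqI)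
    show "x \<in> {x. f x + g x < c} \<longleftrightarrow>
      x \<in> (\<Union>p\<in>{p. fst p + snd p \<le> c}. {x. f x < fst p} \<inter> {x. g x < snd p})" for x
      using add_less_ennreal_iff[of "f x" "g x" c] by simp
  qed
  also have "open \<dots>"
    using f g by (intro open_UN open_Int ballI) (simp_all add: upper_semicontinuous_def)
  finally show "open {x. f x + g x < c}" .
qed

lemma usc_sum:
  "finite I \<Longrightarrow> (\<And>i. i \<in> I \<Longrightarrow> upper_semicontinuous (f i)) \<Longrightarrow> upper_semicontinuous (\<lambda>x. \<Sum>i\<in>I. f i x)"
  by (induction rule: finite_induct) (simp_all add: usc_const_zero usc_plus)

lemma less_times_ennreal_iff:
  assumes "0 < t"
  shows "a < ennreal t * c \<longleftrightarrow> ennreal (1 / t) * a < c" "ennreal t * c < a \<longleftrightarrow> c < ennreal (1 / t) * a"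
proof -
  have inv: "ennreal t * (ennreal (1 / t) * d) = d" "ennreal (1 / t) * (ennreal t * d) = d" for d
    using assms by (simp_all flip: mult.assoc ennreal_mult)
  have mono: "ennreal r * x < ennreal r * y" if "0 < r" "x < y" for r x y
    using that by (intro ennreal_mult_strict_left_mono) auto
  show "a < ennreal t * c \<longleftrightarrow> ennreal (1 / t) * a < c" "ennreal t * c < a \<longleftrightarrow> c < ennreal (1 / t) * a"
    using mono[of "1 / t" a "ennreal t * c"] mono[of t "ennreal (1 / t) * a" c]
      mono[of "1 / t" "ennreal t * c" a] mono[of t c "ennreal (1 / t) * a"] assms
    by (auto simp: inv)
qed

lemma lsc_times: "0 < t \<Longrightarrow> lower_semicontinuous f \<Longrightarrow> lower_semicontinuous (\<lambda>x. ennreal t * f x)"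
  unfolding lower_semicontinuous_def using less_times_ennreal_iff(1)[of t _ "f _"] by simp

lemma usc_times: "0 < t \<Longrightarrow> upper_semicontinuous f \<Longrightarrow> upper_semicontinuous (\<lambda>x. ennreal t * f x)"
  unfolding upper_semicontinuous_def using less_times_ennreal_iff(2)[of t "f _"] by simp

section \<open>Extending real functionals by infinity\<close>

text \<open>Negative values of \<open>f\<close> are sent to \<open>0\<close> by
  \<open>ennreal\<close>, so linearity of the extension relies on nonnegativity of \<open>f\<close>
  on \<open>D\<close>.\<close>

definition extension :: "'a set \<Rightarrow> ('a \<Rightarrow> real) \<Rightarrow> 'a \<Rightarrow> ennreal" where
  "extension D f x = (if x \<in> D then ennreal (f x) else top)"

text \<open>Since \<open>D\<close> contains the summands of its members, a sum is outside
  \<open>D\<close> exactly when one of its summands is, which matches addition of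
  \<open>top\<close>.\<close>

lemma cone_linear_extension:
  fixes D :: "'a::abstract_cone set"
  assumes D: "subcone D" "\<And>x y. x + y \<in> D \<Longrightarrow> x \<in> D"
    and f: "linear_on_cone D f" "\<And>x. x \<in> D \<Longrightarrow> 0 \<le> f x"
  shows "cone_linear (extension D f)"
  unfolding cone_linear_def
proof (intro conjI allI impI)
  have D0: "0 \<in> D" and D_add: "x \<in> D \<Longrightarrow> y \<in> D \<Longrightarrow> x + y \<in> D"
    and D_scale: "0 < t \<Longrightarrow> x \<in> D \<Longrightarrow> t *\<^sub>R x \<in> D" for x y t
    using D(1) by (auto simp: subcone_def)
  have "f (0 + 0) = f 0 + f 0"
    using f(1) D0 by (simp only: linear_on_cone_def)
  then show "extension D f 0 = 0"
    by (simp add: extension_def D0)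
  fix x y
  have "x + y \<in> D \<longleftrightarrow> x \<in> D \<and> y \<in> D"
    using D(2)[of x y] D(2)[of y x] D_add by (auto simp: add.commute)
  then show "extension D f (x + y) = extension D f x + extension D f y"
    using f by (simp add: extension_def linear_on_cone_def ennreal_plus)
  fix t :: real assume "0 < t"
  have "t *\<^sub>R x \<in> D \<longleftrightarrow> x \<in> D"
    using D_scale[of t x] D_scale[of "1 / t" "t *\<^sub>R x"] \<open>0 < t\<close> by (auto simp: cone_scale_inverse)
  then show "extension D f (t *\<^sub>R x) = ennreal t * extension D f x"
    using f \<open>0 < t\<close> by (auto simp: extension_def linear_on_cone_def ennreal_mult ennreal_mult_top)
qed

text \<open>The sets \<open>{x. extension D f x < a}\<close> lie inside \<open>D\<close>, so with
  \<open>D\<close> open, relative neighbourhoods become open ones.\<close>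

lemma usc_extension:
  fixes D :: "'a::topological_space set"
  assumes "open D" "usc_on D f"
  shows "upper_semicontinuous (extension D f)"
  unfolding upper_semicontinuous_def open_subopen[of "{x. extension D f x < _}"]
proof (intro allI ballI)
  fix a x assume "x \<in> {x. extension D f x < a}"
  then have x: "x \<in> D" "ennreal (f x) < a"
    by (auto simp: extension_def split: if_splits)
  obtain c where c: "f x < c" "ennreal c \<le> a"
  proof (cases a)
    case (real r)
    with x(2) have "f x < r"
      using ennreal_leI[of r "f x"] by (auto simp: not_le[symmetric])
    then show thesis
      using real by (intro that[of r]) auto
  qed (auto intro: that[of "f x + 1"])
  have "\<exists>N. open N \<and> x \<in> N \<and> (\<forall>y\<in>N \<inter> D. f y < c)"
    using assms(2) x(1) c(1) unfolding usc_on_def by simp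
  then obtain N where N: "open N" "x \<in> N" "\<forall>y\<in>N \<inter> D. f y < c"
    by (elim exE conjE)
  have "ennreal (f y) < a" if "f y < c" for y
  proof (cases "f y < 0")
    case True
    have "0 < a"
      using x(2) by (rule order_le_less_trans[rotated]) simp
    then show ?thesis
      using True by (simp add: ennreal_neg)
  next
    case False
    then have "ennreal (f y) < ennreal c"
      using that by (simp add: ennreal_less_iff)
    with c(2) show ?thesis by simp
  qed
  with N x(1) assms(1) show "\<exists>T. open T \<and> x \<in> T \<and> T \<subseteq> {x. extension D f x < a}"
    by (intro exI[of _ "N \<inter> D"]) (auto simp: extension_def)
qed

lemma down_closed_scale:
  fixes G :: "'a::extended_choquet_cone set"
  assumes "down_closed G" "(1 / s) *\<^sub>R y \<in> G" "0 < s" "s \<le> t"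
  shows "(1 / t) *\<^sub>R y \<in> G"
proof -
  have "(1 / t) *\<^sub>R y \<le> (1 / s) *\<^sub>R y"
    using assms(3,4) by (intro cone_scale_mono_left) (auto intro: divide_left_mono)
  then show ?thesis
    using assms(1,2) by (auto simp: down_closed_def)
qed

text \<open>The scaled sum is the convex combination of the two given points with weights
  \<open>s / (s + t)\<close> and \<open>t / (s + t)\<close>; this is subadditivity of
  gauges.\<close>

lemma convex_scale_add:
  fixes G :: "'a::abstract_cone set"
  assumes "cone_convex G" "0 < s" "0 < t" "(1 / s) *\<^sub>R x \<in> G" "(1 / t) *\<^sub>R y \<in> G"
  shows "(1 / (s + t)) *\<^sub>R (x + y) \<in> G"
proof -
  have "s / (s + t) \<in> {0<..<1}"
    using assms by auto
  then have "(s / (s + t)) *\<^sub>R ((1 / s) *\<^sub>R x) + (1 - s / (s + t)) *\<^sub>R ((1 / t) *\<^sub>R y) \<in> G"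
    using assms unfolding cone_convex_def by blast
  also have "1 - s / (s + t) = t / (s + t)"
    using assms by (simp add: field_simps)
  also have "(s / (s + t)) *\<^sub>R ((1 / s) *\<^sub>R x) + (t / (s + t)) *\<^sub>R ((1 / t) *\<^sub>R y) = (1 / (s + t)) *\<^sub>R (x + y)"
    using assms by (simp add: cone_scale_scale cone_scale_add_right)
  finally show ?thesis .
qed

section \<open>Gauges of open convex down-sets\<close>

locale open_convex_downset =
  fixes G :: "'a::extended_choquet_cone set"
  assumes G: "open G" "cone_convex G" "down_closed G" "G \<noteq> {}"
begin

definition cone_hull :: "'a set" where
  "cone_hull = {y. \<exists>t>0. (1 / t) *\<^sub>R y \<in> G}"

definition gauge_rel :: "'a \<Rightarrow> real \<Rightarrow> bool" where
  "gauge_rel y t \<longleftrightarrow> 0 < t \<and> (1 / t) *\<^sub>R y \<in> G"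

text \<open>This is the Minkowski functional of \<open>G\<close>. Outside \<open>cone_hull\<close>
  the set is empty and the value is junk.\<close>

definition gauge :: "'a \<Rightarrow> real" where
  "gauge y = Inf {t. gauge_rel y t}"

lemma zero_in_G: "0 \<in> G"
  using G(3,4) by (auto simp: down_closed_def)

lemma gauge_rel_add: "gauge_rel x s \<Longrightarrow> gauge_rel y t \<Longrightarrow> gauge_rel (x + y) (s + t)"
  using convex_scale_add[OF G(2)] by (auto simp: gauge_rel_def)

lemma gauge_rel_scale: "0 < r \<Longrightarrow> gauge_rel x s \<Longrightarrow> gauge_rel (r *\<^sub>R x) (r * s)"
  by (simp add: gauge_rel_def cone_scale_scale)

lemma gauge_rel_mono: "gauge_rel x s \<Longrightarrow> s \<le> t \<Longrightarrow> gauge_rel x t"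
  using down_closed_scale[OF G(3)] by (auto simp: gauge_rel_def)

lemma cone_hull_iff: "y \<in> cone_hull \<longleftrightarrow> (\<exists>t. gauge_rel y t)"
  by (auto simp: cone_hull_def gauge_rel_def)

lemma subcone_cone_hull: "subcone cone_hull"
proof -
  have "gauge_rel 0 1"
    by (simp add: gauge_rel_def cone_scale_one zero_in_G)
  then have "0 \<in> cone_hull"
    unfolding cone_hull_iff ..
  moreover have "x + y \<in> cone_hull" if "x \<in> cone_hull" "y \<in> cone_hull" for x y
    using that unfolding cone_hull_iff by (elim exE) (rule exI, rule gauge_rel_add)
  moreover have "t *\<^sub>R x \<in> cone_hull" if "0 < t" "x \<in> cone_hull" for t x
    using that unfolding cone_hull_iff by (elim exE) (rule exI, rule gauge_rel_scale)
  ultimately show ?thesis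
    by (simp add: subcone_def)
qed

lemma open_gauge_rel: "open {y. gauge_rel y t}"
  using open_scale_vimage[OF G(1), of "1 / t"] by (cases "0 < t") (auto simp: gauge_rel_def)

lemma open_cone_hull: "open cone_hull"
proof -
  have "cone_hull = (\<Union>t. {y. gauge_rel y t})"
    by (auto simp: cone_hull_iff)
  then show ?thesis
    using open_gauge_rel by auto
qed

lemma gauge_le: "gauge_rel y t \<Longrightarrow> gauge y \<le> t"
  unfolding gauge_def by (rule cInf_lower) (auto simp: gauge_rel_def intro: bdd_belowI[of _ 0])

lemma gauge_less: "y \<in> cone_hull \<Longrightarrow> gauge y < t \<Longrightarrow> gauge_rel y t"
  unfolding gauge_def using cInf_lessD[of "{t. gauge_rel y t}" t]
  by (auto simp: cone_hull_iff intro: gauge_rel_mono)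

lemma gauge_greatest: "y \<in> cone_hull \<Longrightarrow> (\<And>t. gauge_rel y t \<Longrightarrow> c \<le> t) \<Longrightarrow> c \<le> gauge y"
  unfolding gauge_def by (rule cInf_greatest) (auto simp: cone_hull_iff)

lemma sublinear_on_gauge:
  assumes D: "subcone D" "D \<subseteq> cone_hull"
  shows "sublinear_on D gauge"
proof -
  \<comment> \<open>This bound demands only nonnegative values, which every gauge satisfies, and
    makes \<open>sublinear_on_Inf\<close> applicable.\<close>
  interpret lower_bound cone_hull "\<lambda>x c. c \<le> 0"
    using subcone_cone_hull by unfold_locales (auto simp: mult_nonneg_nonpos)
  have "sublinear_on cone_hull (\<lambda>y. Inf {t. gauge_rel y t})"
  proof (rule conjunct1[OF sublinear_on_Inf])
    show "d \<le> c" if "gauge_rel x c" "d \<le> 0" for x c d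
      using that by (simp add: gauge_rel_def)
  qed (auto simp: cone_hull_iff gauge_rel_add gauge_rel_scale)
  then have "sublinear_on cone_hull gauge"
    by (simp add: gauge_def[abs_def])
  then show ?thesis
    using D(2) unfolding sublinear_on_def by (meson subsetD)
qed

lemma usc_on_gauge:
  assumes "D \<subseteq> cone_hull"
  shows "usc_on D gauge"
  unfolding usc_on_def
proof (intro ballI allI impI)
  fix x c assume x: "x \<in> D" and "gauge x < c"
  then obtain d where d: "gauge x < d" "d < c"
    using dense by blast
  have "x \<in> {y. gauge_rel y d}"
    using gauge_less[OF _ d(1)] x assms by auto
  moreover have "gauge y < c" if "gauge_rel y d" for y
    using gauge_le[OF that] d(2) by simp
  ultimately show "\<exists>N. open N \<and> x \<in> N \<and> (\<forall>y\<in>N \<inter> D. gauge y < c)"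
    using open_gauge_rel by (intro exI[of _ "{y. gauge_rel y d}"]) auto
qed

lemma cone_hull_down: "x + y \<in> cone_hull \<Longrightarrow> x \<in> cone_hull"
proof -
  assume "x + y \<in> cone_hull"
  then obtain t where "0 < t" "(1 / t) *\<^sub>R (x + y) \<in> G"
    by (auto simp: cone_hull_def)
  moreover have "(1 / t) *\<^sub>R x \<le> (1 / t) *\<^sub>R (x + y)"
    using \<open>0 < t\<close> by (intro cone_scale_mono le_add_left_cone) auto
  ultimately show "x \<in> cone_hull"
    using G(3) by (auto simp: cone_hull_def down_closed_def)
qed

text \<open>\<open>P\<close> demands \<open>t\<close> at every point above a member of
  \<open>t\<close> times \<open>U\<close>, and \<open>0\<close> everywhere. It stays below the gauge
  of \<open>G\<close> because \<open>U\<close> misses the down-set \<open>G\<close>. A linear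
  \<open>f\<close> between the two is then improved to an upper semicontinuous \<open>h\<close>
  between \<open>f\<close> and the gauge.\<close>

lemma usc_functional:
  assumes U: "cone_convex U" "U \<inter> G = {}"
  obtains f where "cone_linear f" "upper_semicontinuous f" "\<And>x. x \<in> U \<Longrightarrow> 1 \<le> f x"
    "\<And>y. y \<in> G \<Longrightarrow> f y \<le> 1"
proof -
  define P where "P y c \<longleftrightarrow> c \<le> 0 \<or> (\<exists>t>0. \<exists>x. (1 / t) *\<^sub>R x \<in> U \<and> x \<le> y \<and> c \<le> t)" for y and c :: real
  interpret lower_bound cone_hull P
  proof
    fix x y c d assume "P x c" "P y d"
    then consider "c \<le> 0" "d \<le> 0"
      | t v where "c \<le> 0" "0 < t" "(1 / t) *\<^sub>R v \<in> U" "v \<le> y" "d \<le> t"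
      | s u where "d \<le> 0" "0 < s" "(1 / s) *\<^sub>R u \<in> U" "u \<le> x" "c \<le> s"
      | s u t v where "0 < s" "(1 / s) *\<^sub>R u \<in> U" "u \<le> x" "c \<le> s"
          "0 < t" "(1 / t) *\<^sub>R v \<in> U" "v \<le> y" "d \<le> t"
      unfolding P_def by blast
    then show "P (x + y) (c + d)"
    proof cases
      case 2
      have "y \<le> x + y"
        using le_add_left_cone[of y x] by (simp add: add.commute)
      then have "v \<le> x + y" "c + d \<le> t"
        using 2 by auto
      then show ?thesis
        using 2 unfolding P_def by blast
    next
      case 3
      then have "u \<le> x + y" "c + d \<le> s"
        using le_add_left_cone[of x y] by auto
      then show ?thesis
        using 3 unfolding P_def by blast
    next
      case 4
      have "(1 / (s + t)) *\<^sub>R (u + v) \<in> U"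
        using 4 by (intro convex_scale_add[OF U(1)])
      moreover have "u + v \<le> x + y" "c + d \<le> s + t" "0 < s + t"
        using 4 by (auto intro: add_mono)
      ultimately show ?thesis
        unfolding P_def by blast
    qed (simp add: P_def)
  next
    fix r :: real and x c assume "0 < r" "P x c"
    then consider "c \<le> 0" | s u where "0 < s" "(1 / s) *\<^sub>R u \<in> U" "u \<le> x" "c \<le> s"
      unfolding P_def by blast
    then show "P (r *\<^sub>R x) (r * c)"
    proof cases
      case 1
      then show ?thesis
        using \<open>0 < r\<close> by (simp add: P_def mult_nonneg_nonpos)
    next
      case 2
      then have "0 < r * s" "(1 / (r * s)) *\<^sub>R (r *\<^sub>R u) \<in> U" "r *\<^sub>R u \<le> r *\<^sub>R x" "r * c \<le> r * s"
        using \<open>0 < r\<close> by (auto simp: cone_scale_scale intro: cone_scale_mono)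
      then show ?thesis
        unfolding P_def by blast
    qed
  next
    show "\<exists>y\<in>cone_hull. \<exists>c. P (x + y) c" if "x \<in> cone_hull" for x
      using that by (intro bexI[of _ x] exI[of _ 0]) (auto simp: P_def)
  qed (rule subcone_cone_hull)
  have sub: "sublinear_on cone_hull gauge"
    using subcone_cone_hull by (rule sublinear_on_gauge) simp
  have "above gauge"
    unfolding above_def
  proof (intro ballI allI impI)
    fix y c assume y: "y \<in> cone_hull" and "P y c"
    show "c \<le> gauge y"
    proof (rule gauge_greatest[OF y])
      fix s assume s: "gauge_rel y s"
      from \<open>P y c\<close> consider "c \<le> 0" | t x where "0 < t" "(1 / t) *\<^sub>R x \<in> U" "x \<le> y" "c \<le> t"
        unfolding P_def by blast
      then show "c \<le> s"
      proof cases
        case 1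
        then show ?thesis using s by (simp add: gauge_rel_def)
      next
        case 2
        have "\<not> s < t"
        proof
          assume "s < t"
          then have "(1 / t) *\<^sub>R y \<in> G"
            using gauge_rel_mono[OF s, of t] by (simp add: gauge_rel_def)
          moreover have "(1 / t) *\<^sub>R x \<le> (1 / t) *\<^sub>R y"
            using 2 by (intro cone_scale_mono) auto
          ultimately have "(1 / t) *\<^sub>R x \<in> G"
            using G(3) by (auto simp: down_closed_def)
          with 2 U(2) show False by auto
        qed
        with 2 show ?thesis by simp
      qed
    qed
  qed
  obtain f where f: "linear_on_cone cone_hull f" "above f" "\<And>x. x \<in> cone_hull \<Longrightarrow> f x \<le> gauge x"
    by (rule linear_sandwich[OF sub \<open>above gauge\<close>]) (rule that)
  obtain h where h: "linear_on_cone cone_hull h" "usc_on cone_hull h"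
    "\<And>x. x \<in> cone_hull \<Longrightarrow> f x \<le> h x" "\<And>x. x \<in> cone_hull \<Longrightarrow> h x \<le> gauge x"
    using usc_linear_sandwich[OF subcone_cone_hull f(1) sub usc_on_gauge[OF order_refl]] f(3)
    by blast
  show thesis
  proof (rule that[of "extension cone_hull h"])
    have "0 \<le> f x" if "x \<in> cone_hull" for x
      using f(2) that unfolding above_def P_def by auto
    then show "cone_linear (extension cone_hull h)"
      using h by (intro cone_linear_extension subcone_cone_hull) (auto intro: cone_hull_down order_trans)
    show "upper_semicontinuous (extension cone_hull h)"
      using h by (intro usc_extension open_cone_hull)
    show "1 \<le> extension cone_hull h x" if "x \<in> U" for x
    proof (cases "x \<in> cone_hull")
      case True
      have "P x 1"
        unfolding P_def using that by (intro disjI2 exI[of _ 1]) (auto simp: cone_scale_one)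
      then have "1 \<le> h x"
        using f(2) h(3)[OF True] True unfolding above_def by force
      then show ?thesis
        using True by (simp add: extension_def)
    qed (simp add: extension_def)
    show "extension cone_hull h y \<le> 1" if "y \<in> G" for y
    proof -
      have "gauge_rel y 1"
        using that by (simp add: gauge_rel_def cone_scale_one)
      then have "y \<in> cone_hull" "gauge y \<le> 1"
        using gauge_le[of y 1] by (auto simp: cone_hull_iff)
      then have "y \<in> cone_hull" "h y \<le> 1"
        using h(4)[of y] by auto
      then show ?thesis
        by (simp add: extension_def)
    qed
  qed
qed

end

section \<open>Linear functionals attached to a compact idempotent\<close>

text \<open>For idempotents, \<open>x + y\<close> is also their midpoint, so the closure of a convex
  neighbourhood of \<open>u\<close> contains a largest idempotent. Over all open convex down-closed
  neighbourhoods these maxima are downward directed with infimum \<open>u\<close>, and compactness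
  of \<open>u\<close> puts one of them below \<open>u\<close>.\<close>

lemma compact_idempotent_nhd:
  fixes u :: "'a::extended_choquet_cone"
  assumes u: "compact_idempotent u"
  obtains V where "open V" "cone_convex V" "down_closed V" "u \<in> V"
    "\<And>w. w \<in> Idem \<Longrightarrow> w \<in> closure V \<Longrightarrow> w \<le> u"
proof -
  define good where "good V \<longleftrightarrow> open V \<and> cone_convex V \<and> down_closed V \<and> u \<in> V" for V :: "'a set"
  define is_max where "is_max V m \<longleftrightarrow> m \<in> Idem \<and> m \<in> closure V \<and> (\<forall>w\<in>Idem. w \<in> closure V \<longrightarrow> w \<le> m)"
    for V :: "'a set" and m
  define D where "D = {m. \<exists>V. good V \<and> is_max V m}"
  have u_Idem: "u \<in> Idem"
    using u by (simp add: compact_idempotent_def)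
  have ex_max: "\<exists>m. is_max V m" if "good V" for V
  proof -
    have V: "cone_convex (closure V)" "u \<in> closure V"
      using that cone_convex_closure closure_subset unfolding good_def by auto
    have "x + y \<in> Idem \<inter> closure V" if "x \<in> Idem \<inter> closure V" "y \<in> Idem \<inter> closure V" for x y
    proof -
      have "(1/2) *\<^sub>R x + (1 - 1/2) *\<^sub>R y \<in> closure V"
        using V(1)[unfolded cone_convex_def, rule_format, of x y "1/2"] that by simp
      then show ?thesis
        using that Idem_scale[of x "1/2"] Idem_scale[of y "1/2"] by (simp add: Idem_add)
    qed
    moreover have "closed (Idem \<inter> closure V)" "Idem \<inter> closure V \<noteq> {}"
      using V u_Idem closed_Idem by auto
    ultimately obtain m where "m \<in> Idem \<inter> closure V" "\<And>x. x \<in> Idem \<inter> closure V \<Longrightarrow> x \<le> m"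
      using greatest_exists[of "Idem \<inter> closure V"] by blast
    then show ?thesis
      by (auto simp: is_max_def)
  qed
  have u_le: "u \<le> m" if "good V" "is_max V m" for V m
    using that u_Idem closure_subset[of V] by (auto simp: good_def is_max_def)
  have "D \<subseteq> Idem"
    by (auto simp: D_def is_max_def)
  moreover have "D \<noteq> {}"
  proof -
    have "good UNIV"
      by (auto simp: good_def cone_convex_def down_closed_def)
    from ex_max[OF this] \<open>good UNIV\<close> show ?thesis
      unfolding D_def by blast
  qed
  moreover have "\<exists>x\<in>D. x \<le> v \<and> x \<le> w" if vw: "v \<in> D" "w \<in> D" for v w
  proof -
    obtain V W where VW: "good V" "is_max V v" "good W" "is_max W w"
      using vw by (auto simp: D_def)
    then have good: "good (V \<inter> W)"
      by (auto simp: good_def cone_convex_def down_closed_def)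
    then obtain x where x: "is_max (V \<inter> W) x"
      using ex_max by blast
    have "closure (V \<inter> W) \<subseteq> closure V" "closure (V \<inter> W) \<subseteq> closure W"
      by (auto intro!: closure_mono)
    then have "x \<le> v" "x \<le> w"
      using x VW by (auto simp: is_max_def)
    with good x show ?thesis
      by (auto simp: D_def)
  qed
  moreover have "isGlb UNIV D u"
  proof -
    have "b \<le> u" if b: "\<And>m. m \<in> D \<Longrightarrow> b \<le> m" for b
    proof (rule ccontr)
      assume "\<not> b \<le> u"
      then have "u \<in> - {y. b \<le> y}" "open (- {y. b \<le> y})"
        using closed_le_left by auto
      then obtain O' where O': "open O'" "cone_convex O'" "u \<in> O'" "closure O' \<subseteq> - {y. b \<le> y}"
        by (metis open_convex_nhd_closure)
      have good: "good (down_hull O')"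
        using O' subset_down_hull[of O']
        by (auto simp: good_def open_down_hull cone_convex_down_hull down_closed_down_hull)
      then obtain m where m: "is_max (down_hull O') m"
        using ex_max by blast
      \<comment> \<open>The hull of the compact set \<open>closure O'\<close> is closed, so
        \<open>m\<close> lies below some \<open>y\<close> in \<open>closure O'\<close>; then
        \<open>b \<le> m \<le> y\<close> contradicts the choice of \<open>O'\<close>.\<close>
      have "down_hull O' \<subseteq> down_hull (closure O')"
        using closure_subset[of O'] by (auto simp: down_hull_def)
      then have "closure (down_hull O') \<subseteq> down_hull (closure O')"
        by (intro closure_minimal closed_down_hull closed_imp_compact) auto
      then obtain y where "y \<in> closure O'" "m \<le> y"
        using m by (auto simp: is_max_def down_hull_def)
      moreover have "b \<le> m"
        using good m by (intro b) (auto simp: D_def)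
      ultimately show False
        using O'(4) by (auto intro: order_trans)
    qed
    then show ?thesis
      using u_le by (auto simp: isGlb_def greatestP_def isLb_def setge_def setle_def D_def)
  qed
  ultimately obtain m where "m \<in> D" "m \<le> u"
    using u unfolding compact_idempotent_def by (metis order_refl)
  then obtain V where V: "good V" "is_max V m"
    by (auto simp: D_def)
  show thesis
    using V \<open>m \<le> u\<close> by (intro that[of V]) (auto simp: good_def is_max_def)
qed

text \<open>The interpolating functionals will dominate \<open>k0\<close> and be real-valued where
  \<open>k0\<close> is finite. \<open>closure_finite\<close> then makes their extension by
  \<open>top\<close> lower semicontinuous, see \<open>lsc_extension\<close>.\<close>

locale usc_unit =
  fixes k0 :: "'a::extended_choquet_cone \<Rightarrow> ennreal" and u :: 'a
  assumes linear: "cone_linear k0" and usc: "upper_semicontinuous k0"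
    and Idem: "u \<in> Idem" and zero_iff: "\<And>y. k0 y = 0 \<longleftrightarrow> y \<le> u"
    and closure_finite: "closure {x. k0 x < 1} \<subseteq> {x. k0 x < top}"

text \<open>By compactness of \<open>- V\<close>, a finite sum \<open>k\<close> of functionals from
  \<open>usc_functional\<close> is at least \<open>1\<close> off \<open>V\<close>. It is finite at
  the idempotent \<open>u\<close>, hence zero there.\<close>

lemma compact_idempotent_imp_usc_unit:
  fixes u :: "'a::extended_choquet_cone"
  assumes u: "compact_idempotent u"
  obtains k where "usc_unit k u"
proof -
  have u_Idem: "u \<in> Idem"
    using u by (simp add: compact_idempotent_def)
  obtain V where V: "open V" "cone_convex V" "down_closed V" "u \<in> V"
    "\<And>w. w \<in> Idem \<Longrightarrow> w \<in> closure V \<Longrightarrow> w \<le> u"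
    using compact_idempotent_nhd[OF u] by blast
  define Q where "Q x U G f \<longleftrightarrow> open U \<and> x \<in> U \<and> open G \<and> u \<in> G \<and> cone_linear f \<and>
    upper_semicontinuous f \<and> (\<forall>y\<in>U. 1 \<le> f y) \<and> (\<forall>y\<in>G. f y \<le> 1)" for x U G and f :: "'a \<Rightarrow> ennreal"
  have "\<exists>U G f. Q x U G f" if "x \<in> - V" for x
  proof -
    have "\<not> x \<le> u"
      using that V(3,4) by (auto simp: down_closed_def)
    then obtain U G where UG: "open U" "cone_convex U" "x \<in> U" "open G" "cone_convex G"
      "down_closed G" "u \<in> G" "U \<inter> G = {}"
      by (rule separate_not_le) (rule that)
    then interpret open_convex_downset G
      by unfold_locales auto
    obtain f where "cone_linear f" "upper_semicontinuous f" "\<And>x. x \<in> U \<Longrightarrow> 1 \<le> f x"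
      "\<And>y. y \<in> G \<Longrightarrow> f y \<le> 1"
      by (rule usc_functional[OF UG(2,8)]) (rule that)
    then have "Q x U G f"
      using UG by (simp add: Q_def)
    then show ?thesis by blast
  qed
  then obtain U G f where Q: "\<And>x. x \<in> - V \<Longrightarrow> Q x (U x) (G x) (f x)"
    by metis
  note Q = Q[unfolded Q_def]
  have "compact (- V)"
    using V(1) by (intro closed_imp_compact) auto
  from compact_finite_subcover[OF this, of U]
  obtain T where T: "finite T" "T \<subseteq> - V" "- V \<subseteq> (\<Union>x\<in>T. U x)"
    using Q by auto
  define k where "k y = (\<Sum>x\<in>T. f x y)" for y
  have lin: "cone_linear k" and usc: "upper_semicontinuous k"
    unfolding k_def using T Q by (auto intro!: cone_linear_sum usc_sum)
  have k_ge: "1 \<le> k y" if "y \<notin> V" for y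
  proof -
    obtain x where x: "x \<in> T" "y \<in> U x"
      using T(3) \<open>y \<notin> V\<close> by auto
    then have "1 \<le> f x y"
      using Q T(2) by auto
    also have "f x y \<le> k y"
      unfolding k_def using T(1) x(1) by (intro member_le_sum) auto
    finally show ?thesis .
  qed
  have "k u \<le> (\<Sum>x\<in>T. 1)"
    unfolding k_def using Q T(2) by (intro sum_mono) auto
  also have "\<dots> < top"
    by (simp add: of_nat_less_top)
  finally have "k u = 0"
    by (intro cone_linear_Idem[OF lin u_Idem])
  have zero: "k y = 0 \<longleftrightarrow> y \<le> u" for y
  proof
    assume "y \<le> u"
    then show "k y = 0"
      using cone_linear_mono[OF lin] \<open>k u = 0\<close> by (metis le_zero_eq)
  next
    assume "k y = 0"
    \<comment> \<open>The whole open ray of \<open>y\<close> has \<open>k = 0\<close> and so lies in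
      \<open>V\<close>. The greatest element of its closure is an idempotent in
      \<open>closure V\<close>, hence below \<open>u\<close>.\<close>
    define S where "S = {t *\<^sub>R y |t. 0 < t}"
    have S_add: "a + b \<in> S" if ab: "a \<in> S" "b \<in> S" for a b
    proof -
      obtain s t where st: "0 < s" "a = s *\<^sub>R y" "0 < t" "b = t *\<^sub>R y"
        using ab unfolding S_def by blast
      then have "a + b = (s + t) *\<^sub>R y" "0 < s + t"
        by (simp_all add: cone_scale_add_left)
      then show ?thesis
        unfolding S_def by blast
    qed
    have S_scale: "2 *\<^sub>R a \<in> S" if a: "a \<in> S" for a
    proof -
      obtain t where "0 < t" "a = t *\<^sub>R y"
        using a by (auto simp: S_def)
      then have "2 *\<^sub>R a = (2 * t) *\<^sub>R y" "0 < 2 * t"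
        by (simp_all add: cone_scale_scale)
      then show ?thesis
        unfolding S_def by blast
    qed
    have "S \<noteq> {}"
      by (auto simp: S_def intro: exI[of _ 1])
    then have "closure S \<noteq> {}"
      by simp
    from greatest_exists[OF closed_closure this closure_add_closed[OF S_add]]
    obtain m where m: "m \<in> closure S" "\<And>a. a \<in> closure S \<Longrightarrow> a \<le> m"
      by blast
    have "2 *\<^sub>R m \<le> m"
      using m S_scale by (intro m(2) closure_scale_closed) auto
    moreover have "1 *\<^sub>R m \<le> 2 *\<^sub>R m"
      by (rule cone_scale_mono_left) auto
    ultimately have "m \<in> Idem"
      by (simp add: Idem_def cone_scale_one)
    moreover have "S \<subseteq> V"
    proof
      fix a assume "a \<in> S"
      then obtain t where "0 < t" "a = t *\<^sub>R y"
        by (auto simp: S_def)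
      then have "k a = 0"
        using \<open>k y = 0\<close> cone_linear_scale[OF lin] by simp
      then show "a \<in> V"
        using k_ge[of a] by force
    qed
    then have "m \<in> closure V"
      using m(1) closure_mono by blast
    ultimately have "m \<le> u"
      by (rule V(5))
    moreover have "1 *\<^sub>R y \<in> S"
      unfolding S_def using zero_less_one by blast
    then have "1 *\<^sub>R y \<le> m"
      using m(2) closure_subset by blast
    ultimately show "y \<le> u"
      by (simp add: cone_scale_one)
  qed
  \<comment> \<open>The idempotent part of \<open>y\<close> stays in \<open>closure V\<close>, by
    convexity with \<open>0\<close>, so \<open>k\<close> vanishes there and is below
    \<open>1\<close> at a small multiple of \<open>y\<close>.\<close>
  have "k y < top" if y: "y \<in> closure {x. k x < 1}" for y
  proof -
    have "{x. k x < 1} \<subseteq> V"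
      using k_ge by force
    then have yV: "y \<in> closure V"
      using y closure_mono by blast
    obtain e where e: "e \<in> Idem" "\<And>t. 0 < t \<Longrightarrow> e \<le> t *\<^sub>R y"
      "\<And>U. open U \<Longrightarrow> e \<in> U \<Longrightarrow> \<exists>n>0. (1 / real n) *\<^sub>R y \<in> U"
      by (rule idempotent_part[of y]) (rule that)
    have "e \<in> closure V"
    proof (rule ccontr)
      assume "e \<notin> closure V"
      then obtain n where n: "0 < n" "(1 / real n) *\<^sub>R y \<notin> closure V"
        using e(3)[of "- closure V"] by auto
      have "(1 / real n) *\<^sub>R y \<in> closure V"
      proof (cases "n = 1")
        case True
        then show ?thesis
          using yV by (simp add: cone_scale_one)
      next
        case False
        have "0 \<in> V"
          using V(3,4) by (auto simp: down_closed_def)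
        then have "0 \<in> closure V"
          using closure_subset by blast
        moreover have "1 / real n \<in> {0<..<1}"
          using n False by auto
        ultimately have "(1 / real n) *\<^sub>R y + (1 - 1 / real n) *\<^sub>R 0 \<in> closure V"
          using cone_convex_closure[OF V(2)] yV unfolding cone_convex_def by blast
        then show ?thesis
          using \<open>1 / real n \<in> {0<..<1}\<close> by (simp add: cone_scale_zero)
      qed
      with n show False by simp
    qed
    then have "k e = 0"
      using V(5) e(1) zero by blast
    then obtain n where n: "0 < n" "k ((1 / real n) *\<^sub>R y) < 1"
      using e(3)[of "{x. k x < 1}"] usc by (auto simp: upper_semicontinuous_def)
    then have "ennreal (1 / real n) * k y < 1"
      by (simp add: cone_linear_scale[OF lin])
    then show ?thesis
      using n(1) by (cases "k y") (auto simp: ennreal_mult_top)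
  qed
  then have "usc_unit k u"
    using lin usc zero u_Idem by unfold_locales auto
  then show thesis by (rule that)
qed

context usc_unit
begin

definition D where "D = {x. k0 x < top}"

lemma subcone_D: "subcone D"
  by (auto simp: subcone_def D_def cone_linear_zero[OF linear] cone_linear_add[OF linear]
      cone_linear_scale[OF linear] ennreal_mult_less_top)

lemma D_down: "x + y \<in> D \<Longrightarrow> x \<in> D"
  by (auto simp: D_def cone_linear_add[OF linear])

lemma open_D: "open D"
  using usc by (simp add: D_def upper_semicontinuous_def)

lemma D_add: "x \<in> D \<Longrightarrow> y \<in> D \<Longrightarrow> x + y \<in> D"
  and D_scale: "0 < t \<Longrightarrow> x \<in> D \<Longrightarrow> t *\<^sub>R x \<in> D"
  using subcone_D by (auto simp: subcone_def)

lemma D_scale_iff: "0 < t \<Longrightarrow> t *\<^sub>R x \<in> D \<longleftrightarrow> x \<in> D"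
  using D_scale[of t x] D_scale[of "1 / t" "t *\<^sub>R x"] by (auto simp: cone_scale_inverse)

lemma u_in_D: "u \<in> D"
  using zero_iff[of u] by (simp add: D_def)

lemma zero_in_D: "0 \<in> D"
  using subcone_D by (simp add: subcone_def)

text \<open>As \<open>k0\<close> is finite at \<open>x\<close>, it is finite and therefore zero at
  the idempotent part of \<open>x\<close>.\<close>

lemma D_idempotent_part:
  assumes "x \<in> D"
  obtains e where "e \<in> Idem" "e \<le> u"
    "\<And>U. open U \<Longrightarrow> e \<in> U \<Longrightarrow> \<exists>n>0. (1 / real n) *\<^sub>R x \<in> U"
proof -
  obtain e where e: "e \<in> Idem" "\<And>t. 0 < t \<Longrightarrow> e \<le> t *\<^sub>R x"
      "\<And>U. open U \<Longrightarrow> e \<in> U \<Longrightarrow> \<exists>n>0. (1 / real n) *\<^sub>R x \<in> U"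
    by (rule idempotent_part[of x]) (rule that)
  have "k0 e \<le> k0 (1 *\<^sub>R x)"
    using e(2)[of 1] by (intro cone_linear_mono[OF linear]) auto
  also have "\<dots> < top"
    using assms by (simp add: cone_scale_one D_def)
  finally have "k0 e = 0"
    by (intro cone_linear_Idem[OF linear e(1)])
  with e show thesis
    by (intro that[of e]) (auto simp: zero_iff)
qed

lemma linear_on_cone_u:
  assumes "linear_on_cone D f"
  shows "f u = 0"
proof -
  have "f (u + u) = f u + f u"
    using assms u_in_D by (simp only: linear_on_cone_def)
  then show ?thesis
    using Idem by (simp add: Idem_add_self)
qed

text \<open>The gauge of \<open>G\<close> is finite on \<open>D\<close>, since small multiples of a
  point of \<open>D\<close> approach an idempotent below \<open>u \<le> z\<close>, which lies in
  \<open>G\<close>. The demands come from the open set \<open>V\<close> alone, so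
  \<open>P_lsc\<close> holds, at the price that \<open>f\<close> and \<open>h\<close> may be
  negative. Taking \<open>V\<close> around \<open>x + u\<close> instead of \<open>x\<close> is
  compensated by \<open>f u = 0\<close>.\<close>

lemma separating_pair:
  assumes x: "x \<in> D" and z: "u \<le> z" "\<not> x \<le> z"
  obtains U G f h where "open U" "x \<in> U" "open G" "z \<in> G" "linear_on_cone D f" "lsc_on D f"
    "linear_on_cone D h" "usc_on D h" "\<And>y. y \<in> D \<Longrightarrow> f y \<le> h y"
    "\<And>y. y \<in> U \<Longrightarrow> y \<in> D \<Longrightarrow> 1 \<le> f y" "\<And>y. y \<in> G \<Longrightarrow> y \<in> D \<Longrightarrow> h y \<le> 1"
proof -
  have "\<not> x + u \<le> z"
    using z(2) le_add_left_cone[of x u] by (auto intro: order_trans)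
  then obtain V G where VG: "open V" "cone_convex V" "x + u \<in> V" "open G" "cone_convex G"
    "down_closed G" "z \<in> G" "V \<inter> G = {}"
    by (rule separate_not_le) (rule that)
  then interpret G: open_convex_downset G
    by unfold_locales auto
  have hull: "D \<subseteq> G.cone_hull"
  proof
    fix y assume "y \<in> D"
    then obtain e where e: "e \<in> Idem" "e \<le> u"
      "\<And>U. open U \<Longrightarrow> e \<in> U \<Longrightarrow> \<exists>n>0. (1 / real n) *\<^sub>R y \<in> U"
      by (rule D_idempotent_part) (rule that)
    have "e \<in> G"
      using e(2) z(1) VG(6,7) unfolding down_closed_def by (meson order_trans)
    then obtain n where "0 < n" "(1 / real n) *\<^sub>R y \<in> G"
      using e(3) VG(4) by blast
    then show "y \<in> G.cone_hull"
      unfolding G.cone_hull_def by (intro CollectI exI[of _ "real n"]) auto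
  qed
  note sub = G.sublinear_on_gauge[OF subcone_D hull] and usc = G.usc_on_gauge[OF hull]
  define P where "P y c \<longleftrightarrow> (\<exists>t>0. (1 / t) *\<^sub>R y \<in> V \<and> c \<le> t)" for y and c :: real
  interpret P: lsc_lower_bound D P
  proof
    fix x y c d assume "P x c" "P y d"
    then obtain s t where st: "0 < s" "(1 / s) *\<^sub>R x \<in> V" "c \<le> s" "0 < t" "(1 / t) *\<^sub>R y \<in> V" "d \<le> t"
      by (auto simp: P_def)
    then have "(1 / (s + t)) *\<^sub>R (x + y) \<in> V"
      by (intro convex_scale_add[OF VG(2)])
    with st show "P (x + y) (c + d)"
      unfolding P_def by (intro exI[of _ "s + t"]) auto
  next
    fix r :: real and x c assume "0 < r" "P x c"
    then obtain s where s: "0 < s" "(1 / s) *\<^sub>R x \<in> V" "c \<le> s"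
      by (auto simp: P_def)
    then show "P (r *\<^sub>R x) (r * c)"
      unfolding P_def using \<open>0 < r\<close> by (intro exI[of _ "r * s"]) (auto simp: cone_scale_scale)
  next
    fix y assume "y \<in> D"
    then obtain e where e: "e \<in> Idem" "e \<le> u"
      "\<And>U. open U \<Longrightarrow> e \<in> U \<Longrightarrow> \<exists>n>0. (1 / real n) *\<^sub>R y \<in> U"
      by (rule D_idempotent_part) (rule that)
    \<comment> \<open>As \<open>e\<close> is absorbed by \<open>u\<close>, adding a small multiple
      of \<open>y\<close> to \<open>x + u\<close> does not leave \<open>V\<close>; this gives a
      demand at \<open>y\<close> plus a multiple of \<open>x + u\<close>.\<close>
    have "e + (x + u) = x + (e + u)"
      by (simp add: ac_simps)
    also have "e + u = u"
      using e by (intro Idem_absorb)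
    finally have "e \<in> {v. v + (x + u) \<in> V}"
      using VG(3) by simp
    with e(3)[OF open_add_vimage[OF VG(1), of "x + u"]]
    obtain n where n: "0 < n" "(1 / real n) *\<^sub>R y + (x + u) \<in> V"
      by blast
    have "(1 / real n) *\<^sub>R (y + real n *\<^sub>R (x + u)) = (1 / real n) *\<^sub>R y + (x + u)"
      using n(1) cone_scale_add_right[of "1 / real n" y "real n *\<^sub>R (x + u)"]
        cone_scale_inverse(2)[of "real n" "x + u"] by simp
    then have "P (y + real n *\<^sub>R (x + u)) (real n)"
      unfolding P_def using n by (intro exI[of _ "real n"]) auto
    moreover have "real n *\<^sub>R (x + u) \<in> D"
      using n(1) x u_in_D by (intro D_scale D_add) auto
    ultimately show "\<exists>z\<in>D. \<exists>c. P (y + z) c" by blast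
  next
    fix x c d assume "P x c" "d < c"
    then obtain t where t: "0 < t" "(1 / t) *\<^sub>R x \<in> V" "c \<le> t"
      by (auto simp: P_def)
    have "open {y. (1 / t) *\<^sub>R y \<in> V}"
      using t(1) VG(1) by (intro open_scale_vimage) auto
    moreover have "P y d" if "(1 / t) *\<^sub>R y \<in> V" for y
      unfolding P_def using that t \<open>d < c\<close> by (intro exI[of _ t]) auto
    ultimately show "\<exists>N. open N \<and> x \<in> N \<and> (\<forall>y\<in>N \<inter> D. P y d)"
      using t(2) by (intro exI[of _ "{y. (1 / t) *\<^sub>R y \<in> V}"]) auto
  qed (rule subcone_D)
  have "P.above G.gauge"
    unfolding P.above_def
  proof (intro ballI allI impI)
    fix y c assume y: "y \<in> D" and "P y c"
    then obtain t where t: "0 < t" "(1 / t) *\<^sub>R y \<in> V" "c \<le> t"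
      by (auto simp: P_def)
    have "y \<in> G.cone_hull"
      using y hull by blast
    then show "c \<le> G.gauge y"
    proof (rule G.gauge_greatest)
      fix s assume s: "G.gauge_rel y s"
      have "\<not> s < t"
      proof
        assume "s < t"
        then have "(1 / t) *\<^sub>R y \<in> G"
          using G.gauge_rel_mono[OF s, of t] by (simp add: G.gauge_rel_def)
        with t(2) VG(8) show False by blast
      qed
      with t(3) show "c \<le> s" by simp
    qed
  qed
  then obtain f where f: "linear_on_cone D f" "lsc_on D f" "P.above f"
    "\<And>x. x \<in> D \<Longrightarrow> f x \<le> G.gauge x"
    using P.lsc_linear_sandwich[OF sub] by blast
  obtain h where h: "linear_on_cone D h" "usc_on D h"
    "\<And>x. x \<in> D \<Longrightarrow> f x \<le> h x" "\<And>x. x \<in> D \<Longrightarrow> h x \<le> G.gauge x"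
    using usc_linear_sandwich[OF subcone_D f(1) sub usc] f(4) by blast
  show thesis
  proof (rule that[of "{y. y + u \<in> V}" G f h])
    show "open {y. y + u \<in> V}"
      by (rule open_add_vimage) (rule VG)
    show "1 \<le> f y" if "y \<in> {y. y + u \<in> V}" "y \<in> D" for y
    proof -
      have "P (y + u) 1"
        unfolding P_def using that by (intro exI[of _ 1]) (auto simp: cone_scale_one)
      then have "1 \<le> f (y + u)"
        using f(3) that(2) u_in_D by (simp add: P.above_def D_add)
      also have "\<dots> = f y + f u"
        using f(1) that(2) u_in_D by (simp add: linear_on_cone_def)
      finally show ?thesis
        by (simp add: linear_on_cone_u[OF f(1)])
    qed
    show "h y \<le> 1" if "y \<in> G" "y \<in> D" for y
    proof -
      have "G.gauge_rel y 1"
        using that by (simp add: G.gauge_rel_def cone_scale_one)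
      then show ?thesis
        using G.gauge_le[of y 1] h(4)[of y] that by simp
    qed
  qed (use VG f h in auto)
qed

text \<open>Outside \<open>D\<close>, \<open>closure_finite\<close> keeps every multiple
  \<open>t *\<^sub>R x\<close> away from \<open>closure {x. k0 x < 1}\<close>. Hence
  \<open>k0 \<ge> 1 / t\<close> near \<open>x\<close>, and \<open>t\<close> is chosen with
  \<open>1 / t = r + 1\<close> above the level \<open>r\<close>.\<close>

lemma lsc_extension:
  assumes f: "lsc_on D f" and ge: "\<And>x. x \<in> D \<Longrightarrow> k0 x \<le> ennreal (f x)"
  shows "lower_semicontinuous (extension D f)"
  unfolding lower_semicontinuous_def
proof
  fix a
  show "open {x. a < extension D f x}"
    unfolding open_subopen[of "{x. a < extension D f x}"]
  proof
    fix x assume "x \<in> {x. a < extension D f x}"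
    then have ax: "a < extension D f x" by simp
    then have "a < top"
      by (rule order_less_le_trans) simp
    then obtain r where r: "a = ennreal r" "0 \<le> r"
      by (cases a) auto
    show "\<exists>T. open T \<and> x \<in> T \<and> T \<subseteq> {x. a < extension D f x}"
    proof (cases "x \<in> D")
      case True
      then have "r < f x"
        using ax r ennreal_leI[of "f x" r] by (auto simp: extension_def not_le[symmetric])
      then have "\<exists>N. open N \<and> x \<in> N \<and> (\<forall>y\<in>N \<inter> D. r < f y)"
        using f True by (simp add: lsc_on_def)
      then obtain N where N: "open N" "x \<in> N" "\<forall>y\<in>N \<inter> D. r < f y"
        by (elim exE conjE)
      have "a < extension D f y" if "y \<in> N" for y
        using N(3) that r by (auto simp: extension_def ennreal_less_iff)
      with N show ?thesis
        by (intro exI[of _ N]) auto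
    next
      case False
      define t where "t = 1 / (r + 1)"
      have t: "0 < t"
        using r by (simp add: t_def)
      let ?N = "{y. t *\<^sub>R y \<in> - closure {x. k0 x < 1}}"
      have "x \<in> ?N"
        using False closure_finite t D_scale_iff[of t x] by (auto simp: D_def)
      moreover have "open ?N"
        using t by (intro open_scale_vimage) auto
      moreover have "a < extension D f y" if "y \<in> ?N" for y
      proof -
        have "t *\<^sub>R y \<notin> {x. k0 x < 1}"
          using that closure_subset[of "{x. k0 x < 1}"] by auto
        then have "1 \<le> ennreal t * k0 y"
          using t by (simp add: cone_linear_scale[OF linear] not_less)
        then have "ennreal (1 / t) * 1 \<le> ennreal (1 / t) * (ennreal t * k0 y)"
          by (intro mult_left_mono) auto
        also have "\<dots> = k0 y"
          using t by (simp flip: mult.assoc ennreal_mult)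
        also have "k0 y \<le> extension D f y"
          using ge by (simp add: extension_def)
        finally have "ennreal (r + 1) \<le> extension D f y"
          by (simp add: t_def)
        moreover have "a < ennreal (r + 1)"
          using r by (simp add: ennreal_less_iff del: ennreal_plus)
        ultimately show ?thesis
          by (rule order_less_le_trans[rotated])
      qed
      ultimately show ?thesis
        by (intro exI[of _ ?N]) auto
    qed
  qed
qed

end

section \<open>Interpolation\<close>

lemma lsc_on_plus:
  assumes f: "lsc_on D f" and g: "lsc_on D g"
  shows "lsc_on D (\<lambda>x. f x + g x)"
  unfolding lsc_on_def
proof (intro ballI allI impI)
  fix x c assume x: "x \<in> D" and c: "c < f x + g x"
  define d where "d = (f x + g x - c) / 2"
  have d: "0 < d"
    using c by (simp add: d_def)
  have "\<exists>N. open N \<and> x \<in> N \<and> (\<forall>y\<in>N \<inter> D. f x - d < f y)"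
    using f x d by (simp add: lsc_on_def)
  then obtain N where N: "open N" "x \<in> N" "\<forall>y\<in>N \<inter> D. f x - d < f y"
    by (elim exE conjE)
  have "\<exists>N. open N \<and> x \<in> N \<and> (\<forall>y\<in>N \<inter> D. g x - d < g y)"
    using g x d by (simp add: lsc_on_def)
  then obtain M where M: "open M" "x \<in> M" "\<forall>y\<in>M \<inter> D. g x - d < g y"
    by (elim exE conjE)
  have "c = (f x - d) + (g x - d)"
    by (simp add: d_def field_simps)
  then have "c < f y + g y" if "y \<in> (N \<inter> M) \<inter> D" for y
  proof -
    have "f x - d < f y" "g x - d < g y"
      using N(3) M(3) that by auto
    with \<open>c = (f x - d) + (g x - d)\<close> show ?thesis by linarith
  qed
  then show "\<exists>N. open N \<and> x \<in> N \<and> (\<forall>y\<in>N \<inter> D. c < f y + g y)"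
    using N M by (intro exI[of _ "N \<inter> M"]) auto
qed

lemma lsc_on_const: "lsc_on D (\<lambda>x. c)"
  by (auto simp: lsc_on_def)

lemma lsc_on_times:
  assumes f: "lsc_on D f" and "0 \<le> t"
  shows "lsc_on D (\<lambda>x. t * f x)"
proof (cases "t = 0")
  case False
  with assms have t: "0 < t" by simp
  show ?thesis
    unfolding lsc_on_def
  proof (intro ballI allI impI)
    fix x c assume x: "x \<in> D" and "c < t * f x"
    then have "c / t < f x"
      using t by (simp add: field_simps)
    then have "\<exists>N. open N \<and> x \<in> N \<and> (\<forall>y\<in>N \<inter> D. c / t < f y)"
      using f x by (simp add: lsc_on_def)
    then show "\<exists>N. open N \<and> x \<in> N \<and> (\<forall>y\<in>N \<inter> D. c < t * f y)"
      using t by (simp add: field_simps)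
  qed
qed (simp add: lsc_on_const)

lemma lsc_on_sum:
  "finite I \<Longrightarrow> (\<And>i. i \<in> I \<Longrightarrow> lsc_on D (f i)) \<Longrightarrow> lsc_on D (\<lambda>x. \<Sum>i\<in>I. f i x)"
  by (induction rule: finite_induct) (simp_all add: lsc_on_const lsc_on_plus)

lemma lsc_on_uminus_iff: "lsc_on D (\<lambda>x. - f x) \<longleftrightarrow> usc_on D f"
proof
  assume "lsc_on D (\<lambda>x. - f x)"
  from usc_on_uminus[OF this] show "usc_on D f" by simp
next
  assume "usc_on D f"
  show "lsc_on D (\<lambda>x. - f x)"
    unfolding lsc_on_def
  proof (intro ballI allI impI)
    fix x c assume "x \<in> D" "c < - f x"
    then have "\<exists>N. open N \<and> x \<in> N \<and> (\<forall>y\<in>N \<inter> D. f y < - c)"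
      using \<open>usc_on D f\<close> by (simp add: usc_on_def)
    then show "\<exists>N. open N \<and> x \<in> N \<and> (\<forall>y\<in>N \<inter> D. c < - f y)"
      by (simp add: less_minus_iff)
  qed
qed

lemma usc_on_times:
  assumes "usc_on D f" "0 \<le> t"
  shows "usc_on D (\<lambda>x. t * f x)"
  using lsc_on_times[of D "\<lambda>x. - f x" t] assms by (simp add: lsc_on_uminus_iff flip: lsc_on_uminus_iff)

lemma usc_on_sum:
  assumes "finite I" "\<And>i. i \<in> I \<Longrightarrow> usc_on D (f i)"
  shows "usc_on D (\<lambda>x. \<Sum>i\<in>I. f i x)"
  using lsc_on_sum[of I D "\<lambda>i x. - f i x"] assms
  by (simp add: lsc_on_uminus_iff sum_negf)

lemma linear_on_cone_times: "linear_on_cone D f \<Longrightarrow> linear_on_cone D (\<lambda>x. c * f x)"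
  by (simp add: linear_on_cone_def algebra_simps)

lemma linear_on_cone_sum:
  "(\<And>i. i \<in> I \<Longrightarrow> linear_on_cone D (f i)) \<Longrightarrow> linear_on_cone D (\<lambda>x. \<Sum>i\<in>I. f i x)"
  by (simp add: linear_on_cone_def sum.distrib sum_distrib_left)

lemma linear_on_cone_zero: "linear_on_cone D f \<Longrightarrow> 0 \<in> D \<Longrightarrow> f 0 = 0"
  unfolding linear_on_cone_def by (metis add.right_neutral add_cancel_left_left)

text \<open>Homogeneity is only given for positive scalars; negative coefficients are reached
  through additivity and \<open>L 0 = 0\<close>.\<close>

lemma linear_on_UNIV_fun:
  fixes L :: "('i \<Rightarrow> real) \<Rightarrow> real"
  assumes L: "linear_on_cone UNIV L" and T: "finite T"
  shows "L (\<lambda>i. if i \<in> T then r i else 0) = (\<Sum>j\<in>T. L (\<lambda>i. if i = j then 1 else 0) * r j)"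
proof -
  have add: "L (f + g) = L f + L g" for f g
    using L by (simp add: linear_on_cone_def)
  have zero: "L 0 = 0"
    using linear_on_cone_zero[OF L] by simp
  have single: "L (\<lambda>i. if i = j then a else 0) = L (\<lambda>i. if i = j then 1 else 0) * a" for j a
  proof -
    have pos: "L (\<lambda>i. if i = j then a else 0) = L (\<lambda>i. if i = j then 1 else 0) * a" if "0 < a" for a
    proof -
      have "(\<lambda>i. if i = j then a else 0) = a *\<^sub>R (\<lambda>i. if i = j then 1 else 0)"
        by (auto simp: scaleR_fun_def)
      then show ?thesis
        using L that by (simp add: linear_on_cone_def mult.commute)
    qed
    consider "0 < a" | "a = 0" | "0 < - a" by linarith
    then show ?thesis
    proof cases
      case 2
      then show ?thesis
        using zero by (simp add: zero_fun_def cong: if_cong)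
    next
      case 3
      have "(\<lambda>i. if i = j then a else 0) + (\<lambda>i. if i = j then - a else 0) = (0 :: 'i \<Rightarrow> real)"
        by (auto simp: fun_eq_iff)
      then have "L (\<lambda>i. if i = j then a else 0) + L (\<lambda>i. if i = j then - a else 0) = 0"
        using add zero by metis
      then show ?thesis
        using pos[OF 3] by simp
    qed (rule pos)
  qed
  show ?thesis
    using T
  proof induction
    case empty
    then show ?case
      using zero by (simp add: zero_fun_def)
  next
    case (insert a T)
    have "(\<lambda>i. if i \<in> insert a T then r i else 0) =
      (\<lambda>i. if i = a then r a else 0) + (\<lambda>i. if i \<in> T then r i else 0)"
      using insert.hyps by (auto simp: fun_eq_iff)
    then show ?case
      by (simp only: add single[of a "r a"] insert.IH sum.insert[OF insert.hyps])
  qed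
qed

context usc_unit
begin

text \<open>The functionals \<open>\<Phi> j \<le> \<Psi> j\<close> separate the points of \<open>{1 \<le> k}\<close> from those of \<open>W\<close>, but they
  are signed. A linear functional on \<open>'i \<Rightarrow> real\<close> between the two bounds \<open>P\<close> and \<open>R\<close> combines them
  with nonnegative coefficients to a pair between \<open>k\<close> and \<open>W\<close>; the term with \<open>\<delta>\<close> in \<open>R\<close> makes the upper
  bound finite.\<close>

lemma interpolation_real:
  assumes k: "cone_linear k" "upper_semicontinuous k" "\<And>x. k0 x \<le> k x" "\<And>x. x \<in> D \<Longrightarrow> k x < top"
    and W: "closed W" "cone_convex W" "down_closed W" "u \<in> W" "\<And>z. z \<in> W \<Longrightarrow> z + u \<in> W"
    and c: "1 < c" "\<And>z. z \<in> W \<Longrightarrow> k z < ennreal (1 / c)"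
  obtains f h where "linear_on_cone D f" "lsc_on D f" "linear_on_cone D h" "usc_on D h"
    "\<And>x. x \<in> D \<Longrightarrow> 0 \<le> f x \<and> k x \<le> ennreal (f x)" "\<And>x. x \<in> D \<Longrightarrow> f x \<le> h x" "\<And>z. z \<in> W \<Longrightarrow> h z \<le> 1"
proof -
  have zero_W: "0 \<in> W"
    using W(3,4) by (auto simp: down_closed_def)
  have W_D: "z \<in> D" if "z \<in> W" for z
    using c(2)[OF that] k(3)[of z] by (auto simp: D_def intro: order_le_less_trans less_trans[of _ "ennreal (1 / c)"])
  \<comment> \<open>The second condition cuts \<open>{1 \<le> k}\<close> down to a closed set inside
    \<open>D\<close>. It retains all points with \<open>k x = 1\<close>: there
    \<open>k0 x \<le> 1\<close>, so a third of \<open>x\<close> has \<open>k0 < 1\<close>.\<close>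
  define L where "L = {x. 1 \<le> k x} \<inter> {x. (1/3) *\<^sub>R x \<in> closure {x. k0 x < 1}}"
  have "open {x. k x < 1}"
    using k(2) by (simp add: upper_semicontinuous_def)
  then have "closed (- {x. k x < 1})"
    by (rule closed_Compl)
  moreover have "- {x. k x < 1} = {x. 1 \<le> k x}"
    by auto
  moreover have "closed {x. (1/3) *\<^sub>R x \<in> closure {x. k0 x < 1}}"
    using closed_vimage[OF closed_closure continuous_on_cone_scale_left[of "1/3"]]
    by (simp add: vimage_def)
  ultimately have L_closed: "closed L"
    unfolding L_def by (intro closed_Int) auto
  have L_D: "x \<in> D" if "x \<in> L" for x
  proof -
    have "(1/3) *\<^sub>R x \<in> D"
      using that closure_finite by (auto simp: L_def D_def)
    then show ?thesis
      by (subst (asm) D_scale_iff) auto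
  qed
  have sep: "\<not> (1 / c) *\<^sub>R x \<le> z" if "x \<in> L" "z \<in> W" for x z
  proof
    assume "(1 / c) *\<^sub>R x \<le> z"
    then have "k ((1 / c) *\<^sub>R x) \<le> k z"
      by (rule cone_linear_mono[OF k(1)])
    also have "\<dots> < ennreal (1 / c)"
      using c(2) that by blast
    finally have "ennreal (1 / c) * k x < ennreal (1 / c)"
      using c(1) by (simp add: cone_linear_scale[OF k(1)])
    moreover have "ennreal (1 / c) * 1 \<le> ennreal (1 / c) * k x"
      using \<open>x \<in> L\<close> by (intro mult_left_mono) (auto simp: L_def)
    ultimately show False by simp
  qed
  \<comment> \<open>\<open>separating_pair\<close> needs \<open>u \<le> z\<close>. A general
    \<open>z\<close> is later replaced by \<open>z + u\<close>, which stays in \<open>W\<close> and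
    does not change the functionals.\<close>
  define K where "K = L \<times> (W \<inter> {z. u \<le> z})"
  have K: "compact K"
    unfolding K_def using L_closed W(1) closed_le_left
    by (intro compact_Times closed_imp_compact closed_Int) auto
  define Q where "Q p U G f h \<longleftrightarrow> open U \<and> (1 / c) *\<^sub>R fst p \<in> U \<and> open G \<and> snd p \<in> G \<and>
    linear_on_cone D f \<and> lsc_on D f \<and> linear_on_cone D h \<and> usc_on D h \<and> (\<forall>y\<in>D. f y \<le> h y) \<and>
    (\<forall>y\<in>U \<inter> D. 1 \<le> f y) \<and> (\<forall>y\<in>G \<inter> D. h y \<le> 1)" for p :: "'a \<times> 'a" and U G f h
  have "\<exists>U G f h. Q p U G f h" if p: "p \<in> K" for p
  proof -
    have "fst p \<in> L" "snd p \<in> W" "u \<le> snd p"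
      using p by (auto simp: K_def)
    then have *: "(1 / c) *\<^sub>R fst p \<in> D" "u \<le> snd p" "\<not> (1 / c) *\<^sub>R fst p \<le> snd p"
      using sep L_D c(1) by (auto intro!: D_scale)
    obtain U G f h where "open U" "(1 / c) *\<^sub>R fst p \<in> U" "open G" "snd p \<in> G"
      "linear_on_cone D f" "lsc_on D f" "linear_on_cone D h" "usc_on D h" "\<And>y. y \<in> D \<Longrightarrow> f y \<le> h y"
      "\<And>y. y \<in> U \<Longrightarrow> y \<in> D \<Longrightarrow> 1 \<le> f y" "\<And>y. y \<in> G \<Longrightarrow> y \<in> D \<Longrightarrow> h y \<le> 1"
      by (rule separating_pair[OF *]) (rule that)
    then have "Q p U G f h"
      by (simp add: Q_def)
    then show ?thesis by blast
  qed
  then obtain U G \<Phi> \<Psi> where Q: "\<And>p. p \<in> K \<Longrightarrow> Q p (U p) (G p) (\<Phi> p) (\<Psi> p)"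
    by metis
  define B where "B p = {x. (1 / c) *\<^sub>R x \<in> U p} \<times> G p" for p
  have "open (B p) \<and> p \<in> B p" if "p \<in> K" for p
    using Q[OF that] c(1) unfolding B_def Q_def
    by (auto intro!: open_Times open_scale_vimage simp: mem_Times_iff)
  from compact_finite_subcover[OF K this]
  obtain T where T: "finite T" "T \<subseteq> K" "K \<subseteq> (\<Union>p\<in>T. B p)"
    by auto
  have QT: "Q j (U j) (G j) (\<Phi> j) (\<Psi> j)" if "j \<in> T" for j
    using Q that T(2) by blast
  have \<Phi>: "linear_on_cone D (\<Phi> j)" "lsc_on D (\<Phi> j)" and \<Psi>: "linear_on_cone D (\<Psi> j)" "usc_on D (\<Psi> j)"
    and \<Phi>_le: "\<And>y. y \<in> D \<Longrightarrow> \<Phi> j y \<le> \<Psi> j y"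
    and \<Phi>_ge: "\<And>y. y \<in> U j \<Longrightarrow> y \<in> D \<Longrightarrow> 1 \<le> \<Phi> j y"
    and \<Psi>_le: "\<And>y. y \<in> G j \<Longrightarrow> y \<in> D \<Longrightarrow> \<Psi> j y \<le> 1" if "j \<in> T" for j
    using QT[OF that] by (simp_all add: Q_def)
  have \<Phi>_zero: "\<Phi> j 0 = 0" and \<Psi>_zero: "\<Psi> j 0 = 0" if "j \<in> T" for j
    using linear_on_cone_zero[OF _ zero_in_D] \<Phi> \<Psi> that by blast+
  have \<Phi>_add: "\<Phi> j (x + y) = \<Phi> j x + \<Phi> j y" and \<Psi>_add: "\<Psi> j (x + y) = \<Psi> j x + \<Psi> j y"
    if "j \<in> T" "x \<in> D" "y \<in> D" for j x y
    using \<Phi>(1) \<Psi>(1) that unfolding linear_on_cone_def by blast+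
  have \<Phi>_scale: "\<Phi> j (t *\<^sub>R x) = t * \<Phi> j x" and \<Psi>_scale: "\<Psi> j (t *\<^sub>R x) = t * \<Psi> j x"
    if "j \<in> T" "0 < t" "x \<in> D" for j t x
    using \<Phi>(1) \<Psi>(1) that unfolding linear_on_cone_def by blast+
  define kr where "kr x = enn2real (k x)" for x
  have kr: "ennreal (kr x) = k x" "0 \<le> kr x" if "x \<in> D" for x
    using k(4)[OF that] by (simp_all add: kr_def)
  have kr_add: "kr (x + y) = kr x + kr y" if "x \<in> D" "y \<in> D" for x y
    using k(4) that by (simp add: kr_def cone_linear_add[OF k(1)] enn2real_plus)
  have kr_scale: "kr (t *\<^sub>R x) = t * kr x" if "0 < t" for t x
    using that by (simp add: kr_def cone_linear_scale[OF k(1)] enn2real_mult)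
  have kr_zero: "kr 0 = 0"
    by (simp add: kr_def cone_linear_zero[OF k(1)])
  \<comment> \<open>\<open>N\<close> is the price of one unit of slack, chosen so that a slack of
    \<open>(c - 1) * b\<close> costs \<open>b\<close>.\<close>
  define N where "N = 1 / (c - 1)"
  have N: "0 < N" "N * (c - 1) = 1"
    using c(1) by (auto simp: N_def)
  \<comment> \<open>A vector \<open>r\<close> above all \<open>\<Phi> j x\<close> must get at least
    \<open>k x\<close>. A vector below all \<open>\<Psi> j z + \<delta> j\<close>, with
    \<open>z\<close> in \<open>s\<close> times \<open>W\<close>, must get at most \<open>s\<close>
    plus the price of the slack.\<close>
  define P where "P r a \<longleftrightarrow> (\<exists>x\<in>D. (\<forall>j\<in>T. \<Phi> j x \<le> r j) \<and> a \<le> kr x)" for r :: "'a \<times> 'a \<Rightarrow> real" and a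
  define R where "R r a \<longleftrightarrow> (\<exists>s>0. \<exists>z \<delta>. (1 / s) *\<^sub>R z \<in> W \<and> (\<forall>j\<in>T. 0 \<le> \<delta> j \<and> r j \<le> \<Psi> j z + \<delta> j) \<and>
    s + N * (\<Sum>j\<in>T. \<delta> j) \<le> a)" for r :: "'a \<times> 'a \<Rightarrow> real" and a
  have scale_W: "z \<in> D" if "0 < s" "(1 / s) *\<^sub>R z \<in> W" for s z
    using W_D[OF that(2)] that(1) by (simp add: D_scale_iff)
  interpret P: lower_bound UNIV P
  proof
    fix r s and a b assume "P r a" "P s b"
    then obtain x y where "x \<in> D" "\<forall>j\<in>T. \<Phi> j x \<le> r j" "a \<le> kr x" "y \<in> D" "\<forall>j\<in>T. \<Phi> j y \<le> s j" "b \<le> kr y"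
      unfolding P_def by blast
    then show "P (r + s) (a + b)"
      unfolding P_def by (intro bexI[of _ "x + y"]) (auto simp: \<Phi>_add kr_add D_add add_mono)
  next
    fix t :: real and r a assume "0 < t" "P r a"
    then obtain x where "x \<in> D" "\<forall>j\<in>T. \<Phi> j x \<le> r j" "a \<le> kr x"
      unfolding P_def by blast
    then show "P (t *\<^sub>R r) (t * a)"
      using \<open>0 < t\<close> unfolding P_def
      by (intro bexI[of _ "t *\<^sub>R x"]) (auto simp: \<Phi>_scale kr_scale D_scale scaleR_fun_def)
  next
    fix r :: "'a \<times> 'a \<Rightarrow> real"
    have "P (r + (\<lambda>j. - r j)) 0"
      unfolding P_def by (intro bexI[of _ 0]) (auto simp: \<Phi>_zero kr_zero zero_in_D)
    then show "\<exists>s\<in>UNIV. \<exists>a. P (r + s) a" by blast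
  qed (simp add: subcone_def)
  define q where "q r = Inf {a. R r a}" for r
  have q: "sublinear_on UNIV q \<and> P.above q \<and> (\<forall>r\<in>UNIV. \<forall>a. R r a \<longrightarrow> q r \<le> a)"
    unfolding q_def
  proof (rule P.sublinear_on_Inf)
    fix r :: "'a \<times> 'a \<Rightarrow> real"
    have "R r (1 + N * (\<Sum>j\<in>T. max 0 (r j)))"
      unfolding R_def using zero_W
      by (intro exI[of _ 1] conjI exI[of _ 0] exI[of _ "\<lambda>j. max 0 (r j)"])
        (auto simp: cone_scale_one \<Psi>_zero)
    then show "\<exists>a. R r a" by blast
  next
    fix r r' :: "'a \<times> 'a \<Rightarrow> real" and a a' assume "R r a" "R r' a'"
    then obtain s z \<delta> s' z' \<delta>' where
      1: "0 < s" "(1 / s) *\<^sub>R z \<in> W" "\<forall>j\<in>T. 0 \<le> \<delta> j \<and> r j \<le> \<Psi> j z + \<delta> j" "s + N * (\<Sum>j\<in>T. \<delta> j) \<le> a" and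
      2: "0 < s'" "(1 / s') *\<^sub>R z' \<in> W" "\<forall>j\<in>T. 0 \<le> \<delta>' j \<and> r' j \<le> \<Psi> j z' + \<delta>' j" "s' + N * (\<Sum>j\<in>T. \<delta>' j) \<le> a'"
      unfolding R_def by blast
    have D: "z \<in> D" "z' \<in> D"
      using scale_W 1 2 by blast+
    have "(1 / (s + s')) *\<^sub>R (z + z') \<in> W"
      using 1 2 by (intro convex_scale_add[OF W(2)])
    moreover have "\<forall>j\<in>T. 0 \<le> \<delta> j + \<delta>' j \<and> (r + r') j \<le> \<Psi> j (z + z') + (\<delta> j + \<delta>' j)"
    proof
      fix j assume "j \<in> T"
      with 1(3) 2(3) have "0 \<le> \<delta> j \<and> r j \<le> \<Psi> j z + \<delta> j" "0 \<le> \<delta>' j \<and> r' j \<le> \<Psi> j z' + \<delta>' j"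
        by blast+
      then show "0 \<le> \<delta> j + \<delta>' j \<and> (r + r') j \<le> \<Psi> j (z + z') + (\<delta> j + \<delta>' j)"
        using D \<open>j \<in> T\<close> by (simp add: \<Psi>_add)
    qed
    moreover have "(s + s') + N * (\<Sum>j\<in>T. \<delta> j + \<delta>' j) \<le> a + a'"
      using 1(4) 2(4) by (simp add: sum.distrib distrib_left)
    moreover have "0 < s + s'"
      using 1 2 by simp
    ultimately show "R (r + r') (a + a')"
      unfolding R_def by (intro exI[of _ "s + s'"] conjI exI[of _ "z + z'"] exI[of _ "\<lambda>j. \<delta> j + \<delta>' j"])
  next
    fix t :: real and r :: "'a \<times> 'a \<Rightarrow> real" and a assume t: "0 < t" and "R r a"
    then obtain s z \<delta> where
      1: "0 < s" "(1 / s) *\<^sub>R z \<in> W" "\<forall>j\<in>T. 0 \<le> \<delta> j \<and> r j \<le> \<Psi> j z + \<delta> j" "s + N * (\<Sum>j\<in>T. \<delta> j) \<le> a"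
      unfolding R_def by blast
    have D: "z \<in> D"
      using scale_W 1 by blast
    have "(1 / (t * s)) *\<^sub>R (t *\<^sub>R z) \<in> W" "0 < t * s"
      using 1 t by (simp_all add: cone_scale_scale)
    moreover have "\<forall>j\<in>T. 0 \<le> t * \<delta> j \<and> (t *\<^sub>R r) j \<le> \<Psi> j (t *\<^sub>R z) + t * \<delta> j"
    proof
      fix j assume "j \<in> T"
      with 1(3) have "0 \<le> \<delta> j" "r j \<le> \<Psi> j z + \<delta> j" by blast+
      then have "0 \<le> t * \<delta> j" "t * r j \<le> t * (\<Psi> j z + \<delta> j)"
        using t by (auto intro: mult_left_mono)
      then show "0 \<le> t * \<delta> j \<and> (t *\<^sub>R r) j \<le> \<Psi> j (t *\<^sub>R z) + t * \<delta> j"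
        using D t \<open>j \<in> T\<close> by (simp add: \<Psi>_scale scaleR_fun_def distrib_left)
    qed
    moreover have "t * s + N * (\<Sum>j\<in>T. t * \<delta> j) \<le> t * a"
      using mult_left_mono[OF 1(4), of t] t by (simp add: algebra_simps sum_distrib_left)
    ultimately show "R (t *\<^sub>R r) (t * a)"
      unfolding R_def by (intro exI[of _ "t * s"] conjI exI[of _ "t *\<^sub>R z"] exI[of _ "\<lambda>j. t * \<delta> j"])
  next
    fix r :: "'a \<times> 'a \<Rightarrow> real" and a b assume "R r a" "P r b"
    then obtain s z \<delta> x where
      1: "0 < s" "(1 / s) *\<^sub>R z \<in> W" "\<forall>j\<in>T. 0 \<le> \<delta> j \<and> r j \<le> \<Psi> j z + \<delta> j" "s + N * (\<Sum>j\<in>T. \<delta> j) \<le> a" and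
      2: "x \<in> D" "\<forall>j\<in>T. \<Phi> j x \<le> r j" "b \<le> kr x"
      unfolding R_def P_def by blast
    have z: "z \<in> D"
      using scale_W 1 by blast
    have sum: "\<delta> j \<le> (\<Sum>j\<in>T. \<delta> j)" if "j \<in> T" for j
      using T(1) 1(3) that by (intro member_le_sum) auto
    have sum_nonneg: "0 \<le> (\<Sum>j\<in>T. \<delta> j)"
      using 1(3) by (intro sum_nonneg) auto
    \<comment> \<open>Otherwise scale \<open>x\<close> to \<open>k\<close>-value \<open>1\<close>
      and \<open>z + u\<close> into \<open>W\<close>. A member of the cover containing this pair
      gives \<open>j\<close> with \<open>\<Phi> j x \<ge> c * b\<close> and
      \<open>\<Psi> j z \<le> s < b\<close>, so the slack at \<open>j\<close> alone costs at least
      \<open>b\<close>.\<close>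
    have "kr x \<le> s + N * (\<Sum>j\<in>T. \<delta> j)"
    proof (rule ccontr)
      assume less: "\<not> ?thesis"
      define b where "b = kr x"
      have b: "s < b" "0 < b"
        using less 1(1) N(1) sum_nonneg by (auto simp: b_def not_le intro: order_le_less_trans[rotated])
      have "k ((1 / b) *\<^sub>R x) = ennreal (kr ((1 / b) *\<^sub>R x))"
        using b 2(1) by (intro kr(1)[symmetric] D_scale) auto
      then have k1: "k ((1 / b) *\<^sub>R x) = 1"
        using b by (simp add: kr_scale flip: b_def)
      have "k0 ((1/3) *\<^sub>R ((1 / b) *\<^sub>R x)) = ennreal (1/3) * k0 ((1 / b) *\<^sub>R x)"
        by (intro cone_linear_scale[OF linear]) simp
      also have "\<dots> \<le> ennreal (1/3) * 1"
        using k(3)[of "(1 / b) *\<^sub>R x"] k1 by (intro mult_left_mono) auto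
      also have "\<dots> < 1"
        by (simp add: ennreal_less_one_iff)
      finally have "(1/3) *\<^sub>R ((1 / b) *\<^sub>R x) \<in> closure {x. k0 x < 1}"
        by (intro subsetD[OF closure_subset] CollectI)
      then have "(1 / b) *\<^sub>R x \<in> L"
        using k1 by (simp add: L_def)
      moreover have "(1 / s) *\<^sub>R (z + u) = (1 / s) *\<^sub>R z + u"
        using 1(1) Idem_scale[OF Idem, of "1 / s"] by (simp add: cone_scale_add_right)
      then have zu: "(1 / s) *\<^sub>R (z + u) \<in> W \<inter> {z. u \<le> z}"
        using W(5)[OF 1(2)] le_add_left_cone[of u "(1 / s) *\<^sub>R z"] by (simp add: add.commute)
      ultimately obtain j where j: "j \<in> T" "((1 / b) *\<^sub>R x, (1 / s) *\<^sub>R (z + u)) \<in> B j"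
        using T(3) unfolding K_def by blast
      have "1 \<le> \<Phi> j ((1 / c) *\<^sub>R ((1 / b) *\<^sub>R x))"
        using j b c(1) 2(1) by (intro \<Phi>_ge D_scale) (auto simp: B_def)
      also have "\<dots> = 1 / c * (1 / b * \<Phi> j x)"
        using j(1) b c(1) 2(1) by (simp add: \<Phi>_scale D_scale)
      finally have "c * b \<le> \<Phi> j x"
        using b c(1) by (simp add: field_simps)
      also have "\<dots> \<le> \<Psi> j z + \<delta> j"
        using 1(3) 2(2) j(1) by (blast intro: order_trans)
      also have "\<Psi> j z \<le> s"
      proof -
        have "\<Psi> j ((1 / s) *\<^sub>R (z + u)) \<le> 1"
          using j 1(1) z u_in_D by (intro \<Psi>_le D_scale D_add) (auto simp: B_def)
        moreover have "\<Psi> j ((1 / s) *\<^sub>R (z + u)) = 1 / s * (\<Psi> j z + \<Psi> j u)"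
          using j(1) 1(1) z u_in_D by (simp add: \<Psi>_scale \<Psi>_add D_add)
        moreover have "\<Psi> j u = 0"
          by (rule linear_on_cone_u[OF \<Psi>(1)[OF j(1)]])
        ultimately have "1 / s * \<Psi> j z \<le> 1"
          by (simp only: add_0_right)
        then show ?thesis
          using 1(1) by (simp add: field_simps)
      qed
      finally have "(c - 1) * b \<le> \<delta> j"
        using b(1) by (simp add: algebra_simps)
      then have "N * ((c - 1) * b) \<le> N * (\<Sum>j\<in>T. \<delta> j)"
        using sum[OF j(1)] N(1) by (intro mult_left_mono) auto
      also have "N * ((c - 1) * b) = b"
        using N(2) by (simp flip: mult.assoc)
      finally show False
        using less 1(1) by (simp add: b_def)
    qed
    with 1(4) 2(3) show "b \<le> a" by simp
  qed
  then obtain \<Lambda> where \<Lambda>: "linear_on_cone UNIV \<Lambda>" "P.above \<Lambda>" "\<And>r. \<Lambda> r \<le> q r"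
    using P.linear_sandwich[of q] by auto
  define t where "t j = \<Lambda> (\<lambda>i. if i = j then 1 else 0)" for j
  \<comment> \<open>With \<open>x = 0\<close>, \<open>P\<close> demands \<open>0\<close> at every
    nonnegative vector.\<close>
  have t: "0 \<le> t j" for j
  proof -
    have "P (\<lambda>i. if i = j then 1 else 0) 0"
      unfolding P_def by (intro bexI[of _ 0]) (auto simp: \<Phi>_zero kr_zero zero_in_D)
    then show ?thesis
      using \<Lambda>(2) by (simp add: P.above_def t_def)
  qed
  have \<Lambda>_sum: "\<Lambda> (\<lambda>i. if i \<in> T then r i else 0) = (\<Sum>j\<in>T. t j * r j)" for r
    unfolding t_def by (rule linear_on_UNIV_fun[OF \<Lambda>(1) T(1)])
  show thesis
  proof (rule that[of "\<lambda>x. \<Sum>j\<in>T. t j * \<Phi> j x" "\<lambda>x. \<Sum>j\<in>T. t j * \<Psi> j x"])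
    show "linear_on_cone D (\<lambda>x. \<Sum>j\<in>T. t j * \<Phi> j x)" "linear_on_cone D (\<lambda>x. \<Sum>j\<in>T. t j * \<Psi> j x)"
      using \<Phi>(1) \<Psi>(1) by (auto intro!: linear_on_cone_sum linear_on_cone_times)
    show "lsc_on D (\<lambda>x. \<Sum>j\<in>T. t j * \<Phi> j x)" "usc_on D (\<lambda>x. \<Sum>j\<in>T. t j * \<Psi> j x)"
      using \<Phi>(2) \<Psi>(2) T(1) t by (auto intro!: lsc_on_sum lsc_on_times usc_on_sum usc_on_times)
    show "(\<Sum>j\<in>T. t j * \<Phi> j x) \<le> (\<Sum>j\<in>T. t j * \<Psi> j x)" if "x \<in> D" for x
      using \<Phi>_le that t by (intro sum_mono mult_left_mono)
    show "0 \<le> (\<Sum>j\<in>T. t j * \<Phi> j x) \<and> k x \<le> ennreal (\<Sum>j\<in>T. t j * \<Phi> j x)" if "x \<in> D" for x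
    proof -
      have "P (\<lambda>i. if i \<in> T then \<Phi> i x else 0) (kr x)"
        unfolding P_def using that by (intro bexI[of _ x]) auto
      then have "kr x \<le> \<Lambda> (\<lambda>i. if i \<in> T then \<Phi> i x else 0)"
        using \<Lambda>(2) by (simp add: P.above_def)
      then show ?thesis
        using kr[OF that] unfolding \<Lambda>_sum by (metis ennreal_leI order_trans)
    qed
    show "(\<Sum>j\<in>T. t j * \<Psi> j z) \<le> 1" if "z \<in> W" for z
    proof -
      have "R (\<lambda>i. if i \<in> T then \<Psi> i z else 0) 1"
        unfolding R_def using that
        by (intro exI[of _ 1] conjI exI[of _ z] exI[of _ "\<lambda>j. 0"]) (auto simp: cone_scale_one)
      then have "\<Lambda> (\<lambda>i. if i \<in> T then \<Psi> i z else 0) \<le> 1"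
        using q \<Lambda>(3) by (blast intro: order_trans)
      then show ?thesis
        by (simp add: \<Lambda>_sum)
    qed
  qed
qed

end

section \<open>Separation by functions in \<open>Lsc_sigma\<close>\<close>

context usc_unit
begin

text \<open>With \<open>b ^ 3 = c\<close>, multiplying \<open>k\<close> by \<open>b\<close> keeps it
  at most \<open>b / c = 1 / b ^ 2\<close> on \<open>W\<close>, strictly below the
  \<open>1 / b\<close> required by \<open>interpolation_real\<close>. Dividing the result by
  \<open>b\<close> leaves the bound \<open>1 / b < 1\<close>, so the step can be repeated.\<close>

lemma interpolation:
  assumes k: "cone_linear k" "upper_semicontinuous k" "\<And>x. k0 x \<le> k x" "\<And>x. x \<in> D \<Longrightarrow> k x < top"
    and W: "closed W" "cone_convex W" "down_closed W" "u \<in> W" "\<And>z. z \<in> W \<Longrightarrow> z + u \<in> W"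
    and c: "1 < c" "\<And>z. z \<in> W \<Longrightarrow> k z \<le> ennreal (1 / c)"
  obtains f h b where "cone_linear f" "lower_semicontinuous f" "cone_linear h" "upper_semicontinuous h"
    "\<And>x. k x \<le> f x" "\<And>x. f x \<le> h x" "\<And>x. x \<in> D \<Longrightarrow> h x < top"
    "1 < b" "\<And>z. z \<in> W \<Longrightarrow> h z \<le> ennreal (1 / b)"
proof -
  define b where "b = root 3 c"
  have b: "1 < b" "b ^ 3 = c"
    using c(1) by (simp_all add: b_def)
  then have "0 < b" by simp
  note inv = less_times_ennreal_iff[OF \<open>0 < b\<close>]
  let ?k = "\<lambda>x. ennreal b * k x"
  have k_le: "k x \<le> ?k x" for x
    using mult_right_mono[of 1 "ennreal b" "k x"] b(1) by simp
  have W_D: "z \<in> D" if "z \<in> W" for z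
  proof -
    have "k0 z \<le> ennreal (1 / c)"
      using k(3) c(2)[OF that] by (rule order_trans)
    also have "\<dots> < top" by simp
    finally show ?thesis by (simp add: D_def)
  qed
  have "?k z < ennreal (1 / b)" if "z \<in> W" for z
  proof -
    have "?k z \<le> ennreal b * ennreal (1 / c)"
      using c(2)[OF that] by (intro mult_left_mono) auto
    also have "\<dots> = ennreal (b / c)"
      using b c(1) by (simp flip: ennreal_mult)
    also have "b / c < 1 / b"
      using b by (simp add: field_simps power3_eq_cube flip: b(2))
    then have "ennreal (b / c) < ennreal (1 / b)"
      using b c(1) by (simp add: ennreal_less_iff)
    finally show ?thesis .
  qed
  moreover have "k0 x \<le> ?k x" for x
    using k(3) k_le by (rule order_trans)
  moreover have "?k x < top" if "x \<in> D" for x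
    using k(4)[OF that] by (simp add: ennreal_mult_less_top)
  ultimately obtain f h where fh: "linear_on_cone D f" "lsc_on D f" "linear_on_cone D h" "usc_on D h"
    "\<And>x. x \<in> D \<Longrightarrow> 0 \<le> f x \<and> ?k x \<le> ennreal (f x)" "\<And>x. x \<in> D \<Longrightarrow> f x \<le> h x"
    "\<And>z. z \<in> W \<Longrightarrow> h z \<le> 1"
    using interpolation_real[OF cone_linear_times[OF k(1)] usc_times[OF \<open>0 < b\<close> k(2)] _ _ W b(1)]
    by blast
  let ?f = "\<lambda>x. ennreal (1 / b) * extension D f x"
  let ?h = "\<lambda>x. ennreal (1 / b) * extension D h x"
  have b': "0 < 1 / b"
    using \<open>0 < b\<close> by simp
  show thesis
  proof (rule that[of ?f ?h b])
    show "cone_linear ?f"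
      using fh by (intro cone_linear_times cone_linear_extension subcone_D) (auto intro: D_down)
    have h_nonneg: "0 \<le> h x" if "x \<in> D" for x
      using fh(5,6)[OF that] by simp
    show "cone_linear ?h"
      using fh h_nonneg by (intro cone_linear_times cone_linear_extension subcone_D) (auto intro: D_down)
    have "k0 x \<le> ennreal (f x)" if "x \<in> D" for x
      using fh(5)[OF that] k(3)[of x] k_le[of x] by (auto intro: order_trans)
    then show "lower_semicontinuous ?f"
      using fh by (intro lsc_times[OF b'] lsc_extension)
    show "upper_semicontinuous ?h"
      using fh by (intro usc_times[OF b'] usc_extension open_D)
    show "k x \<le> ?f x" for x
    proof -
      have "?k x \<le> extension D f x"
        using fh(5)[of x] by (auto simp: extension_def)
      then have "ennreal (1 / b) * ?k x \<le> ?f x"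
        by (rule mult_left_mono) simp
      then show ?thesis
        using \<open>0 < b\<close> by (simp flip: mult.assoc ennreal_mult)
    qed
    show "?f x \<le> ?h x" for x
      using fh(6)[of x] by (intro mult_left_mono) (auto simp: extension_def intro: ennreal_leI)
    show "?h x < top" if "x \<in> D" for x
      using that by (simp add: extension_def ennreal_mult_less_top)
    show "?h z \<le> ennreal (1 / b)" if "z \<in> W" for z
    proof -
      have "extension D h z \<le> 1"
        using W_D[OF that] fh(7)[OF that] by (simp add: extension_def)
      then have "?h z \<le> ennreal (1 / b) * 1"
        by (intro mult_left_mono) auto
      then show ?thesis by simp
    qed
  qed (rule b)
qed

lemma Lsc_sigma_positive_off_idempotent:
  obtains s G where "s \<in> Lsc_sigma" "\<And>y. \<not> y \<le> u \<Longrightarrow> 0 < s y" "open G" "down_closed G" "u \<in> G"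
    "\<And>y. y \<in> G \<Longrightarrow> s y \<le> 1"
proof -
  have "(0::ennreal) < ennreal (1/2)"
    unfolding ennreal_less_zero_iff by simp
  then have "open {x. k0 x < ennreal (1/2)}" "u \<in> {x. k0 x < ennreal (1/2)}"
    using usc zero_iff[of u] unfolding upper_semicontinuous_def by auto
  then obtain U where U: "open U" "cone_convex U" "u \<in> U" "closure U \<subseteq> {x. k0 x < ennreal (1/2)}"
    by (rule open_convex_nhd_closure) (rule that)
  \<comment> \<open>Adding \<open>u\<close> before the test makes \<open>W\<close> closed under
    adding \<open>u\<close>, because \<open>u + u = u\<close>.\<close>
  define W where "W = {y. y + u \<in> down_hull (closure U)}"
  have uu: "u + u = u"
    using Idem by (simp add: Idem_add_self)
  have "closed (down_hull (closure U))"
    by (intro closed_down_hull closed_imp_compact) simp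
  then have W1: "closed W"
    using closed_vimage[of "down_hull (closure U)" "\<lambda>y. y + u"]
    by (simp add: W_def vimage_def continuous_intros)
  have "cone_convex (down_hull (closure U))"
    by (intro cone_convex_down_hull cone_convex_closure U)
  then have W2: "cone_convex W"
    unfolding cone_convex_def
  proof (intro ballI)
    fix x y t assume *: "\<forall>x\<in>down_hull (closure U). \<forall>y\<in>down_hull (closure U). \<forall>t\<in>{0<..<1}.
        t *\<^sub>R x + (1 - t) *\<^sub>R y \<in> down_hull (closure U)"
      and xy: "x \<in> W" "y \<in> W" and t: "t \<in> {0<..<(1::real)}"
    have "t *\<^sub>R (x + u) + (1 - t) *\<^sub>R (y + u) \<in> down_hull (closure U)"
      using * xy t by (simp add: W_def)
    also have "t *\<^sub>R (x + u) + (1 - t) *\<^sub>R (y + u) = t *\<^sub>R x + (1 - t) *\<^sub>R y + (u + u)"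
      using t Idem_scale[OF Idem] by (simp add: cone_scale_add_right ac_simps)
    finally show "t *\<^sub>R x + (1 - t) *\<^sub>R y \<in> W"
      by (simp add: W_def uu)
  qed
  have W3: "down_closed W"
    unfolding down_closed_def
  proof (intro ballI allI impI)
    fix x y assume "y \<in> W" "x \<le> y"
    then have "y + u \<in> down_hull (closure U)" "x + u \<le> y + u"
      by (auto simp: W_def intro: add_right_mono)
    then show "x \<in> W"
      using down_closed_down_hull[of "closure U"] unfolding down_closed_def W_def by blast
  qed
  have "u \<in> down_hull (closure U)"
    using U(3) closure_subset subset_down_hull by blast
  then have W4: "u \<in> W"
    by (simp add: W_def uu)
  have W5: "z + u \<in> W" if "z \<in> W" for z
    using that by (simp add: W_def add.assoc uu)
  have W6: "k0 z \<le> ennreal (1 / 2)" if "z \<in> W" for z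
  proof -
    obtain y where y: "y \<in> closure U" "z + u \<le> y"
      using \<open>z \<in> W\<close> by (auto simp: W_def down_hull_def)
    have "k0 z \<le> k0 y"
      using order_trans[OF le_add_left_cone y(2)] by (rule cone_linear_mono[OF linear])
    also have "k0 y \<le> ennreal (1 / 2)"
      using y(1) U(4) by (intro less_imp_le) blast
    finally show ?thesis .
  qed
  \<comment> \<open>The factor \<open>c > 1\<close> may depend on \<open>p\<close>: the gap on
    \<open>W\<close> may shrink from step to step but never closes.\<close>
  define inv where "inv p \<longleftrightarrow> cone_linear (fst p) \<and> lower_semicontinuous (fst p) \<and> cone_linear (snd p) \<and>
    upper_semicontinuous (snd p) \<and> (\<forall>x. k0 x \<le> fst p x) \<and> (\<forall>x. fst p x \<le> snd p x) \<and>
    (\<forall>x\<in>D. snd p x < top) \<and> (\<exists>c>1. \<forall>z\<in>W. snd p z \<le> ennreal (1 / c))"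
    for p :: "('a \<Rightarrow> ennreal) \<times> ('a \<Rightarrow> ennreal)"
  have step: "\<exists>p. inv p \<and> (\<forall>x. k x \<le> fst p x)"
    if k: "cone_linear k" "upper_semicontinuous k" "\<forall>x. k0 x \<le> k x" "\<forall>x\<in>D. k x < top"
      "1 < c" "\<forall>z\<in>W. k z \<le> ennreal (1 / c)" for k c
  proof -
    obtain f h b where "cone_linear f" "lower_semicontinuous f" "cone_linear h" "upper_semicontinuous h"
      "\<And>x. k x \<le> f x" "\<And>x. f x \<le> h x" "\<And>x. x \<in> D \<Longrightarrow> h x < top"
      "1 < b" "\<And>z. z \<in> W \<Longrightarrow> h z \<le> ennreal (1 / b)"
      using interpolation[OF k(1,2) _ _ W1 W2 W3 W4 W5 k(5)] k(3,4,6) by blast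
    then have "inv (f, h) \<and> (\<forall>x. k x \<le> fst (f, h) x)"
      using k(3) by (auto simp: inv_def intro: order_trans)
    then show ?thesis ..
  qed
  have "\<exists>p. \<forall>n. inv (p n) \<and> (\<forall>x. snd (p n) x \<le> fst (p (Suc n)) x)"
  proof (rule dependent_nat_choice)
    show "\<exists>p. inv p"
      using step[of k0 2] linear usc W6 by (auto simp: D_def)
    fix p and n :: nat assume p: "inv p"
    then obtain c where c: "1 < c" "\<forall>z\<in>W. snd p z \<le> ennreal (1 / c)"
      by (auto simp: inv_def)
    have "\<forall>x. k0 x \<le> snd p x"
      using p by (auto simp: inv_def intro: order_trans)
    then show "\<exists>q. inv q \<and> (\<forall>x. snd p x \<le> fst q x)"
      using step[OF _ _ _ _ c] p by (simp add: inv_def)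
  qed
  then obtain p where p: "\<And>n. inv (p n)" "\<And>n x. snd (p n) x \<le> fst (p (Suc n)) x"
    by auto
  define f h where "f n = fst (p n)" and "h n = snd (p n)" for n
  have f: "cone_linear (f n)" "lower_semicontinuous (f n)" "k0 x \<le> f n x" "f n x \<le> h n x" for n x
    using p(1)[of n] by (simp_all add: inv_def f_def h_def)
  have h: "upper_semicontinuous (h n)" "h n x \<le> f (Suc n) x" for n x
    using p[of n] by (simp_all add: inv_def f_def h_def)
  have h_W: "h n z \<le> 1" if "z \<in> W" for n z
  proof -
    obtain c where c: "1 < c" "\<forall>z\<in>W. snd (p n) z \<le> ennreal (1 / c)"
      using p(1)[of n] by (auto simp: inv_def)
    then have "h n z \<le> ennreal (1 / c)"
      using that by (simp add: h_def)
    also have "ennreal (1 / c) \<le> ennreal 1"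
      using c(1) by (intro ennreal_leI) simp
    finally show ?thesis by simp
  qed
  have inc: "incseq (\<lambda>n. f n x)" for x
    using f(4) h(2) by (intro incseq_SucI) (rule order_trans)
  define s where "s x = (SUP n. f n x)" for x
  have f_le: "f n x \<le> s x" for n x
    unfolding s_def by (rule SUP_upper) simp
  have less_s: "a < s x \<longleftrightarrow> (\<exists>n. a < f n x)" for a x
    unfolding s_def by (simp add: less_SUP_iff)
  have "cone_linear s"
    unfolding cone_linear_def
  proof (intro conjI allI impI)
    show "s 0 = 0"
      by (simp add: s_def cone_linear_zero[OF f(1)])
    show "s (x + y) = s x + s y" for x y
      using ennreal_SUP_add[OF inc[of x] inc[of y]] by (simp add: s_def cone_linear_add[OF f(1)])
    show "s (t *\<^sub>R x) = ennreal t * s x" if "0 < t" for t x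
      by (simp add: s_def cone_linear_scale[OF f(1) that] SUP_mult_left_ennreal)
  qed
  moreover have "lower_semicontinuous s"
    unfolding lower_semicontinuous_def
  proof
    fix a
    have "{x. a < s x} = (\<Union>n. {x. a < f n x})"
      by (auto simp: less_s)
    then show "open {x. a < s x}"
      using f(2) by (auto simp: lower_semicontinuous_def)
  qed
  moreover have "sigma_compact {x. a < s x}" if a: "a < \<infinity>" for a
  proof -
    obtain r where r: "a = ennreal r" "0 \<le> r"
      using a by (cases a) auto
    \<comment> \<open>These sets are closed because \<open>h n\<close> is upper semicontinuous. The
      margin \<open>1 / (n + 1)\<close> tends to \<open>0\<close>, so their union recovers the
      strict inequality \<open>a < s x\<close>.\<close>
    define K where "K n = {x. ennreal (r + 1 / real (Suc n)) \<le> h n x}" for n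
    have "compact (K n)" for n
    proof -
      have "K n = - {x. h n x < ennreal (r + 1 / real (Suc n))}"
        by (auto simp: K_def)
      then show ?thesis
        using h(1)[of n] by (intro closed_imp_compact) (simp add: upper_semicontinuous_def closed_Compl)
    qed
    moreover have "{x. a < s x} = (\<Union>n. K n)"
    proof (intro set_eqI iffI)
      fix x assume "x \<in> {x. a < s x}"
      then obtain n where n: "ennreal r < f n x"
        by (auto simp: less_s r)
      \<comment> \<open>A large \<open>m\<close> makes the margin fit, and \<open>n \<le> m\<close>
        ensures \<open>f n x \<le> h m x\<close>.\<close>
      obtain m where m: "n \<le> m" "ennreal (r + 1 / real (Suc m)) \<le> f n x"
      proof (cases "f n x")
        case (real q)
        then have "0 < q - r"
          using n r by (simp add: ennreal_less_iff)
        then obtain m where m: "1 / real (Suc m) < q - r"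
          using nat_approx_posE by blast
        have "1 / real (Suc (max n m)) \<le> 1 / real (Suc m)"
          by (intro divide_left_mono) auto
        with m have "r + 1 / real (Suc (max n m)) \<le> q" by linarith
        then show thesis
          using real by (intro that[of "max n m"]) (auto intro: ennreal_leI)
      qed (auto intro: that)
      have "f n x \<le> h m x"
        using incseqD[OF inc m(1), of x] f(4) by (rule order_trans)
      with m(2) have "x \<in> K m"
        unfolding K_def by (auto intro: order_trans)
      then show "x \<in> (\<Union>n. K n)" by blast
    next
      fix x assume "x \<in> (\<Union>n. K n)"
      then obtain n where "ennreal (r + 1 / real (Suc n)) \<le> h n x"
        by (auto simp: K_def)
      also have "h n x \<le> s x"
        using h(2) f_le by (rule order_trans)
      finally have "ennreal (r + 1 / real (Suc n)) \<le> s x" .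
      moreover have "a < ennreal (r + 1 / real (Suc n))"
        using r by (simp add: ennreal_less_iff del: ennreal_plus of_nat_Suc)
      ultimately show "x \<in> {x. a < s x}" by simp
    qed
    ultimately show ?thesis
      unfolding sigma_compact_def by blast
  qed
  ultimately have s: "s \<in> Lsc_sigma"
    by (simp add: Lsc_sigma_def)
  have pos: "0 < s y" if "\<not> y \<le> u" for y
  proof -
    have "0 < k0 y"
      using that zero_iff by (simp add: zero_less_iff_neq_zero)
    also have "k0 y \<le> s y"
      using f(3) f_le by (rule order_trans)
    finally show ?thesis .
  qed
  \<comment> \<open>This is the set of \<open>y\<close> with \<open>y + u\<close> below a point of
    \<open>U\<close>: an open down-set around \<open>u\<close> inside \<open>W\<close>.\<close>
  define G where "G = (\<Union>v. {y. y + (u + v) \<in> U})"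
  have "open G"
    unfolding G_def using U(1) by (intro open_UN ballI open_add_vimage)
  moreover have "down_closed G"
    unfolding down_closed_def
  proof (intro ballI allI impI)
    fix y x assume "y \<in> G" "x \<le> y"
    then obtain v z where "y + (u + v) \<in> U" "y = x + z"
      by (auto simp: G_def le_iff_add)
    then have "x + (u + (v + z)) \<in> U"
      by (simp add: ac_simps)
    then show "x \<in> G"
      by (auto simp: G_def)
  qed
  moreover have "u + (u + 0) \<in> U"
    using U(3) uu by simp
  then have "u \<in> G"
    unfolding G_def by blast
  moreover have "s y \<le> 1" if "y \<in> G" for y
  proof -
    obtain v where "y + (u + v) \<in> U"
      using \<open>y \<in> G\<close> by (auto simp: G_def)
    then have "y + u + v \<in> closure U"
      using closure_subset by (auto simp: add.assoc)
    moreover have "y + u \<le> y + u + v"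
      by (rule le_add_left_cone)
    ultimately have "y \<in> W"
      unfolding W_def down_hull_def by blast
    then have "f n y \<le> 1" for n
      using f(4) h_W by (blast intro: order_trans)
    then show ?thesis
      unfolding s_def by (intro SUP_least)
  qed
  ultimately show thesis
    using s pos by (intro that[of s G])
qed

end

section \<open>Closure properties of \<open>Lsc_sigma\<close> and the general separation
  statement\<close>

lemma sigma_compact_UN:
  assumes "\<And>n::nat. sigma_compact (A n)"
  shows "sigma_compact (\<Union>n. A n)"
proof -
  have "\<forall>n. \<exists>K. (\<forall>m. compact (K m)) \<and> A n = (\<Union>m::nat. K m)"
    using assms by (simp add: sigma_compact_def)
  then obtain K where K: "\<And>n m. compact (K n m)" "\<And>n. A n = (\<Union>m::nat. K n m)"
    by metis
  have "(\<Union>n. A n) = (\<Union>i. K (fst (prod_decode i)) (snd (prod_decode i)))"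
  proof (intro set_eqI iffI)
    fix x assume "x \<in> (\<Union>n. A n)"
    then obtain n m where "x \<in> K n m"
      using K(2) by auto
    then show "x \<in> (\<Union>i. K (fst (prod_decode i)) (snd (prod_decode i)))"
      by (intro UN_I[of "prod_encode (n, m)"]) auto
  qed (use K(2) in auto)
  then show ?thesis
    unfolding sigma_compact_def using K(1)
    by (intro exI[of _ "\<lambda>i. K (fst (prod_decode i)) (snd (prod_decode i))"]) auto
qed

lemma sigma_compact_empty: "sigma_compact {}"
  unfolding sigma_compact_def by (intro exI[of _ "\<lambda>n. {}"]) auto

lemma sigma_compact_Un:
  assumes "sigma_compact A" "sigma_compact B"
  shows "sigma_compact (A \<union> B)"
proof -
  have "sigma_compact (\<Union>n::nat. if n = 0 then A else B)"
    using assms by (intro sigma_compact_UN) auto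
  also have "(\<Union>n::nat. if n = 0 then A else B) = A \<union> B"
    by (auto split: if_splits)
  finally show ?thesis .
qed

lemma sigma_compact_Int:
  fixes A B :: "'a::t2_space set"
  assumes "sigma_compact A" "sigma_compact B"
  shows "sigma_compact (A \<inter> B)"
proof -
  obtain K L where KL: "\<And>n::nat. compact (K n)" "A = (\<Union>n. K n)" "\<And>n::nat. compact (L n)" "B = (\<Union>n. L n)"
    using assms by (auto simp: sigma_compact_def)
  have "sigma_compact (K n \<inter> B)" for n
    unfolding sigma_compact_def KL(4) using KL(1,3)
    by (intro exI[of _ "\<lambda>m. K n \<inter> L m"]) (auto intro: compact_Int)
  then have "sigma_compact (\<Union>n. K n \<inter> B)"
    by (rule sigma_compact_UN)
  also have "(\<Union>n. K n \<inter> B) = A \<inter> B"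
    using KL(2) by auto
  finally show ?thesis .
qed

lemma Lsc_sigma_zero: "(\<lambda>x. 0) \<in> Lsc_sigma"
  by (simp add: Lsc_sigma_def cone_linear_const_zero lsc_const_zero sigma_compact_empty)

text \<open>The union that describes \<open>{x. c < f x + g x}\<close> is made countable by
  restricting the two levels to rationals; negative rationals just give the level
  \<open>0\<close>.\<close>

lemma Lsc_sigma_plus:
  fixes f g :: "'a::extended_choquet_cone \<Rightarrow> ennreal"
  assumes f: "f \<in> Lsc_sigma" and g: "g \<in> Lsc_sigma"
  shows "(\<lambda>x. f x + g x) \<in> Lsc_sigma"
proof -
  have "sigma_compact {x. c < f x + g x}" if "c < \<infinity>" for c
  proof -
    define r where "r n = ennreal (real_of_rat (nat_to_rat_surj n))" for n
    define A where "A i j = (if c \<le> r i + r j then {x. r i < f x} \<inter> {x. r j < g x} else {})" for i j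
    have "sigma_compact (A i j)" for i j
      using f g unfolding A_def by (auto simp: Lsc_sigma_def r_def intro!: sigma_compact_Int sigma_compact_empty)
    then have "sigma_compact ({x. c < f x} \<union> {x. c < g x} \<union> (\<Union>i j. A i j))"
      using f g that by (intro sigma_compact_Un sigma_compact_UN) (auto simp: Lsc_sigma_def)
    also have "{x. c < f x} \<union> {x. c < g x} \<union> (\<Union>i j. A i j) = {x. c < f x + g x}"
    proof (intro set_eqI iffI)
      fix x assume "x \<in> {x. c < f x} \<union> {x. c < g x} \<union> (\<Union>i j. A i j)"
      then consider "c < f x" | "c < g x" | i j where "c \<le> r i + r j" "r i < f x" "r j < g x"
        by (auto simp: A_def split: if_splits)
      then show "x \<in> {x. c < f x + g x}"
      proof cases
        case 3
        then have "r i + r j < f x + g x"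
          by (intro add_strict_mono)
        with 3 show ?thesis by simp
      qed (auto intro: less_le_trans add_increasing add_increasing2)
    next
      fix x assume "x \<in> {x. c < f x + g x}"
      then have "c < f x \<or> c < g x \<or> (\<exists>s t. c < s + t \<and> s < f x \<and> t < g x)"
        using less_add_ennreal_iff[of c "f x" "g x"] by simp
      then consider "c < f x" | "c < g x" | s t where "c < s + t" "s < f x" "t < g x" by blast
      then show "x \<in> {x. c < f x} \<union> {x. c < g x} \<union> (\<Union>i j. A i j)"
      proof cases
        case 3
        obtain p q where pq: "s < ennreal (real_of_rat p)" "ennreal (real_of_rat p) < f x"
          "t < ennreal (real_of_rat q)" "ennreal (real_of_rat q) < g x"
          using ennreal_rat_dense[OF 3(2)] ennreal_rat_dense[OF 3(3)] by auto
        obtain i j where ij: "p = nat_to_rat_surj i" "q = nat_to_rat_surj j"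
          using surj_nat_to_rat_surj by (metis surj_def)
        have "c \<le> r i + r j"
          using 3(1) add_strict_mono[OF pq(1,3)] by (simp add: r_def ij)
        then have "x \<in> A i j"
          using pq by (simp add: A_def r_def ij)
        then show ?thesis by blast
      qed auto
    qed
    finally show ?thesis .
  qed
  then show ?thesis
    using f g by (simp add: Lsc_sigma_def cone_linear_plus lsc_plus)
qed

lemma Lsc_sigma_times:
  assumes f: "f \<in> Lsc_sigma" and t: "0 < t"
  shows "(\<lambda>x. ennreal t * f x) \<in> Lsc_sigma"
proof -
  have "sigma_compact {x. a < ennreal t * f x}" if "a < \<infinity>" for a
  proof -
    have "ennreal (1 / t) * a < \<infinity>"
      using that by (simp add: ennreal_mult_less_top)
    then show ?thesis
      using f less_times_ennreal_iff(1)[OF t, of a "f _"] by (simp add: Lsc_sigma_def)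
  qed
  then show ?thesis
    using f t by (simp add: Lsc_sigma_def cone_linear_times lsc_times)
qed

lemma Lsc_sigma_sum:
  fixes f :: "'i \<Rightarrow> 'a::extended_choquet_cone \<Rightarrow> ennreal"
  shows "finite I \<Longrightarrow> (\<And>i. i \<in> I \<Longrightarrow> f i \<in> Lsc_sigma) \<Longrightarrow> (\<lambda>x. \<Sum>i\<in>I. f i x) \<in> Lsc_sigma"
  by (induction rule: finite_induct) (simp_all add: Lsc_sigma_zero Lsc_sigma_plus)

text \<open>By abundance each point of \<open>K\<close> fails to lie below some compact idempotent
  \<open>v \<ge> w\<close>. The open sets \<open>{y. \<not> y \<le> v}\<close> cover
  \<open>K\<close>, and finitely many of the associated functions are added and rescaled.\<close>

lemma Lsc_sigma_separation:
  fixes w :: "'a::extended_choquet_cone"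
  assumes abundance: "abundance_of_compact_idempotents TYPE('a)"
    and w: "w \<in> Idem" and K: "compact K" "\<And>x. x \<in> K \<Longrightarrow> \<not> x \<le> w"
  obtains s G where "s \<in> Lsc_sigma" "\<And>x. x \<in> K \<Longrightarrow> 0 < s x" "open G" "down_closed G" "w \<in> G"
    "\<And>y. y \<in> G \<Longrightarrow> s y \<le> 1"
proof -
  obtain C where C: "\<forall>v\<in>C. compact_idempotent v" "isGlb UNIV C w"
    using abundance w unfolding abundance_of_compact_idempotents_def by blast
  define Q where "Q x v s G \<longleftrightarrow> \<not> x \<le> v \<and> s \<in> Lsc_sigma \<and> (\<forall>y. \<not> y \<le> v \<longrightarrow> 0 < s y) \<and> open G \<and>
    down_closed G \<and> w \<in> G \<and> (\<forall>y\<in>G. s y \<le> 1)" for x v :: 'a and s and G :: "'a set"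
  have "\<exists>v s G. Q x v s G" if x: "x \<in> K" for x
  proof -
    have "\<exists>v\<in>C. \<not> x \<le> v"
    proof (rule ccontr)
      assume "\<not> ?thesis"
      then have "x \<le> w"
        using C(2) by (auto simp: isGlb_def greatestP_def isLb_def setge_def setle_def)
      with K(2)[OF x] show False by blast
    qed
    then obtain v where v: "v \<in> C" "\<not> x \<le> v" by blast
    then have "compact_idempotent v"
      using C(1) by blast
    then obtain k where "usc_unit k v"
      by (rule compact_idempotent_imp_usc_unit)
    then interpret usc_unit k v .
    obtain s G where sG: "s \<in> Lsc_sigma" "\<And>y. \<not> y \<le> v \<Longrightarrow> 0 < s y" "open G" "down_closed G" "v \<in> G"
      "\<And>y. y \<in> G \<Longrightarrow> s y \<le> 1"
      by (rule Lsc_sigma_positive_off_idempotent) (rule that)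
    have "w \<le> v"
      using C(2) v(1) by (auto simp: isGlb_def greatestP_def isLb_def setge_def)
    then have "w \<in> G"
      using sG(4,5) by (auto simp: down_closed_def)
    then have "Q x v s G"
      using sG v by (simp add: Q_def)
    then show ?thesis by blast
  qed
  then obtain v s G where Q: "\<And>x. x \<in> K \<Longrightarrow> Q x (v x) (s x) (G x)"
    by metis
  note Q = Q[unfolded Q_def]
  have "open {y. \<not> y \<le> v x} \<and> x \<in> {y. \<not> y \<le> v x}" if "x \<in> K" for x
    using closed_le_right[of "v x"] Q[OF that] by (auto simp: closed_def Collect_neg_eq)
  from compact_finite_subcover[OF K(1) this]
  obtain T where T: "finite T" "T \<subseteq> K" "K \<subseteq> (\<Union>x\<in>T. {y. \<not> y \<le> v x})"
    by auto
  \<comment> \<open>The \<open>+ 1\<close> keeps \<open>t\<close> positive when \<open>T\<close> is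
    empty.\<close>
  define t where "t = 1 / (real (card T) + 1)"
  have t: "0 < t" "t * real (card T) \<le> 1"
    by (simp_all add: t_def field_simps)
  show thesis
  proof (rule that[of "\<lambda>y. ennreal t * (\<Sum>x\<in>T. s x y)" "\<Inter>x\<in>T. G x"])
    show "(\<lambda>y. ennreal t * (\<Sum>x\<in>T. s x y)) \<in> Lsc_sigma"
      using Q T by (intro Lsc_sigma_times Lsc_sigma_sum t) auto
    show "0 < ennreal t * (\<Sum>x\<in>T. s x y)" if y: "y \<in> K" for y
    proof -
      obtain x where x: "x \<in> T" "\<not> y \<le> v x"
        using T(3) y by auto
      then have "0 < s x y"
        using Q T(2) by blast
      also have "s x y \<le> (\<Sum>x\<in>T. s x y)"
        using T(1) x(1) by (intro member_le_sum) auto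
      finally show ?thesis
        using t(1) by (simp add: ennreal_zero_less_mult_iff)
    qed
    show "open (\<Inter>x\<in>T. G x)"
      using Q T by (intro open_INT) auto
    show "down_closed (\<Inter>x\<in>T. G x)"
      using Q T(2) by (fastforce simp: down_closed_def)
    show "w \<in> (\<Inter>x\<in>T. G x)"
      using Q T(2) by blast
    show "ennreal t * (\<Sum>x\<in>T. s x y) \<le> 1" if y: "y \<in> (\<Inter>x\<in>T. G x)" for y
    proof -
      have "(\<Sum>x\<in>T. s x y) \<le> (\<Sum>x\<in>T. 1)"
        using Q T(2) y by (intro sum_mono) auto
      then have "ennreal t * (\<Sum>x\<in>T. s x y) \<le> ennreal t * ennreal (real (card T))"
        by (intro mult_left_mono) (auto simp: ennreal_of_nat_eq_real_of_nat)
      also have "\<dots> = ennreal (t * real (card T))"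
        using t(1) by (simp add: ennreal_mult)
      also have "\<dots> \<le> ennreal 1"
        using t(2) by (rule ennreal_leI)
      finally show ?thesis by simp
    qed
  qed
qed

section \<open>Weak cancellation\<close>

text \<open>The factors tend to \<open>1\<close>. They are all at least \<open>1/2\<close>, so an
  infinite \<open>p\<close> forces \<open>q\<close> to be infinite.\<close>

lemma le_if_scaled_le:
  fixes p q :: ennreal
  assumes le: "\<And>n. m \<le> n \<Longrightarrow> ennreal (1 - 1 / (real n + 2)) * p \<le> q"
  shows "p \<le> q"
proof (cases q)
  case (real b)
  have "p \<noteq> top"
    using le[of m] real by (auto simp: ennreal_mult_top top_unique)
  then obtain a where a: "p = ennreal a" "0 \<le> a"
    by (cases p) auto
  have "a \<le> b"
  proof (rule ccontr)
    assume "\<not> a \<le> b"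
    then have "0 < a" "0 < (a - b) / a"
      using real by auto
    then obtain k where k: "1 / real (Suc k) < (a - b) / a"
      using nat_approx_posE by blast
    let ?n = "max m k"
    have "1 / (real ?n + 2) \<le> 1 / real (Suc k)"
      by (intro divide_left_mono) auto
    also note k
    finally have "1 / (real ?n + 2) * a < a - b"
      using \<open>0 < a\<close> by (simp only: less_divide_eq if_True)
    then have less: "b < (1 - 1 / (real ?n + 2)) * a"
      by (simp only: left_diff_distrib)
    have "ennreal ((1 - 1 / (real ?n + 2)) * a) \<le> ennreal b"
      using le[of ?n] a real by (simp add: ennreal_mult)
    then have "(1 - 1 / (real ?n + 2)) * a \<le> b"
      using real(1) by (rule ennreal_le_iff[THEN iffD1, rotated])
    with less show False by simp
  qed
  then show ?thesis
    using a real by (simp add: ennreal_leI)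
qed simp

lemma SUP_of_nat_times_eq_top:
  fixes c :: ennreal
  assumes "0 < c"
  shows "(SUP n. of_nat n * c) = top"
  using assms by (simp add: ennreal_SUP_of_nat_eq_top ennreal_top_mult flip: SUP_mult_right_ennreal)

lemma cone_scale_le_self:
  fixes x :: "'a::extended_choquet_cone"
  assumes "0 < n"
  shows "(1 / real n) *\<^sub>R x \<le> x"
  using cone_scale_mono_left[of "1 / real n" 1 x] assms by (simp add: cone_scale_one)

lemma weak_cancellation_if_strongly_connected:
  assumes abundance: "abundance_of_compact_idempotents TYPE('a::extended_choquet_cone)"
    and conn: "strongly_connected TYPE('a)"
  shows "weak_cancellation (Lsc_sigma :: ('a \<Rightarrow> ennreal) set)"
  unfolding weak_cancellation_def
proof (intro ballI impI)
  fix f g h :: "'a \<Rightarrow> ennreal"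
  assume h: "h \<in> Lsc_sigma" and wb: "way_below Lsc_sigma (\<lambda>x. f x + h x) (\<lambda>x. g x + h x)"
  have h_lin: "cone_linear h" and h_lsc: "lower_semicontinuous h"
    using h by (simp_all add: Lsc_sigma_def)
  have wbD: "\<exists>n. (\<lambda>x. f x + h x) \<le> k n"
    if "\<And>n. k n \<in> Lsc_sigma" "incseq k" "(\<lambda>x. g x + h x) \<le> (SUP n. k n)" for k
  proof -
    have "range k \<subseteq> Lsc_sigma"
      using that(1) by auto
    then show ?thesis
      using wb[unfolded way_below_def, THEN spec, of k] that(2,3) by simp
  qed
  show "way_below Lsc_sigma f g"
    unfolding way_below_def
  proof (intro allI impI)
    fix gs :: "nat \<Rightarrow> 'a \<Rightarrow> ennreal"
    assume gs: "range gs \<subseteq> Lsc_sigma \<and> incseq gs \<and> g \<le> (SUP n. gs n)"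
    then have gs_S: "gs n \<in> Lsc_sigma" for n
      by auto
    then have gs_lin: "cone_linear (gs n)" for n
      by (simp add: Lsc_sigma_def)
    have gs_mono: "gs m x \<le> gs n x" if "m \<le> n" for m n x
      using gs that by (auto simp: incseq_def le_fun_def)
    have g_le: "g x \<le> (SUP n. gs n x)" for x
      using gs le_funD[of g "SUP n. gs n" x] by (simp only: SUP_apply)

    \<comment> \<open>The zeros of \<open>h\<close> form a closed set that is stable under sums, so
      there is a largest one, \<open>w\<close>, and it is idempotent.\<close>
    have "closed (- {x. 0 < h x})"
      using h_lsc by (intro closed_Compl) (simp add: lower_semicontinuous_def)
    then have "closed {x. h x = 0}"
      by (simp add: zero_less_iff_neq_zero Collect_neg_eq[symmetric])
    moreover have "{x. h x = 0} \<noteq> {}"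
      using cone_linear_zero[OF h_lin] by blast
    ultimately obtain w where w: "w \<in> {x. h x = 0}" "\<And>x. x \<in> {x. h x = 0} \<Longrightarrow> x \<le> w"
      using greatest_exists[of "{x. h x = 0}"] by (auto simp: cone_linear_add[OF h_lin])
    have "2 *\<^sub>R w \<le> w"
      using w(1) by (intro w(2)) (simp add: cone_linear_scale[OF h_lin])
    moreover have "1 *\<^sub>R w \<le> 2 *\<^sub>R w"
      by (rule cone_scale_mono_left) auto
    ultimately have w_Idem: "w \<in> Idem"
      by (simp add: Idem_def cone_scale_one)
    have pos_iff: "\<not> x \<le> w" if "0 < h x" for x
      using that cone_linear_mono[OF h_lin, of x w] w(1) by auto

    have "sigma_compact {x. 0 < h x}"
      using h by (simp add: Lsc_sigma_def)
    then obtain K where K: "\<And>n::nat. compact (K n)" "{x. 0 < h x} = (\<Union>n. K n)"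
      by (auto simp: sigma_compact_def)
    \<comment> \<open>\<open>s n\<close> is positive on the compact piece \<open>K n\<close> of
      \<open>{0 < h}\<close> but at most \<open>1\<close> near \<open>w\<close>.\<close>
    define Q where "Q n s G \<longleftrightarrow> s \<in> Lsc_sigma \<and> (\<forall>x\<in>K n. 0 < s x) \<and> open G \<and> down_closed G \<and> w \<in> G \<and>
      (\<forall>y\<in>G. s y \<le> 1)" for n and s :: "'a \<Rightarrow> ennreal" and G
    have "\<exists>s G. Q n s G" for n
    proof -
      have "\<not> x \<le> w" if "x \<in> K n" for x
        using K(2) that by (intro pos_iff) blast
      then obtain s G where "s \<in> Lsc_sigma" "\<And>x. x \<in> K n \<Longrightarrow> 0 < s x" "open G" "down_closed G" "w \<in> G"
        "\<And>y. y \<in> G \<Longrightarrow> s y \<le> 1"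
        by (rule Lsc_sigma_separation[OF abundance w_Idem K(1)[of n]]) (assumption | rule that)+
      then have "Q n s G"
        by (simp add: Q_def)
      then show ?thesis by blast
    qed
    then obtain s G where Q: "\<And>n. Q n (s n) (G n)"
      by metis
    have s: "s n \<in> Lsc_sigma" "x \<in> K n \<Longrightarrow> 0 < s n x" and G: "open (G n)" "down_closed (G n)" "w \<in> G n"
      and s_G: "y \<in> G n \<Longrightarrow> s n y \<le> 1" for n x y
      using Q[of n] by (simp_all add: Q_def)

    \<comment> \<open>Each \<open>H n\<close> is bounded near \<open>w\<close>, being a finite sum,
      while the growing factor drives the supremum to infinity wherever \<open>h\<close> is
      positive.\<close>
    define H where "H n x = ennreal (real (Suc n)) * (\<Sum>i\<le>n. s i x)" for n x
    have H_S: "H n \<in> Lsc_sigma" for n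
      unfolding H_def using s(1) by (intro Lsc_sigma_times Lsc_sigma_sum) auto
    then have H_lin: "cone_linear (H n)" for n
      by (simp add: Lsc_sigma_def)
    have H_mono: "H m x \<le> H n x" if "m \<le> n" for m n x
      unfolding H_def using that by (intro mult_mono ennreal_leI sum_mono2) auto
    have h_le: "h x \<le> (SUP n. H n x)" for x
    proof (cases "h x = 0")
      case False
      then obtain i where "x \<in> K i"
        using K(2) by (auto simp: zero_less_iff_neq_zero)
      then have "0 < s i x"
        by (rule s(2))
      have "of_nat m * s i x \<le> (SUP n. H n x)" for m
      proof -
        have "s i x \<le> (\<Sum>j\<le>max m i. s j x)"
          by (rule member_le_sum) auto
        moreover have "(of_nat m :: ennreal) \<le> ennreal (real (Suc (max m i)))"
          unfolding ennreal_of_nat_eq_real_of_nat by (intro ennreal_leI) auto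
        ultimately have "of_nat m * s i x \<le> H (max m i) x"
          unfolding H_def by (intro mult_mono) auto
        then show ?thesis
          by (rule order_trans) (rule SUP_upper, simp)
      qed
      then have "(SUP n. of_nat n * s i x) \<le> (SUP n. H n x)"
        by (rule SUP_least)
      then have "top \<le> (SUP n. H n x)"
        unfolding SUP_of_nat_times_eq_top[OF \<open>0 < s i x\<close>] .
      then show ?thesis
        by (rule order_trans[OF top_greatest])
    qed simp

    \<comment> \<open>First test sequence for the way-below relation. The factors increase to
      \<open>1\<close>, yet each single member yields an inequality with a factor below
      \<open>1\<close>.\<close>
    define A where "A n x = ennreal (1 - 1 / (real n + 2)) * (gs n x + h x)" for n x
    have "A n \<in> Lsc_sigma" for n
      unfolding A_def using gs_S h by (intro Lsc_sigma_times Lsc_sigma_plus) auto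
    moreover have "incseq A"
    proof (rule incseq_SucI, rule le_funI)
      fix n x
      have "1 / (real (Suc n) + 2) \<le> 1 / (real n + 2)"
        by (intro divide_left_mono) auto
      then show "A n x \<le> A (Suc n) x"
        unfolding A_def using gs_mono[of n "Suc n" x] by (intro mult_mono ennreal_leI add_mono) auto
    qed
    moreover have "(\<lambda>x. g x + h x) \<le> (SUP n. A n)"
    proof (rule le_funI)
      fix x
      have "gs m x + h x \<le> (SUP n. A n x)" for m
      proof (rule le_if_scaled_le)
        fix n assume "m \<le> n"
        then have "ennreal (1 - 1 / (real n + 2)) * (gs m x + h x) \<le> A n x"
          unfolding A_def using gs_mono by (intro mult_left_mono add_mono) auto
        then show "ennreal (1 - 1 / (real n + 2)) * (gs m x + h x) \<le> (SUP n. A n x)"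
          by (rule order_trans) (rule SUP_upper, simp)
      qed
      then have *: "(SUP m. gs m x + h x) \<le> (SUP n. A n x)"
        by (rule SUP_least)
      have "g x + h x \<le> (SUP m. gs m x) + h x"
        by (intro add_right_mono g_le)
      also have "\<dots> = (SUP m. gs m x + h x)"
        by (rule ennreal_SUP_add_left[symmetric]) simp
      also note *
      finally show "g x + h x \<le> (SUP n. A n) x"
        by (simp only: SUP_apply)
    qed
    ultimately have "\<exists>n. (\<lambda>x. f x + h x) \<le> A n"
      by (rule wbD)
    then obtain n1 where n1: "\<And>x. f x + h x \<le> A n1 x"
      by (auto simp: le_fun_def)

    \<comment> \<open>Second test sequence, with \<open>h\<close> replaced by functions that are
      bounded near \<open>w\<close>.\<close>
    have "(\<lambda>x. gs n x + H n x) \<in> Lsc_sigma" for n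
      using gs_S H_S by (intro Lsc_sigma_plus)
    moreover have "incseq (\<lambda>n x. gs n x + H n x)"
      by (intro incseq_SucI le_funI add_mono gs_mono H_mono) auto
    moreover have "(\<lambda>x. g x + h x) \<le> (SUP n. (\<lambda>x. gs n x + H n x))"
    proof (rule le_funI)
      fix x
      have "incseq (\<lambda>n. gs n x)" "incseq (\<lambda>n. H n x)"
        by (auto intro!: incseq_SucI gs_mono H_mono)
      then have *: "(SUP n. gs n x + H n x) = (SUP n. gs n x) + (SUP n. H n x)"
        by (rule ennreal_SUP_add)
      have "g x + h x \<le> (SUP n. gs n x) + (SUP n. H n x)"
        by (intro add_mono g_le h_le)
      also note *[symmetric]
      finally show "g x + h x \<le> (SUP n. (\<lambda>x. gs n x + H n x)) x"
        by (simp only: SUP_apply)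
    qed
    ultimately have "\<exists>n. (\<lambda>x. f x + h x) \<le> (\<lambda>x. gs n x + H n x)"
      by (rule wbD)
    then obtain n2 where n2: "\<And>x. f x + h x \<le> gs n2 x + H n2 x"
      by (auto simp: le_fun_def)

    define N where "N = max n1 n2"
    define d where "d = 1 / (real n1 + 2)"
    have d: "0 < d" "d < 1"
      by (auto simp: d_def)
    have bound1: "f x + h x \<le> ennreal (1 - d) * (gs N x + h x)" for x
    proof -
      have "A n1 x \<le> ennreal (1 - d) * (gs N x + h x)"
        unfolding A_def d_def using gs_mono[of n1 N x] by (intro mult_left_mono add_mono) (auto simp: N_def)
      with n1[of x] show ?thesis by (rule order_trans)
    qed
    have bound2: "h x \<le> gs N x + H n2 x" for x
    proof -
      have "h x \<le> f x + h x" by (simp add: add_increasing)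
      also note n2[of x]
      also have "gs n2 x + H n2 x \<le> gs N x + H n2 x"
        using gs_mono[of n2 N x] by (intro add_mono) (auto simp: N_def)
      finally show ?thesis .
    qed
    have "f x \<le> gs N x" for x
    proof (cases "gs N x = top")
      case False
      then obtain a where a: "gs N x = ennreal a" "0 \<le> a"
        by (cases "gs N x") auto
      have gs_finite: "gs N y \<le> ennreal a" if "y \<le> x" for y
        using cone_linear_mono[OF gs_lin that, of N] a by simp
      \<comment> \<open>Below \<open>x\<close>, a finite value \<open>b\<close> of \<open>h\<close>
        satisfies \<open>b \<le> (1 - d) * (a + b)\<close>. So \<open>h\<close> is either infinite
        or at most \<open>a / d\<close> there.\<close>
      have h_bounded: "h y \<le> ennreal (a / d)" if "y \<le> x" "h y < top" for y
      proof -
        obtain b where b: "h y = ennreal b" "0 \<le> b"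
          using \<open>h y < top\<close> by (cases "h y") auto
        have "ennreal b \<le> f y + h y"
          by (simp add: b add_increasing)
        also note bound1[of y]
        also have "ennreal (1 - d) * (gs N y + h y) \<le> ennreal (1 - d) * (ennreal a + ennreal b)"
          using gs_finite[OF \<open>y \<le> x\<close>] b by (intro mult_left_mono add_mono) auto
        also have "\<dots> = ennreal ((1 - d) * (a + b))"
          using a b d by (simp add: ennreal_mult ennreal_plus)
        finally have "b \<le> (1 - d) * (a + b)"
          using a b d by (subst (asm) ennreal_le_iff) auto
        then have "d * b \<le> (1 - d) * a"
          by (simp add: algebra_simps)
        also have "\<dots> \<le> 1 * a"
          using a d by (intro mult_right_mono) auto
        finally have "b \<le> a / d"
          using d by (simp add: field_simps)
        then show ?thesis
          using b by (simp add: ennreal_leI)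
      qed

      \<comment> \<open>Among the points below \<open>x\<close>, \<open>O1\<close> consists of those
        where \<open>h\<close> is infinite and \<open>O2\<close> of those where it is finite; both
        are open.\<close>
      define O1 where "O1 = {y. ennreal (a / d) < h y}"
      define O2 where "O2 = \<Union>{U. open U \<and> (\<forall>y\<in>U. y \<le> x \<longrightarrow> h y < top)}"
      have "open O1"
        using h_lsc by (simp add: O1_def lower_semicontinuous_def)
      have "open O2"
        unfolding O2_def by (rule open_Union) auto
      \<comment> \<open>The idempotent part of \<open>y\<close> is a zero of \<open>h\<close>, hence
        below \<open>w\<close>, so a small multiple of \<open>y\<close> has a neighbourhood on which
        \<open>H n2\<close> is bounded. Scaling back, \<open>bound2\<close> makes \<open>h\<close>
        finite near \<open>y\<close>, below \<open>x\<close>.\<close>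
      have in_O2: "y \<in> O2" if y: "y \<le> x" "h y < top" for y
      proof -
        obtain e where e: "e \<in> Idem" "\<And>t. 0 < t \<Longrightarrow> e \<le> t *\<^sub>R y"
          "\<And>U. open U \<Longrightarrow> e \<in> U \<Longrightarrow> \<exists>n>0. (1 / real n) *\<^sub>R y \<in> U"
          by (rule idempotent_part[of y]) (rule that)
        have "h e \<le> h (1 *\<^sub>R y)"
          using e(2)[of 1] by (intro cone_linear_mono[OF h_lin]) auto
        also have "\<dots> < top"
          using y(2) by (simp add: cone_scale_one)
        finally have "h e = 0"
          by (rule cone_linear_Idem[OF h_lin e(1)])
        then have "e \<le> w"
          by (intro w(2)) simp
        have "e \<in> G i" for i
          using G(2,3)[of i] \<open>e \<le> w\<close> by (auto simp: down_closed_def)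
        moreover have open_G: "open (\<Inter>i\<le>n2. G i)"
          using G(1) by (intro open_INT) auto
        ultimately obtain n where n: "0 < n" "(1 / real n) *\<^sub>R y \<in> (\<Inter>i\<le>n2. G i)"
          using e(3)[of "\<Inter>i\<le>n2. G i"] by auto
        let ?U = "{z. (1 / real n) *\<^sub>R z \<in> (\<Inter>i\<le>n2. G i)}"
        have "h z < top" if z: "z \<in> ?U" "z \<le> x" for z
        proof -
          have "(\<Sum>i\<le>n2. s i ((1 / real n) *\<^sub>R z)) \<le> (\<Sum>i\<le>n2. 1)"
            using z(1) by (intro sum_mono s_G) auto
          also have "\<dots> < top"
            by (simp add: of_nat_less_top)
          finally have "H n2 ((1 / real n) *\<^sub>R z) < top"
            unfolding H_def by (simp add: ennreal_mult_less_top del: of_nat_Suc)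
          then have "H n2 z < top"
            using n(1) by (cases "H n2 z") (auto simp: cone_linear_scale[OF H_lin] ennreal_mult_top)
          then have "gs N z + H n2 z < top"
            using gs_finite[OF z(2)] by (auto intro: order_le_less_trans)
          with bound2[of z] show ?thesis by (rule order_le_less_trans)
        qed
        moreover have "open ?U"
          using n(1) open_G by (intro open_scale_vimage) auto
        ultimately show ?thesis
          unfolding O2_def using n(2) by (intro UnionI[of ?U]) auto
      qed
      have O2_D: "h y < top" if "y \<in> O2" "y \<le> x" for y
        using that by (auto simp: O2_def)

      obtain e where e: "e \<in> Idem" "\<And>t. 0 < t \<Longrightarrow> e \<le> t *\<^sub>R x"
        "\<And>U. open U \<Longrightarrow> e \<in> U \<Longrightarrow> \<exists>n>0. (1 / real n) *\<^sub>R x \<in> U"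
        by (rule idempotent_part[of x]) (rule that)
      have "e \<le> x"
        using e(2)[of 1] by (simp add: cone_scale_one)
      \<comment> \<open>The set below \<open>e\<close> contains \<open>0\<close>, which lies in
        \<open>O2\<close>, so by connectedness it avoids \<open>O1\<close> and \<open>h e\<close> is
        finite. As \<open>O2\<close> is open, finiteness passes from \<open>e\<close> to a small
        multiple of \<open>x\<close>, and so to \<open>x\<close>.\<close>
      have "connected {y. y \<le> e}"
        using conn e(1) by (simp add: strongly_connected_def)
      moreover have "O1 \<inter> O2 \<inter> {y. y \<le> e} = {}"
      proof (rule equals0I)
        fix y assume y: "y \<in> O1 \<inter> O2 \<inter> {y. y \<le> e}"
        then have "y \<le> x"
          using \<open>e \<le> x\<close> by auto
        then have "h y \<le> ennreal (a / d)"
          using y by (intro h_bounded O2_D) auto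
        then show False
          using y by (simp add: O1_def leD)
      qed
      moreover have "{y. y \<le> e} \<subseteq> O1 \<union> O2"
      proof
        fix y assume "y \<in> {y. y \<le> e}"
        then have "y \<le> x"
          using \<open>e \<le> x\<close> by auto
        show "y \<in> O1 \<union> O2"
        proof (cases "y \<in> O1")
          case False
          then have "h y < top"
            by (auto simp: O1_def not_less intro: order_le_less_trans)
          then show ?thesis
            using in_O2[OF \<open>y \<le> x\<close>] by blast
        qed simp
      qed
      ultimately have "O1 \<inter> {y. y \<le> e} = {} \<or> O2 \<inter> {y. y \<le> e} = {}"
        using \<open>open O1\<close> \<open>open O2\<close> by (intro connectedD)
      moreover have "0 \<in> O2 \<inter> {y. y \<le> e}"
        using in_O2[of 0] cone_linear_zero[OF h_lin] by simp
      ultimately have "e \<notin> O1" by blast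
      then have "h e < top"
        by (auto simp: O1_def not_less intro: order_le_less_trans)
      then have "e \<in> O2"
        using \<open>e \<le> x\<close> by (intro in_O2)
      then obtain n where n: "0 < n" "(1 / real n) *\<^sub>R x \<in> O2"
        using e(3) \<open>open O2\<close> by blast
      have "h ((1 / real n) *\<^sub>R x) < top"
        by (rule O2_D[OF n(2) cone_scale_le_self[OF n(1)]])
      then have "h x < top"
        using n(1) by (cases "h x") (auto simp: cone_linear_scale[OF h_lin] ennreal_mult_top)
      have "h x + f x \<le> ennreal (1 - d) * (gs N x + h x)"
        using bound1[of x] by (simp add: add.commute)
      also have "\<dots> \<le> 1 * (gs N x + h x)"
        using d by (intro mult_right_mono) (auto simp: ennreal_le_1)
      finally have "h x + f x \<le> h x + gs N x"
        by (simp add: add.commute)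
      then show ?thesis
        using \<open>h x < top\<close> by (auto simp: ennreal_add_left_cancel_le)
    qed simp
    then show "\<exists>n. f \<le> gs n"
      by (auto simp: le_fun_def)
  qed
qed

section \<open>From weak cancellation to strong connectedness\<close>

text \<open>Zorn's lemma; compactness provides a lower bound in \<open>S\<close> for each
  chain.\<close>

lemma closed_has_minimal:
  fixes S :: "'a::extended_choquet_cone set"
  assumes S: "closed S" "S \<noteq> {}"
  shows "\<exists>m\<in>S. \<forall>x\<in>S. x \<le> m \<longrightarrow> x = m"
proof (rule predicate_Zorn)
  show "partial_order_on S (relation_of (\<ge>) S)"
    by (rule partial_order_on_relation_ofI) auto
  fix C assume "C \<in> Chains (relation_of (\<ge>) S)"
  then have C: "C \<subseteq> S" and chain: "\<And>x y. x \<in> C \<Longrightarrow> y \<in> C \<Longrightarrow> x \<le> y \<or> y \<le> x"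
    by (auto simp: Chains_def relation_of_def)
  have "S \<inter> (\<Inter>x\<in>C. {y. y \<le> x}) \<noteq> {}"
  proof (rule compact_imp_fip_image)
    fix I assume "finite I" "I \<subseteq> C"
    then have "I = {} \<or> (\<exists>m\<in>I. \<forall>x\<in>I. m \<le> x)"
    proof induction
      case (insert a I)
      then consider "I = {}" | m where "m \<in> I" "\<forall>x\<in>I. m \<le> x" by auto
      then show ?case
      proof cases
        case 2
        then have "a \<le> m \<or> m \<le> a"
          using insert.prems by (intro chain) auto
        then show ?thesis
          using 2 by (auto intro: order_trans)
      qed simp
    qed simp
    then show "S \<inter> (\<Inter>x\<in>I. {y. y \<le> x}) \<noteq> {}"
      using S(2) C \<open>I \<subseteq> C\<close> by auto
  qed (use S closed_imp_compact closed_le_right in auto)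
  then show "\<exists>m\<in>S. \<forall>x\<in>C. m \<le> x" by auto
qed

lemma closed_has_maximal:
  fixes S :: "'a::extended_choquet_cone set"
  assumes S: "closed S" "S \<noteq> {}"
  shows "\<exists>m\<in>S. \<forall>x\<in>S. m \<le> x \<longrightarrow> x = m"
proof (rule predicate_Zorn)
  show "partial_order_on S (relation_of (\<le>) S)"
    by (rule partial_order_on_relation_ofI) auto
  fix C assume "C \<in> Chains (relation_of (\<le>) S)"
  then have C: "C \<subseteq> S" and chain: "\<And>x y. x \<in> C \<Longrightarrow> y \<in> C \<Longrightarrow> x \<le> y \<or> y \<le> x"
    by (auto simp: Chains_def relation_of_def)
  have "S \<inter> (\<Inter>x\<in>C. {y. x \<le> y}) \<noteq> {}"
  proof (rule compact_imp_fip_image)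
    fix I assume "finite I" "I \<subseteq> C"
    then have "I = {} \<or> (\<exists>m\<in>I. \<forall>x\<in>I. x \<le> m)"
    proof induction
      case (insert a I)
      then consider "I = {}" | m where "m \<in> I" "\<forall>x\<in>I. x \<le> m" by auto
      then show ?case
      proof cases
        case 2
        then have "a \<le> m \<or> m \<le> a"
          using insert.prems by (intro chain) auto
        then show ?thesis
          using 2 by (auto intro: order_trans)
      qed simp
    qed simp
    then show "S \<inter> (\<Inter>x\<in>I. {y. x \<le> y}) \<noteq> {}"
      using S(2) C \<open>I \<subseteq> C\<close> by auto
  qed (use S closed_imp_compact closed_le_left in auto)
  then show "\<exists>m\<in>S. \<forall>x\<in>C. x \<le> m" by auto
qed

lemma connected_ray:
  fixes y :: "'a::extended_choquet_cone"
  shows "connected ((\<lambda>t. t *\<^sub>R y) ` {0<..1::real})"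
proof (rule connected_continuous_image)
  have "continuous_on {0<..1::real} (\<lambda>t. (\<lambda>(t, x). t *\<^sub>R x) (t, y))"
    by (rule continuous_on_compose2[OF continuous_on_cone_scale]) (auto intro!: continuous_intros)
  then show "continuous_on {0<..1::real} (\<lambda>t. t *\<^sub>R y)"
    by simp
qed simp

text \<open>Split a disconnected set \<open>{x. x \<le> w}\<close> into closed parts
  \<open>A\<close>, containing \<open>0\<close>, and \<open>B\<close>. Take a minimal idempotent
  \<open>e0\<close> of \<open>B\<close>, a maximal \<open>m\<close> among the other points below
  \<open>e0\<close>, and a minimal idempotent \<open>e\<close> with \<open>m + e = e0\<close>. Then
  \<open>m\<close> serves as \<open>v\<close>.\<close>

lemma not_strongly_connected_idempotents:
  assumes "\<not> strongly_connected TYPE('a::extended_choquet_cone)"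
  obtains e v :: "'a::extended_choquet_cone" where "e \<in> Idem" "v \<in> Idem" "\<not> e \<le> v" "\<And>z. z \<le> e \<Longrightarrow> z \<le> v \<or> z = e"
proof -
  obtain w :: 'a where w: "w \<in> Idem" "\<not> connected {x. x \<le> w}"
    using assms by (auto simp: strongly_connected_def)
  obtain A0 B0 where AB0: "closed A0" "closed B0" "{x. x \<le> w} \<subseteq> A0 \<union> B0" "A0 \<inter> B0 \<inter> {x. x \<le> w} = {}"
    "A0 \<inter> {x. x \<le> w} \<noteq> {}" "B0 \<inter> {x. x \<le> w} \<noteq> {}"
    using w(2) unfolding connected_closed by blast
  have "\<exists>A B. closed A \<and> closed B \<and> {x. x \<le> w} = A \<union> B \<and> A \<inter> B = {} \<and> 0 \<in> A \<and> B \<noteq> {}"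
  proof (cases "0 \<in> A0")
    case True
    with AB0 closed_le_right[of w] show ?thesis
      by (intro exI[of _ "A0 \<inter> {x. x \<le> w}"] exI[of _ "B0 \<inter> {x. x \<le> w}"]) auto
  next
    case False
    moreover have "0 \<in> {x. x \<le> w}" by simp
    ultimately have "0 \<in> B0"
      using AB0(3) by blast
    with AB0 closed_le_right[of w] show ?thesis
      by (intro exI[of _ "B0 \<inter> {x. x \<le> w}"] exI[of _ "A0 \<inter> {x. x \<le> w}"]) auto
  qed
  then obtain A B where AB: "closed A" "closed B" "{x. x \<le> w} = A \<union> B" "A \<inter> B = {}" "0 \<in> A" "B \<noteq> {}"
    by (elim exE conjE)
  \<comment> \<open>The ray from \<open>y\<close> towards \<open>0\<close> is connected, so it stays
    in \<open>B\<close>, and closedness of \<open>B\<close> catches the idempotent part.\<close>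
  have part: "\<exists>e\<in>B \<inter> Idem. e \<le> y" if y: "y \<in> B" for y
  proof -
    obtain e where e: "e \<in> Idem" "\<And>t. 0 < t \<Longrightarrow> e \<le> t *\<^sub>R y"
      "\<And>U. open U \<Longrightarrow> e \<in> U \<Longrightarrow> \<exists>n>0. (1 / real n) *\<^sub>R y \<in> U"
      by (rule idempotent_part[of y]) (rule that)
    let ?T = "(\<lambda>t. t *\<^sub>R y) ` {0<..1::real}"
    have "y \<le> w"
      using y AB(3) by auto
    have "t *\<^sub>R y \<le> w" if "t \<in> {0<..1}" for t
    proof -
      have "t *\<^sub>R y \<le> 1 *\<^sub>R y"
        using that by (intro cone_scale_mono_left) auto
      then show ?thesis
        using \<open>y \<le> w\<close> by (simp add: cone_scale_one)
    qed
    then have T: "?T \<subseteq> A \<union> B"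
      unfolding AB(3)[symmetric] by auto
    have "1 *\<^sub>R y \<in> ?T"
      by (intro imageI) simp
    then have "y \<in> ?T"
      by (simp add: cone_scale_one)
    with connected_ray[of y] T have "A \<inter> ?T = {}"
      using AB y unfolding connected_closed by blast
    then have TB: "?T \<subseteq> B"
      using T by blast
    have "e \<in> B"
    proof (rule ccontr)
      assume "e \<notin> B"
      then obtain n where n: "0 < n" "(1 / real n) *\<^sub>R y \<notin> B"
        using e(3)[of "- B"] AB(2) by auto
      then have "1 / real n \<in> {0<..1}"
        by auto
      with TB n(2) show False by blast
    qed
    with e(1) e(2)[of 1] show ?thesis
      by (auto simp: cone_scale_one)
  qed
  have "closed (B \<inter> Idem)" "B \<inter> Idem \<noteq> {}"
    using AB part closed_Idem by (auto intro: closed_Int)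
  from closed_has_minimal[OF this] obtain e0 where e0: "e0 \<in> B" "e0 \<in> Idem"
    "\<And>x. x \<in> B \<Longrightarrow> x \<in> Idem \<Longrightarrow> x \<le> e0 \<Longrightarrow> x = e0"
    by auto
  have e0_B: "y = e0" if y: "y \<in> B" "y \<le> e0" for y
  proof -
    obtain e where "e \<in> B" "e \<in> Idem" "e \<le> y"
      using part[OF y(1)] by blast
    moreover from this have "e = e0"
      using y(2) by (intro e0(3)) auto
    ultimately show ?thesis
      using y(2) by simp
  qed
  \<comment> \<open>By minimality of \<open>e0\<close>, everything below \<open>e0\<close> except
    \<open>e0\<close> itself lies in \<open>A\<close>, so \<open>P\<close> is the set of all
    \<open>z < e0\<close>; it is closed and therefore has maximal elements.\<close>
  define P where "P = A \<inter> {z. z \<le> e0}"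
  have "e0 \<le> w"
    using e0(1) AB(3) by auto
  then have P_or: "z \<in> P \<or> z = e0" if "z \<le> e0" for z
  proof -
    have "z \<le> w"
      using that \<open>e0 \<le> w\<close> by simp
    then have "z \<in> A \<union> B"
      unfolding AB(3)[symmetric] by simp
    then show ?thesis
      using that e0_B by (auto simp: P_def)
  qed
  have "e0 \<notin> P"
    using e0(1) AB(4) by (auto simp: P_def)
  have "closed P" "P \<noteq> {}"
    using AB(1,5) unfolding P_def by (auto intro!: closed_Int closed_le_right)
  from closed_has_maximal[OF this] obtain m where m: "m \<in> P" "\<And>x. x \<in> P \<Longrightarrow> m \<le> x \<Longrightarrow> x = m"
    by blast
  have m_le: "m \<le> e0"
    using m(1) by (simp add: P_def)
  have scale_e0: "t *\<^sub>R e0 = e0" if "0 < t" for t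
    using e0(2) that by (rule Idem_scale)
  have m_Idem: "m \<in> Idem"
  proof -
    have "2 *\<^sub>R m \<noteq> e0"
    proof
      assume "2 *\<^sub>R m = e0"
      then have "m = (1 / 2) *\<^sub>R e0"
        using cone_scale_inverse(2)[of 2 m] by simp
      then show False
        using scale_e0 m(1) \<open>e0 \<notin> P\<close> by simp
    qed
    moreover have "2 *\<^sub>R m \<le> e0"
      using cone_scale_mono[OF _ m_le, of 2] scale_e0 by simp
    ultimately have "2 *\<^sub>R m \<in> P"
      using P_or by blast
    moreover have "1 *\<^sub>R m \<le> 2 *\<^sub>R m"
      by (rule cone_scale_mono_left) auto
    ultimately show ?thesis
      using m(2) by (simp add: Idem_def cone_scale_one)
  qed
  have closed_eq: "closed {y. m + y = e0}"
    by (intro closed_Collect_eq continuous_intros)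
  define E where "E = Idem \<inter> {y. y \<le> e0} \<inter> {y. m + y = e0}"
  have "closed E"
    unfolding E_def using closed_Idem closed_le_right closed_eq by (intro closed_Int)
  moreover have "m + e0 = e0"
    by (rule Idem_absorb(2)[OF m_Idem m_le])
  then have "E \<noteq> {}"
    using e0(2) by (auto simp: E_def)
  ultimately have "\<exists>m\<in>E. \<forall>x\<in>E. x \<le> m \<longrightarrow> x = m"
    by (rule closed_has_minimal)
  then obtain e where e: "e \<in> E" "\<And>x. x \<in> E \<Longrightarrow> x \<le> e \<Longrightarrow> x = e"
    by blast
  have "\<not> e \<le> m"
  proof
    assume "e \<le> m"
    then have "m + e = m"
      using e(1) by (intro Idem_absorb(1)) (auto simp: E_def)
    then show False
      using e(1) m(1) \<open>e0 \<notin> P\<close> by (simp add: E_def)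
  qed
  moreover have "z \<le> m \<or> z = e" if z: "z \<le> e" for z
  \<comment> \<open>If \<open>m + z = e0\<close>, the idempotent part of \<open>z\<close> satisfies
    the same equation, so it equals \<open>e\<close> by minimality. Otherwise \<open>m + z\<close>
    lies in \<open>P\<close>, and maximality of \<open>m\<close> gives
    \<open>m + z = m\<close>.\<close>
  proof (cases "m + z = e0")
    case True
    obtain e' where e': "e' \<in> Idem" "\<And>t. 0 < t \<Longrightarrow> e' \<le> t *\<^sub>R z"
      "\<And>U. open U \<Longrightarrow> e' \<in> U \<Longrightarrow> \<exists>n>0. (1 / real n) *\<^sub>R z \<in> U"
      by (rule idempotent_part[of z]) (rule that)
    have "e' \<le> z"
      using e'(2)[of 1] by (simp add: cone_scale_one)
    have "m + e' = e0"
    proof (rule ccontr)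
      assume "m + e' \<noteq> e0"
      then obtain n where n: "0 < n" "m + (1 / real n) *\<^sub>R z \<noteq> e0"
        using e'(3)[of "- {y. m + y = e0}"] closed_eq by auto
      have "m + (1 / real n) *\<^sub>R z = (1 / real n) *\<^sub>R (m + z)"
        using n(1) Idem_scale[OF m_Idem, of "1 / real n"] by (simp add: cone_scale_add_right)
      also have "\<dots> = e0"
        using n(1) True scale_e0 by simp
      finally show False
        using n(2) by simp
    qed
    then have "e' \<in> E"
      using e'(1) \<open>e' \<le> z\<close> z e(1) by (auto simp: E_def)
    then have "e' = e"
      using \<open>e' \<le> z\<close> z by (intro e(2)) auto
    then show ?thesis
      using \<open>e' \<le> z\<close> z by simp
  next
    case False
    have "m + z \<le> m + e"
      using z by (rule add_left_mono)
    then have "m + z \<le> e0"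
      using e(1) by (simp add: E_def)
    then have "m + z \<in> P"
      using False P_or by blast
    then have "m + z = m"
      using le_add_left_cone by (intro m(2))
    then show ?thesis
      using le_add_left_cone[of z m] by (simp add: add.commute)
  qed
  ultimately show thesis
    using e(1) m_Idem by (intro that[of e m]) (auto simp: E_def)
qed

lemma strongly_connected_if_weak_cancellation:
  assumes abundance: "abundance_of_compact_idempotents TYPE('a::extended_choquet_cone)"
    and weak: "weak_cancellation (Lsc_sigma :: ('a \<Rightarrow> ennreal) set)"
  shows "strongly_connected TYPE('a)"
proof (rule ccontr)
  assume "\<not> strongly_connected TYPE('a)"
  then obtain e v :: 'a where ev: "e \<in> Idem" "v \<in> Idem" "\<not> e \<le> v" "\<And>z. z \<le> e \<Longrightarrow> z \<le> v \<or> z = e"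
    by (rule not_strongly_connected_idempotents) (rule that)
  obtain s G1 where s: "s \<in> Lsc_sigma" "\<And>x. x \<in> {e} \<Longrightarrow> 0 < s x" and G1: "open G1" "down_closed G1" "v \<in> G1"
    and s_G1: "\<And>y. y \<in> G1 \<Longrightarrow> s y \<le> 1"
    using Lsc_sigma_separation[OF abundance ev(2), of "{e}"] ev(3) by auto
  have s_lin: "cone_linear s" and s_lsc: "lower_semicontinuous s"
    using s(1) by (simp_all add: Lsc_sigma_def)
  have s_e: "s e = top"
    using cone_linear_Idem[OF s_lin ev(1)] s(2) by (cases "s e") auto
  \<comment> \<open>Halving makes \<open>s\<close> at most \<open>1/2\<close> on this neighbourhood
    of \<open>v\<close>, so points with \<open>1 \<le> s y\<close> lie outside it.\<close>
  define G where "G = {y. 2 *\<^sub>R y \<in> G1}"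
  have "open G"
    unfolding G_def using G1(1) by (intro open_scale_vimage) auto
  have "v \<in> G"
    using ev(2) G1(3) by (simp add: G_def Idem_def)
  have G_down: "x \<in> G" if "y \<in> G" "x \<le> y" for x y
    using that G1(2) cone_scale_mono[of 2 x y] by (auto simp: G_def down_closed_def)
  have not_G: "y \<notin> G" if "1 \<le> s y" for y
  proof
    assume "y \<in> G"
    then have "s (2 *\<^sub>R y) \<le> 1"
      by (intro s_G1) (simp add: G_def)
    then have "2 * s y \<le> 1"
      by (simp add: cone_linear_scale[OF s_lin])
    moreover have "2 * 1 \<le> 2 * s y"
      using that by (intro mult_left_mono) auto
    ultimately have "2 * 1 \<le> (1::ennreal)"
      by (rule order_trans[rotated])
    then show False by simp
  qed
  \<comment> \<open>No point of \<open>Q\<close> is below \<open>e\<close>: such a point is below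
    \<open>v\<close>, hence in \<open>G\<close>, or equals \<open>e\<close>, where \<open>s\<close>
    is infinite. So some function positive on \<open>Q\<close> vanishes at \<open>e\<close>.\<close>
  define Q where "Q = - {y. 2 < s y} \<inter> - G"
  have "closed Q"
    unfolding Q_def using s_lsc \<open>open G\<close>
    by (intro closed_Int closed_Compl) (simp_all add: lower_semicontinuous_def)
  then have Q: "compact Q"
    by (rule closed_imp_compact)
  have Q_e: "\<not> y \<le> e" if "y \<in> Q" for y
  proof
    assume "y \<le> e"
    then show False
      using ev(4)[of y] that G_down[OF \<open>v \<in> G\<close>] s_e by (auto simp: Q_def)
  qed
  obtain g0 G2 where g0: "g0 \<in> Lsc_sigma" "\<And>x. x \<in> Q \<Longrightarrow> 0 < g0 x" and G2: "e \<in> G2" "\<And>y. y \<in> G2 \<Longrightarrow> g0 y \<le> 1"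
    using Lsc_sigma_separation[OF abundance ev(1) Q Q_e] by metis
  have g0_lin: "cone_linear g0" and g0_lsc: "lower_semicontinuous g0"
    using g0(1) by (simp_all add: Lsc_sigma_def)
  have "g0 e \<le> 1"
    using G2 by blast
  also have "(1::ennreal) < top" by simp
  finally have g0_e: "g0 e = 0"
    by (rule cone_linear_Idem[OF g0_lin ev(1)])
  \<comment> \<open>A positive lower semicontinuous function on a compact set is bounded away from
    \<open>0\<close>; a multiple is then at least \<open>4\<close> on \<open>Q\<close>.\<close>
  have "\<exists>N. \<forall>y\<in>Q. ennreal (1 / real (Suc N)) < g0 y"
  proof -
    have ex: "\<exists>n. ennreal (1 / real (Suc n)) < g0 y" if "y \<in> Q" for y
    proof (cases "g0 y")
      case (real r)
      then have "0 < r"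
        using g0(2)[OF that] by (simp add: ennreal_less_zero_iff)
      then obtain n where "1 / real (Suc n) < r"
        using nat_approx_posE by blast
      then show ?thesis
        using real by (intro exI[of _ n]) (auto simp: ennreal_less_iff)
    qed auto
    then obtain n where n: "\<And>y. y \<in> Q \<Longrightarrow> ennreal (1 / real (Suc (n y))) < g0 y"
      by metis
    have "open {z. ennreal (1 / real (Suc (n y))) < g0 z} \<and> y \<in> {z. ennreal (1 / real (Suc (n y))) < g0 z}"
      if "y \<in> Q" for y
      using g0_lsc n[OF that] by (simp add: lower_semicontinuous_def)
    from compact_finite_subcover[OF Q this]
    obtain T where T: "finite T" "Q \<subseteq> (\<Union>y\<in>T. {z. ennreal (1 / real (Suc (n y))) < g0 z})"
      by auto
    obtain N where N: "\<forall>k\<in>n ` T. k \<le> N"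
      using finite_nat_set_iff_bounded_le[of "n ` T"] T(1) by auto
    have "ennreal (1 / real (Suc N)) < g0 z" if "z \<in> Q" for z
    proof -
      obtain y where y: "y \<in> T" "ennreal (1 / real (Suc (n y))) < g0 z"
        using T(2) \<open>z \<in> Q\<close> by auto
      have "1 / real (Suc N) \<le> 1 / real (Suc (n y))"
        using N y(1) by (intro divide_left_mono) auto
      then have "ennreal (1 / real (Suc N)) \<le> ennreal (1 / real (Suc (n y)))"
        by (rule ennreal_leI)
      also note y(2)
      finally show ?thesis .
    qed
    then show ?thesis by blast
  qed
  then obtain N where N: "\<And>y. y \<in> Q \<Longrightarrow> ennreal (1 / real (Suc N)) < g0 y" by blast
  define r where "r = 4 * real (Suc N)"
  have r: "0 < r" by (simp add: r_def)
  define g where "g y = ennreal r * g0 y" for y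
  have g: "g \<in> Lsc_sigma"
    unfolding g_def using g0(1) r by (rule Lsc_sigma_times)
  have g_Q: "4 \<le> g y" if "y \<in> Q" for y
  proof -
    have "ennreal r * ennreal (1 / real (Suc N)) \<le> g y"
      unfolding g_def using N[OF that] by (intro mult_left_mono) auto
    moreover have "ennreal r * ennreal (1 / real (Suc N)) = ennreal (r * (1 / real (Suc N)))"
      using r by (intro ennreal_mult[symmetric]) auto
    moreover have "r * (1 / real (Suc N)) = 4"
      by (simp add: r_def del: of_nat_Suc)
    ultimately show ?thesis by simp
  qed
  have "way_below Lsc_sigma (\<lambda>x. s x + s x) (\<lambda>x. g x + s x)"
    unfolding way_below_def
  proof (intro allI impI)
    fix k :: "nat \<Rightarrow> 'a \<Rightarrow> ennreal"
    assume k: "range k \<subseteq> Lsc_sigma \<and> incseq k \<and> (\<lambda>x. g x + s x) \<le> (SUP n. k n)"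
    then have "k n \<in> Lsc_sigma" for n
      by auto
    then have k_lin: "cone_linear (k n)" and k_lsc: "lower_semicontinuous (k n)" for n
      by (simp_all add: Lsc_sigma_def)
    have k_mono: "k m x \<le> k n x" if "m \<le> n" for m n x
      using k that by (auto simp: incseq_def le_fun_def)
    have k_sup: "g x + s x \<le> (SUP n. k n x)" for x
      using k le_funD[of "\<lambda>x. g x + s x" "SUP n. k n" x] by (simp only: SUP_apply)
    show "\<exists>n. (\<lambda>x. s x + s x) \<le> k n"
    proof (rule ccontr)
      assume "\<nexists>n. (\<lambda>x. s x + s x) \<le> k n"
      then have less: "\<exists>y. k n y < s y + s y" for n
        by (auto simp: le_fun_def not_le)
      \<comment> \<open>A point with \<open>k n y < 2 * s y\<close> can be scaled: to
        \<open>s = 1\<close> if \<open>s y\<close> is finite, and otherwise until \<open>k n\<close>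
        is at most \<open>2\<close>, with \<open>s\<close> still infinite.\<close>
      have T: "\<exists>y. y \<notin> G \<and> k n y \<le> 2" for n
      proof -
        obtain y where y: "k n y < s y + s y"
          using less by blast
        have "\<exists>t>0. 1 \<le> s (t *\<^sub>R y) \<and> k n (t *\<^sub>R y) \<le> 2"
        proof (cases "s y")
          case (real a)
          then have y': "k n y < ennreal (2 * a)"
            using y by (simp flip: ennreal_plus)
          then have "0 < ennreal (2 * a)"
            by (rule order_le_less_trans[rotated]) simp
          then have "0 < a"
            by (simp add: ennreal_less_zero_iff)
          have "s ((1 / a) *\<^sub>R y) = ennreal (1 / a) * ennreal a"
            using \<open>0 < a\<close> real by (simp add: cone_linear_scale[OF s_lin])
          also have "\<dots> = 1"
            using \<open>0 < a\<close> by (simp flip: ennreal_mult)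
          finally have "s ((1 / a) *\<^sub>R y) = 1" .
          moreover have "k n ((1 / a) *\<^sub>R y) \<le> ennreal (1 / a) * ennreal (2 * a)"
            using \<open>0 < a\<close> y' by (auto simp: cone_linear_scale[OF k_lin] intro!: mult_left_mono)
          moreover have "ennreal (1 / a) * ennreal (2 * a) = ennreal 2"
            using \<open>0 < a\<close> by (simp flip: ennreal_mult)
          ultimately show ?thesis
            using \<open>0 < a\<close> by (intro exI[of _ "1 / a"]) auto
        next
          case top
          obtain b where b: "k n y = ennreal b" "0 \<le> b"
            using y by (cases "k n y") auto
          define t where "t = 1 / (b + 1)"
          have t: "0 < t" "t * b \<le> 2"
            using b by (auto simp: t_def field_simps)
          have "k n (t *\<^sub>R y) = ennreal (t * b)"
            using t b by (simp add: cone_linear_scale[OF k_lin] ennreal_mult)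
          also have "\<dots> \<le> ennreal 2"
            using t(2) by (rule ennreal_leI)
          finally show ?thesis
            using t(1) top by (intro exI[of _ t]) (simp add: cone_linear_scale[OF s_lin] ennreal_mult_top)
        qed
        then show ?thesis
          using not_G by blast
      qed
      \<comment> \<open>By compactness one \<open>y\<close> outside \<open>G\<close> works for all
        \<open>n\<close>. Then \<open>g y + s y \<le> 2\<close> puts \<open>y\<close> into
        \<open>Q\<close>, where \<open>g\<close> is at least \<open>4\<close>.\<close>
      have "UNIV \<inter> (\<Inter>n\<in>UNIV. - G \<inter> - {y. 2 < k n y}) \<noteq> {}"
      proof (rule compact_imp_fip_image[OF compact_cone])
        show "closed (- G \<inter> - {y. 2 < k n y})" for n
          using \<open>open G\<close> k_lsc[of n]
          by (intro closed_Int closed_Compl) (simp_all add: lower_semicontinuous_def)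
        fix I :: "nat set" assume "finite I"
        then obtain m where m: "\<forall>n\<in>I. n \<le> m"
          using finite_nat_set_iff_bounded_le by blast
        obtain y where "y \<notin> G" "k m y \<le> 2"
          using T by blast
        moreover have "k n y \<le> 2" if "n \<in> I" for n
          using k_mono[of n m y] m that \<open>k m y \<le> 2\<close> by (auto intro: order_trans)
        ultimately have "y \<in> UNIV \<inter> (\<Inter>n\<in>I. - G \<inter> - {y. 2 < k n y})"
          by (auto simp: not_less)
        then show "UNIV \<inter> (\<Inter>n\<in>I. - G \<inter> - {y. 2 < k n y}) \<noteq> {}" by blast
      qed
      then obtain y where "y \<in> UNIV \<inter> (\<Inter>n\<in>UNIV. - G \<inter> - {y. 2 < k n y})"
        by blast
      then have y: "y \<notin> G" "k n y \<le> 2" for n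
        by (auto simp: not_less)
      have "g y + s y \<le> 2"
        using k_sup[of y] SUP_least[of UNIV "\<lambda>n. k n y" 2] y(2) by (auto intro: order_trans)
      moreover have "s y \<le> g y + s y" "g y \<le> g y + s y"
        by (simp_all add: add_increasing add_increasing2)
      ultimately have "s y \<le> 2" "g y \<le> 2"
        by (blast intro: order_trans)+
      then have "4 \<le> g y"
        using y(1) by (intro g_Q) (auto simp: Q_def not_less)
      then have "(4::ennreal) \<le> 2"
        using \<open>g y \<le> 2\<close> by (rule order_trans)
      then show False by simp
    qed
  qed
  then have "way_below Lsc_sigma s g"
    using weak s(1) g unfolding weak_cancellation_def by blast
  \<comment> \<open>The constant sequence turns the way-below relation into
    \<open>s \<le> g\<close>, which fails at \<open>e\<close>.\<close>
  moreover have "range (\<lambda>n::nat. g) \<subseteq> Lsc_sigma \<and> incseq (\<lambda>n::nat. g) \<and> g \<le> (SUP n::nat. g)"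
    using g by (auto simp: incseq_def)
  ultimately have "\<exists>n::nat. s \<le> g"
    unfolding way_below_def by (elim allE[of _ "\<lambda>n. g"]) blast
  then have "s e \<le> g e"
    by (auto simp: le_fun_def)
  then show False
    by (simp add: s_e g_def g0_e)
qed

theorem theorem5p4:
  assumes "abundance_of_compact_idempotents TYPE('a::extended_choquet_cone)"
  shows "strongly_connected TYPE('a) \<longleftrightarrow>
    weak_cancellation (Lsc_sigma :: ('a \<Rightarrow> ennreal) set)"
  using weak_cancellation_if_strongly_connected strongly_connected_if_weak_cancellation assms
  by blast

end
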